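(* Let $\pi_1:V_1\to X_1$ and $\pi_2:V_2\to X_2$ be two finite-dimensional diffeological vector pseudo-bundles whose fibre dimensions are bounded, and let $(\tilde f,f)$ be a gluing of the former to the latter such that $f$ is a diffeomorphism with its image and the gluing-dual commutativity condition is satisfied, with commutativity diffeomorphism $\Phi_{\cup,*}:(V_1\cup_{\tilde f}V_2)^*\to V_2^*\cup_{\tilde f^*}V_1^*$. Let $\dim_{V^*}$ be the supremum of the dimensions of the fibres of $V_1^*$ and $V_2^*$. Then the map $$\Phi^{\bigwedge}=\Phi_{\cup,\oplus}^{(\dim_{V^*})}\circ\bigoplus_{n=0}^{\dim_{V^*}}\left(\Phi_{\cup,\otimes}^{(\otimes n)}\circ\Phi_{\cup,*}^{\otimes n}\right)\Big|_{\bigwedge(V_1\cup_{\tilde f}V_2)}$$ is a pseudo-bundle diffeomorphism $\bigwedge(V_1\cup_{\tilde f}V_2)\to\bigwedge(V_2)\cup_{\tilde f^{\bigwedge}}\bigwedge(V_1)$ covering the switch map $\varphi_{X_1\leftrightarrow X_2}$.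
   Context: Diffeological spaces, plots, smooth maps, and the subset, quotient, product, disjoint union and functional diffeologies are in the usual sense of Souriau. $E^*$ denotes the space of smooth linear maps $E\to\mathbb R$ on a diffeological vector space $E$, with the functional diffeology. A diffeological vector pseudo-bundle is a smooth surjective map $\pi:V\to X$ of diffeological spaces with a vector space structure on each fibre such that fibrewise addition $V\times_XV\to V$, scalar multiplication $\mathbb R\times V\to V$ and the zero section are smooth. The dual pseudo-bundle is $V^*=\bigcup_{x}(\pi^{-1}(x))^*$ with projection $\pi^*$; $q:U'\to V^*$ is a plot iff for every plot $p:U\to V$ the map $(u',u)\mapsto q(u')(p(u))$ is smooth on the set where $q(u')$ and $p(u)$ lie over the same point. $V\oplus V'$ is $V\times_XV'$ with the subset diffeology; $V\otimes V'$ is the fibrewise tensor product, with the finest pseudo-bundle diffeology making $V\times_XV'\to V\otimes V'$ smooth ($V^{\otimes0}=X\times\mathbb R$). A pseudo-bundle diffeomorphism is a fibrewise linear diffeomorphism of total spaces covering a map of the bases. Gluing. For $h:Z_1\supseteq Y'\to Z_2$ smooth, $Z_1\cup_hZ_2=(Z_1\sqcup Z_2)/(z\sim h(z),\ z\in Y')$ with the quotient of the disjoint union diffeology. The natural inclusions of $Z_1\setminus Y'$ and of $Z_2$ have disjoint images covering it; they are denoted $i_1^{Z_1},i_2^{Z_2}$ for base spaces and $j_1^{Z_1},j_2^{Z_2}$ for total spaces (subscript 1 for the left-hand factor, 2 for the right-hand one). A gluing $(\tilde f,f)$ consists of a smooth $f:X_1\supseteq Y\to X_2$ and a smooth fibrewise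 linear lift $\tilde f:\pi_1^{-1}(Y)\to V_2$ of $f$; it yields the pseudo-bundle $V_1\cup_{\tilde f}V_2\to X_1\cup_fX_2$. The map $\tilde f^*:(\pi_2^* )^{-1}(f(Y))\to V_1^*$ is $\xi\mapsto\xi\circ\tilde f|_{\pi_1^{-1}(y)}$ for $\xi\in(\pi_2^{-1}(f(y)))^*$; it lifts $f^{-1}$ and gives the gluing $V_2^*\cup_{\tilde f^*}V_1^*\to X_2\cup_{f^{-1}}X_1$. The switch map $\varphi_{X_1\leftrightarrow X_2}:X_1\cup_fX_2\to X_2\cup_{f^{-1}}X_1$ is: $i_1^{X_1}(x)\mapsto i_2^{X_1}(x)$ for $x\in X_1\setminus Y$, $i_2^{X_2}(f(x))\mapsto i_2^{X_1}(x)$ for $x\in Y$, $i_2^{X_2}(x)\mapsto i_1^{X_2}(x)$ for $x\in X_2\setminus f(Y)$. The gluing-dual commutativity condition says that the map $\Phi_{\cup,*}:(V_1\cup_{\tilde f}V_2)^*\to V_2^*\cup_{\tilde f^*}V_1^*$ covering the switch map and given by $j_2^{V_1^*}\circ(j_1^{V_1})^*$ over $i_1^{X_1}(X_1\setminus Y)$, by $j_2^{V_1^*}\circ\tilde f^*\circ(j_2^{V_2})^*$ over $i_2^{X_2}(f(Y))$, and by $j_1^{V_2^*}\circ(j_2^{V_2})^*$ over $i_2^{X_2}(X_2\setminus f(Y))$, is a diffeomorphism; $(j_i^{V_i})^*$ is fibrewise pre-composition with $j_i^{V_i}$. Exterior algebras. $\mathrm{Alt}(v_1\otimes\cdots\otimes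 v_n)=\frac1{n!}\sum_\sigma\mathrm{sgn}(\sigma)v_{\sigma(1)}\otimes\cdots\otimes v_{\sigma(n)}$ (fibrewise), $\bigwedge_n(V)=\mathrm{Alt}(V^{\otimes n})$, $\bigwedge_*(V)=\bigoplus_n\bigwedge_n(V)$ with the subset diffeology, and $\bigwedge(V):=\bigwedge_*(V^* )$. $\tilde f^{\bigwedge}$ is the restriction of $\bigoplus_n(\tilde f^* )^{\otimes n}$ to the part of $\bigwedge(V_2)$ over $f(Y)$, with values in $\bigwedge(V_1)$. Commutativity maps. $\Phi_{\cup,\otimes}^{(\otimes n)}:(V_2^*\cup_{\tilde f^*}V_1^* )^{\otimes n}\to(V_2^* )^{\otimes n}\cup_{(\tilde f^* )^{\otimes n}}(V_1^* )^{\otimes n}$ is the fibrewise linear map determined by $\Phi_{\cup,\otimes}^{(\otimes n)}\circ(j_1^{V_2^*})^{\otimes n}=j_1^{(V_2^* )^{\otimes n}}$ and $\Phi_{\cup,\otimes}^{(\otimes n)}\circ(j_2^{V_1^*})^{\otimes n}=j_2^{(V_1^* )^{\otimes n}}$. $\Phi_{\cup,\oplus}^{(k)}:\bigoplus_{n=0}^k\left((V_2^* )^{\otimes n}\cup_{(\tilde f^* )^{\otimes n}}(V_1^* )^{\otimes n}\right)\to\left(\bigoplus_{n=0}^k(V_2^* )^{\otimes n}\right)\cup_{\oplus_n(\tilde f^* )^{\otimes n}}\left(\bigoplus_{n=0}^k(V_1^* )^{\otimes n}\right)$ is determined by the analogous identities for the direct sums of the inclusions $j_1$, $j_2$.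
   Formalization: A plot q of the dual V* is also required to have π*∘q a plot of X; by the evaluation condition alone, zero covectors over any discontinuous map to X would be a plot, so π* would not be smooth and V* would not be a pseudo-bundle. *)

theory Defs
  imports "HOL-Analysis.Analysis" "HOL-Analysis.Finite_Function_Topology"
    "HOL-Combinatorics.Permutations"
    "Jordan_Normal_Form.VS_Connect"
begin

section \<open>Smooth functions on open subsets of Euclidean spaces\<close>

text \<open>Domains of plots are open subsets of \<open>Euclidean_space n\<close>, whose points are the
  sequences vanishing from index \<open>n\<close> on, so that \<open>n\<close> can be quantified over.
  A function is of class \<open>C\<^sup>k\<close> if its iterated partial derivatives of order up to \<open>k\<close>
  exist and are continuous.\<close>

primrec Ck_on :: "nat \<Rightarrow> nat \<Rightarrow> (nat \<Rightarrow> real) set \<Rightarrow> ((nat \<Rightarrow> real) \<Rightarrow> real) \<Rightarrow> bool" where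
  "Ck_on 0 n U f \<longleftrightarrow>
     continuous_map (subtopology (Euclidean_space n) U) euclideanreal f"
| "Ck_on (Suc k) n U f \<longleftrightarrow>
     continuous_map (subtopology (Euclidean_space n) U) euclideanreal f \<and>
     (\<forall>i<n. \<exists>g. (\<forall>u\<in>U. ((\<lambda>t. f (u(i := t))) has_real_derivative g u) (at (u i))) \<and>
                Ck_on k n U g)"

definition smooth_fun :: "nat \<Rightarrow> (nat \<Rightarrow> real) set \<Rightarrow> ((nat \<Rightarrow> real) \<Rightarrow> real) \<Rightarrow> bool" where
  "smooth_fun n U f \<longleftrightarrow> (\<forall>k. Ck_on k n U f)"

definition smooth_param ::
  "nat \<Rightarrow> (nat \<Rightarrow> real) set \<Rightarrow> nat \<Rightarrow> ((nat \<Rightarrow> real) \<Rightarrow> (nat \<Rightarrow> real)) \<Rightarrow> bool" where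
  "smooth_param n U m g \<longleftrightarrow>
     g ` U \<subseteq> topspace (Euclidean_space m) \<and> (\<forall>i<m. smooth_fun n U (\<lambda>u. g u i))"


section \<open>Diffeological spaces\<close>

text \<open>\<open>plots D n U p\<close> says that the restriction of \<open>p\<close> to the open set
  \<open>U\<close> of the \<open>n\<close>-dimensional Euclidean space is a plot; the values of \<open>p\<close>
  outside \<open>U\<close> are irrelevant.\<close>

record 'a dspace =
  pts :: "'a set"
  plots :: "nat \<Rightarrow> (nat \<Rightarrow> real) set \<Rightarrow> ((nat \<Rightarrow> real) \<Rightarrow> 'a) \<Rightarrow> bool"

definition diffeological :: "'a dspace \<Rightarrow> bool" where
  "diffeological D \<longleftrightarrow>
     (\<forall>n U p. plots D n U p \<longrightarrow> openin (Euclidean_space n) U \<and> p ` U \<subseteq> pts D) \<and>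
     (\<forall>n U p q. plots D n U p \<and> (\<forall>u\<in>U. q u = p u) \<longrightarrow> plots D n U q) \<and>
     (\<forall>n U. \<forall>x\<in>pts D. openin (Euclidean_space n) U \<longrightarrow> plots D n U (\<lambda>u. x)) \<and>
     (\<forall>n U p. openin (Euclidean_space n) U \<and>
        (\<forall>u\<in>U. \<exists>W. openin (Euclidean_space n) W \<and> u \<in> W \<and> W \<subseteq> U \<and> plots D n W p)
        \<longrightarrow> plots D n U p) \<and>
     (\<forall>n U p m W g. plots D n U p \<and> openin (Euclidean_space m) W \<and>
        smooth_param m W n g \<and> g ` W \<subseteq> U \<longrightarrow> plots D m W (p \<circ> g))"

definition dsmooth :: "'a dspace \<Rightarrow> 'b dspace \<Rightarrow> ('a \<Rightarrow> 'b) \<Rightarrow> bool" where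
  "dsmooth D E f \<longleftrightarrow>
     f ` pts D \<subseteq> pts E \<and> (\<forall>n U p. plots D n U p \<longrightarrow> plots E n U (f \<circ> p))"

definition ddiffeo :: "'a dspace \<Rightarrow> 'b dspace \<Rightarrow> ('a \<Rightarrow> 'b) \<Rightarrow> bool" where
  "ddiffeo D E f \<longleftrightarrow>
     bij_betw f (pts D) (pts E) \<and> dsmooth D E f \<and> dsmooth E D (inv_into (pts D) f)"

definition dreal :: "real dspace" where
  "dreal = \<lparr>pts = UNIV, plots = (\<lambda>n U p. openin (Euclidean_space n) U \<and> smooth_fun n U p)\<rparr>"

definition ddom :: "nat \<Rightarrow> (nat \<Rightarrow> real) set \<Rightarrow> (nat \<Rightarrow> real) dspace" where
  "ddom n U = \<lparr>pts = U, plots = (\<lambda>m W g. openin (Euclidean_space m) W \<and>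
     smooth_param m W n g \<and> g ` W \<subseteq> U)\<rparr>"

definition dsub :: "'a dspace \<Rightarrow> 'a set \<Rightarrow> 'a dspace" where
  "dsub D S = \<lparr>pts = pts D \<inter> S, plots = (\<lambda>n U p. plots D n U p \<and> p ` U \<subseteq> S)\<rparr>"

definition dprod :: "'a dspace \<Rightarrow> 'b dspace \<Rightarrow> ('a \<times> 'b) dspace" where
  "dprod D E = \<lparr>pts = pts D \<times> pts E,
     plots = (\<lambda>n U p. plots D n U (fst \<circ> p) \<and> plots E n U (snd \<circ> p))\<rparr>"

definition dsum :: "'a dspace \<Rightarrow> 'b dspace \<Rightarrow> ('a + 'b) dspace" where
  "dsum D E = \<lparr>pts = pts D <+> pts E,
     plots = (\<lambda>n U p. openin (Euclidean_space n) U \<and>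
       (\<forall>u\<in>U. \<exists>W. openin (Euclidean_space n) W \<and> u \<in> W \<and> W \<subseteq> U \<and>
          ((\<exists>q. plots D n W q \<and> (\<forall>w\<in>W. p w = Inl (q w))) \<or>
           (\<exists>q. plots E n W q \<and> (\<forall>w\<in>W. p w = Inr (q w))))))\<rparr>"

text \<open>The quotient diffeology on the image of \<open>\<kappa>\<close>, identified with the quotient of \<open>D\<close> by
  the equivalence relation \<open>\<kappa> a = \<kappa> b\<close>.\<close>

definition dquot :: "('a \<Rightarrow> 'b) \<Rightarrow> 'a dspace \<Rightarrow> 'b dspace" where
  "dquot \<kappa> D = \<lparr>pts = \<kappa> ` pts D,
     plots = (\<lambda>n U p. openin (Euclidean_space n) U \<and>
       (\<forall>u\<in>U. \<exists>W q. openin (Euclidean_space n) W \<and> u \<in> W \<and> W \<subseteq> U \<and>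
          plots D n W q \<and> (\<forall>w\<in>W. p w = \<kappa> (q w))))\<rparr>"


section \<open>Gluing of diffeological spaces\<close>

text \<open>The quotient of the disjoint union by \<open>z \<sim> h z\<close>, for \<open>z \<in> Y\<close>, is represented by
  choosing in each class the representative \<open>Inr (h z)\<close> of \<open>Inl z\<close> for \<open>z \<in> Y\<close>;
  \<open>glue_map\<close> is the quotient projection, and the lemma below shows that
  its fibres are the classes. With this choice the natural inclusions of the complement of \<open>Y\<close>
  and of the right-hand factor are \<open>Inl\<close> and \<open>Inr\<close>, both for base spaces and for
  total spaces.\<close>

definition glue_map :: "'a set \<Rightarrow> ('a \<Rightarrow> 'b) \<Rightarrow> 'a + 'b \<Rightarrow> 'a + 'b" where
  "glue_map Y h = case_sum (\<lambda>z. if z \<in> Y then Inr (h z) else Inl z) Inr"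

lemma glue_map_eq_iff:
  fixes Y :: "'a set" and h :: "'a \<Rightarrow> 'b"
  defines "R \<equiv> {(Inl z, Inr (h z)) | z. z \<in> Y}"
  shows "glue_map Y h a = glue_map Y h b \<longleftrightarrow> (a, b) \<in> (R \<union> R\<inverse>)\<^sup>*"
proof
  have step: "(c, glue_map Y h c) \<in> (R \<union> R\<inverse>)\<^sup>*" for c
    by (cases c) (auto simp: glue_map_def R_def)
  have "sym ((R \<union> R\<inverse>)\<^sup>*)"
    by (intro sym_rtrancl sym_Un_converse)
  then have step': "(glue_map Y h c, c) \<in> (R \<union> R\<inverse>)\<^sup>*" for c
    using step by (meson symD)
  assume "glue_map Y h a = glue_map Y h b"
  then show "(a, b) \<in> (R \<union> R\<inverse>)\<^sup>*"
    using step[of a] step'[of b] by (auto intro: rtrancl_trans)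
next
  assume "(a, b) \<in> (R \<union> R\<inverse>)\<^sup>*"
  then show "glue_map Y h a = glue_map Y h b"
    by (induction rule: rtrancl_induct) (auto simp: glue_map_def R_def)
qed

definition dglue :: "'a dspace \<Rightarrow> 'b dspace \<Rightarrow> 'a set \<Rightarrow> ('a \<Rightarrow> 'b) \<Rightarrow> ('a + 'b) dspace" where
  "dglue D E Y h = dquot (glue_map Y h) (dsum D E)"

definition switch_map :: "'x1 set \<Rightarrow> ('x1 \<Rightarrow> 'x2) \<Rightarrow> 'x1 + 'x2 \<Rightarrow> 'x2 + 'x1" where
  "switch_map Y f = case_sum Inr (\<lambda>x. if x \<in> f ` Y then Inr (inv_into Y f x) else Inl x)"


section \<open>Diffeological vector pseudo-bundles\<close>

record ('v, 'x) vbundle =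
  tot :: "'v dspace"
  base :: "'x dspace"
  bproj :: "'v \<Rightarrow> 'x"
  vadd :: "'v \<Rightarrow> 'v \<Rightarrow> 'v"
  vsmul :: "real \<Rightarrow> 'v \<Rightarrow> 'v"
  vzero :: "'x \<Rightarrow> 'v"

definition vert :: "('v, 'x) vbundle \<Rightarrow> 'x \<Rightarrow> 'v set" where
  "vert V x = {v \<in> pts (tot V). bproj V v = x}"

definition over :: "('v, 'x) vbundle \<Rightarrow> 'x set \<Rightarrow> 'v set" where
  "over V S = {v \<in> pts (tot V). bproj V v \<in> S}"

text \<open>\<open>mult\<close> and \<open>one\<close> are part of the type of modules but play no role in a vector space.\<close>

definition fibre :: "('v, 'x) vbundle \<Rightarrow> 'x \<Rightarrow> (real, 'v) module" where
  "fibre V x = \<lparr>carrier = vert V x, mult = undefined, one = undefined,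
     zero = vzero V x, add = vadd V, smult = vsmul V\<rparr>"

definition real_line :: "(real, real) module" where
  "real_line = \<lparr>carrier = UNIV, mult = (*), one = 1, zero = 0, add = (+), smult = (*)\<rparr>"

definition pseudo_bundle :: "('v, 'x) vbundle \<Rightarrow> bool" where
  "pseudo_bundle V \<longleftrightarrow>
     diffeological (tot V) \<and> diffeological (base V) \<and>
     dsmooth (tot V) (base V) (bproj V) \<and> bproj V ` pts (tot V) = pts (base V) \<and>
     (\<forall>x\<in>pts (base V). vectorspace class_ring (fibre V x)) \<and>
     dsmooth (dsub (dprod (tot V) (tot V)) {(v, w). bproj V v = bproj V w}) (tot V)
       (\<lambda>(v, w). vadd V v w) \<and>
     dsmooth (dprod dreal (tot V)) (tot V) (\<lambda>(r, v). vsmul V r v) \<and>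
     dsmooth (base V) (tot V) (vzero V)"

definition bundle_diffeo ::
  "('v, 'x) vbundle \<Rightarrow> ('w, 'y) vbundle \<Rightarrow> ('v \<Rightarrow> 'w) \<Rightarrow> ('x \<Rightarrow> 'y) \<Rightarrow> bool" where
  "bundle_diffeo V W F \<phi> \<longleftrightarrow>
     ddiffeo (tot V) (tot W) F \<and>
     (\<forall>x\<in>pts (base V). \<phi> x \<in> pts (base W) \<and>
        linear_map class_ring (fibre V x) (fibre W (\<phi> x)) F)"

definition sub_bundle :: "('v, 'x) vbundle \<Rightarrow> 'v set \<Rightarrow> ('v, 'x) vbundle" where
  "sub_bundle V S = V\<lparr>tot := dsub (tot V) S\<rparr>"


subsection \<open>Gluing of pseudo-bundles\<close>

definition gluing ::
  "('v1, 'x1) vbundle \<Rightarrow> ('v2, 'x2) vbundle \<Rightarrow> 'x1 set \<Rightarrow> ('x1 \<Rightarrow> 'x2) \<Rightarrow> ('v1 \<Rightarrow> 'v2) \<Rightarrow> bool"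
  where
  "gluing V1 V2 Y f F \<longleftrightarrow>
     Y \<subseteq> pts (base V1) \<and> dsmooth (dsub (base V1) Y) (base V2) f \<and>
     dsmooth (dsub (tot V1) (over V1 Y)) (tot V2) F \<and>
     (\<forall>y\<in>Y. linear_map class_ring (fibre V1 y) (fibre V2 (f y)) F)"

text \<open>The values of \<open>vadd\<close> on pairs of vectors from different fibres are irrelevant.\<close>

definition glue_bundle ::
  "('v1, 'x1) vbundle \<Rightarrow> ('v2, 'x2) vbundle \<Rightarrow> 'x1 set \<Rightarrow> ('x1 \<Rightarrow> 'x2) \<Rightarrow> ('v1 \<Rightarrow> 'v2)
    \<Rightarrow> ('v1 + 'v2, 'x1 + 'x2) vbundle" where
  "glue_bundle V1 V2 Y f F =
     \<lparr>tot = dglue (tot V1) (tot V2) (over V1 Y) F,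
      base = dglue (base V1) (base V2) Y f,
      bproj = map_sum (bproj V1) (bproj V2),
      vadd = (\<lambda>c d. case (c, d) of
                (Inl v, Inl w) \<Rightarrow> Inl (vadd V1 v w)
              | (Inr v, Inr w) \<Rightarrow> Inr (vadd V2 v w)
              | _ \<Rightarrow> undefined),
      vsmul = (\<lambda>r. map_sum (vsmul V1 r) (vsmul V2 r)),
      vzero = map_sum (vzero V1) (vzero V2)\<rparr>"


subsection \<open>Dual pseudo-bundle\<close>

text \<open>A covector is stored together with its base point and is \<open>undefined\<close> outside its
  fibre. That the projection of a plot is a plot of the base has to be asked for separately:
  the condition on evaluations alone is void on zero covectors, and the
  projection of the dual would not be smooth.\<close>

definition dual_bundle :: "('v, 'x) vbundle \<Rightarrow> ('x \<times> ('v \<Rightarrow> real), 'x) vbundle" where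
  "dual_bundle V =
     (let C = {(x, \<xi>). x \<in> pts (base V) \<and> \<xi> \<in> extensional (vert V x) \<and>
                 linear_map class_ring (fibre V x) real_line \<xi> \<and>
                 dsmooth (dsub (tot V) (vert V x)) dreal \<xi>}
      in \<lparr>tot = \<lparr>pts = C,
            plots = (\<lambda>m U q. openin (Euclidean_space m) U \<and> q ` U \<subseteq> C \<and>
              plots (base V) m U (fst \<circ> q) \<and>
              (\<forall>n W p. plots (tot V) n W p \<longrightarrow>
                 dsmooth (dsub (dprod (ddom m U) (ddom n W)) {(u, w). fst (q u) = bproj V (p w)})
                   dreal (\<lambda>(u, w). snd (q u) (p w))))\<rparr>,
          base = base V,
          bproj = fst,
          vadd = (\<lambda>(x, \<xi>) (y, \<eta>). (x, restrict (\<lambda>v. \<xi> v + \<eta> v) (vert V x))),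
          vsmul = (\<lambda>r (x, \<xi>). (x, restrict (\<lambda>v. r * \<xi> v) (vert V x))),
          vzero = (\<lambda>x. (x, restrict (\<lambda>v. 0) (vert V x)))\<rparr>)"


subsection \<open>Tensor powers\<close>

text \<open>The \<open>n\<close>-th tensor power of a vector space is the free vector space on its \<open>n\<close>-tuples
  (lists of length \<open>n\<close>) modulo the subspace \<open>tensor_null\<close> spanned by the multilinearity
  relations.\<close>

abbreviation gen :: "'v list \<Rightarrow> ('v list, real) poly_mapping" where
  "gen l \<equiv> Poly_Mapping.single l 1"

definition lin_ext ::
  "('v list \<Rightarrow> ('w list, real) poly_mapping)
    \<Rightarrow> ('v list, real) poly_mapping \<Rightarrow> ('w list, real) poly_mapping" where
  "lin_ext \<phi> a = (\<Sum>l\<in>Poly_Mapping.keys a. Poly_Mapping.lookup a l *\<^sub>R \<phi> l)"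

definition tuples :: "(real, 'v) module \<Rightarrow> nat \<Rightarrow> 'v list set" where
  "tuples E n = {l. length l = n \<and> set l \<subseteq> carrier E}"

definition tensor_null :: "(real, 'v) module \<Rightarrow> nat \<Rightarrow> ('v list, real) poly_mapping set" where
  "tensor_null E n = real_vector.span
     ({gen (l[i := v \<oplus>\<^bsub>E\<^esub> w]) - gen (l[i := v]) - gen (l[i := w]) | l i v w.
         l \<in> tuples E n \<and> i < n \<and> v \<in> carrier E \<and> w \<in> carrier E} \<union>
      {gen (l[i := r \<odot>\<^bsub>E\<^esub> v]) - r *\<^sub>R gen (l[i := v]) | l i r v.
         l \<in> tuples E n \<and> i < n \<and> v \<in> carrier E})"

definition tensor_class ::
  "(real, 'v) module \<Rightarrow> nat \<Rightarrow> ('v list, real) poly_mapping \<Rightarrow> ('v list, real) poly_mapping set" where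
  "tensor_class E n a = {b. b - a \<in> tensor_null E n}"

definition tensor_space :: "(real, 'v) module \<Rightarrow> nat \<Rightarrow> ('v list, real) poly_mapping set set" where
  "tensor_space E n = tensor_class E n ` real_vector.span (gen ` tuples E n)"

type_synonym ('v, 'x) tensor = "'x \<times> ('v list, real) poly_mapping set"

text \<open>The \<open>n\<close>-fold fibre product; for \<open>n = 0\<close> it is the base.\<close>

definition fibre_power :: "('v, 'x) vbundle \<Rightarrow> nat \<Rightarrow> ('x \<times> 'v list) dspace" where
  "fibre_power V n =
     (let C = {(x, l). x \<in> pts (base V) \<and> l \<in> tuples (fibre V x) n}
      in \<lparr>pts = C,
          plots = (\<lambda>m U p. openin (Euclidean_space m) U \<and> p ` U \<subseteq> C \<and>
            plots (base V) m U (fst \<circ> p) \<and>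
            (\<forall>i<n. plots (tot V) m U (\<lambda>u. snd (p u) ! i)))\<rparr>)"

definition tensor_map :: "('v, 'x) vbundle \<Rightarrow> nat \<Rightarrow> 'x \<times> 'v list \<Rightarrow> ('v, 'x) tensor" where
  "tensor_map V n = (\<lambda>(x, l). (x, tensor_class (fibre V x) n (gen l)))"

definition tensor_bundle_with ::
  "('v, 'x) tensor dspace \<Rightarrow> ('v, 'x) vbundle \<Rightarrow> nat \<Rightarrow> (('v, 'x) tensor, 'x) vbundle" where
  "tensor_bundle_with D V n =
     \<lparr>tot = D,
      base = base V,
      bproj = fst,
      vadd = (\<lambda>(x, A) (y, B). (x, \<Union>a\<in>A. \<Union>b\<in>B. tensor_class (fibre V x) n (a + b))),
      vsmul = (\<lambda>r (x, A). (x, \<Union>a\<in>A. tensor_class (fibre V x) n (r *\<^sub>R a))),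
      vzero = (\<lambda>x. (x, tensor_null (fibre V x) n))\<rparr>"

text \<open>The total space carries the finest pseudo-bundle diffeology for which \<open>tensor_map\<close> is
  smooth, that is, the intersection of all of them. For \<open>n = 0\<close> the fibres are the
  real line spanned by \<open>gen []\<close>, and this diffeology, generated by the section
  \<open>gen []\<close>, is the product one.\<close>

definition tensor_power :: "('v, 'x) vbundle \<Rightarrow> nat \<Rightarrow> (('v, 'x) tensor, 'x) vbundle" where
  "tensor_power V n =
     (let C = {(x, A). x \<in> pts (base V) \<and> A \<in> tensor_space (fibre V x) n}
      in tensor_bundle_with
           \<lparr>pts = C,
            plots = (\<lambda>m U p. \<forall>D. pts D = C \<and> pseudo_bundle (tensor_bundle_with D V n) \<and>
                       dsmooth (fibre_power V n) D (tensor_map V n) \<longrightarrow> plots D m U p)\<rparr> V n)"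

text \<open>The \<open>n\<close>-th tensor power of a fibrewise linear map \<open>g\<close> over \<open>\<phi>\<close> with values in \<open>W\<close>.\<close>

definition tensor_power_map ::
  "('w, 'y) vbundle \<Rightarrow> nat \<Rightarrow> ('x \<Rightarrow> 'y) \<Rightarrow> ('v \<Rightarrow> 'w) \<Rightarrow> ('v, 'x) tensor \<Rightarrow> ('w, 'y) tensor" where
  "tensor_power_map W n \<phi> g = (\<lambda>(x, A).
     (\<phi> x, \<Union>a\<in>A. tensor_class (fibre W (\<phi> x)) n (lin_ext (\<lambda>l. gen (map g l)) a)))"


subsection \<open>Direct sums\<close>

text \<open>An element of the direct sum of the \<open>W n\<close>, \<open>n \<in> I\<close>, is a family of vectors over one
  point of the common base with finitely many nonzero members. Families are
  extended by zero outside the nonempty index set \<open>I\<close>, so that the sum over \<open>{..k}\<close> is contained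
  in the sum over all \<open>n\<close>. The diffeology is that of the fibre product.\<close>

definition direct_sum :: "nat set \<Rightarrow> (nat \<Rightarrow> ('w, 'x) vbundle) \<Rightarrow> (nat \<Rightarrow> 'w, 'x) vbundle" where
  "direct_sum I W =
     (let C = {w. \<exists>x\<in>pts (base (W 0)).
                 (\<forall>n\<in>I. w n \<in> vert (W n) x) \<and> finite {n\<in>I. w n \<noteq> vzero (W n) x} \<and>
                 (\<forall>n. n \<notin> I \<longrightarrow> w n = vzero (W n) x)}
      in \<lparr>tot = \<lparr>pts = C,
            plots = (\<lambda>m U p. openin (Euclidean_space m) U \<and> p ` U \<subseteq> C \<and>
              (\<forall>n\<in>I. plots (tot (W n)) m U (\<lambda>u. p u n)))\<rparr>,
          base = base (W 0),
          bproj = (\<lambda>w. bproj (W 0) (w 0)),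
          vadd = (\<lambda>v w n. vadd (W n) (v n) (w n)),
          vsmul = (\<lambda>r w n. vsmul (W n) r (w n)),
          vzero = (\<lambda>x n. vzero (W n) x)\<rparr>)"

definition direct_sum_map :: "(nat \<Rightarrow> 'v \<Rightarrow> 'w) \<Rightarrow> (nat \<Rightarrow> 'v) \<Rightarrow> (nat \<Rightarrow> 'w)" where
  "direct_sum_map g w = (\<lambda>n. g n (w n))"


subsection \<open>Exterior algebras\<close>

definition Alt :: "('v, 'x) vbundle \<Rightarrow> nat \<Rightarrow> ('v, 'x) tensor \<Rightarrow> ('v, 'x) tensor" where
  "Alt V n = (\<lambda>(x, A). (x, \<Union>a\<in>A. tensor_class (fibre V x) n
     (lin_ext (\<lambda>l. (1 / fact n) *\<^sub>R
        (\<Sum>\<sigma> | \<sigma> permutes {..<n}. of_int (sign \<sigma>) *\<^sub>R gen (permute_list \<sigma> l))) a)))"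

definition ext_power :: "('v, 'x) vbundle \<Rightarrow> nat \<Rightarrow> (('v, 'x) tensor, 'x) vbundle" where
  "ext_power V n = sub_bundle (tensor_power V n) (Alt V n ` pts (tot (tensor_power V n)))"

definition contra_ext :: "('v, 'x) vbundle \<Rightarrow> (nat \<Rightarrow> ('v, 'x) tensor, 'x) vbundle" where
  "contra_ext V = direct_sum UNIV (ext_power V)"

definition ext_bundle ::
  "('v, 'x) vbundle \<Rightarrow> (nat \<Rightarrow> ('x \<times> ('v \<Rightarrow> real), 'x) tensor, 'x) vbundle" where
  "ext_bundle V = contra_ext (dual_bundle V)"


section \<open>Duals of gluings and the commutativity maps\<close>

text \<open>\<open>dual_lift V1 Y f F\<close> is the map \<open>F\<^sup>*\<close>, from the part of the dual of \<open>V2\<close> over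
  \<open>f ` Y\<close> to the dual of \<open>V1\<close>, over the inverse of \<open>f\<close>.\<close>

definition dual_lift ::
  "('v1, 'x1) vbundle \<Rightarrow> 'x1 set \<Rightarrow> ('x1 \<Rightarrow> 'x2) \<Rightarrow> ('v1 \<Rightarrow> 'v2)
    \<Rightarrow> 'x2 \<times> ('v2 \<Rightarrow> real) \<Rightarrow> 'x1 \<times> ('v1 \<Rightarrow> real)" where
  "dual_lift V1 Y f F = (\<lambda>(x, \<xi>).
     (inv_into Y f x, restrict (\<lambda>v. \<xi> (F v)) (vert V1 (inv_into Y f x))))"

definition dual_glue ::
  "('v1, 'x1) vbundle \<Rightarrow> ('v2, 'x2) vbundle \<Rightarrow> 'x1 set \<Rightarrow> ('x1 \<Rightarrow> 'x2) \<Rightarrow> ('v1 \<Rightarrow> 'v2)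
    \<Rightarrow> ('x2 \<times> ('v2 \<Rightarrow> real) + 'x1 \<times> ('v1 \<Rightarrow> real), 'x2 + 'x1) vbundle" where
  "dual_glue V1 V2 Y f F =
     glue_bundle (dual_bundle V2) (dual_bundle V1) (f ` Y) (inv_into Y f) (dual_lift V1 Y f F)"

definition \<Phi>_dual ::
  "('v1, 'x1) vbundle \<Rightarrow> ('v2, 'x2) vbundle \<Rightarrow> 'x1 set \<Rightarrow> ('x1 \<Rightarrow> 'x2) \<Rightarrow> ('v1 \<Rightarrow> 'v2)
    \<Rightarrow> ('x1 + 'x2) \<times> ('v1 + 'v2 \<Rightarrow> real)
    \<Rightarrow> 'x2 \<times> ('v2 \<Rightarrow> real) + 'x1 \<times> ('v1 \<Rightarrow> real)" where
  "\<Phi>_dual V1 V2 Y f F = (\<lambda>(c, \<xi>). case c of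
       Inl x \<Rightarrow> Inr (x, restrict (\<lambda>v. \<xi> (Inl v)) (vert V1 x))
     | Inr x \<Rightarrow>
         (if x \<in> f ` Y then Inr (dual_lift V1 Y f F (x, restrict (\<lambda>v. \<xi> (Inr v)) (vert V2 x)))
          else Inl (x, restrict (\<lambda>v. \<xi> (Inr v)) (vert V2 x))))"

definition gluing_dual_commutes ::
  "('v1, 'x1) vbundle \<Rightarrow> ('v2, 'x2) vbundle \<Rightarrow> 'x1 set \<Rightarrow> ('x1 \<Rightarrow> 'x2) \<Rightarrow> ('v1 \<Rightarrow> 'v2) \<Rightarrow> bool"
  where
  "gluing_dual_commutes V1 V2 Y f F \<longleftrightarrow>
     ddiffeo (tot (dual_bundle (glue_bundle V1 V2 Y f F))) (tot (dual_glue V1 V2 Y f F))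
       (\<Phi>_dual V1 V2 Y f F)"

text \<open>Let \<open>J1\<close>, \<open>J2\<close> map the fibres of \<open>A\<close>, \<open>B\<close> bijectively to those of
  \<open>G\<close> over the images under \<open>Inl\<close> and \<open>Inr\<close> of points of their bases. Then \<open>glue_comm G A B J1 J2\<close>
  is the map \<open>\<Phi>\<close> on \<open>G\<close> determined by \<open>\<Phi> \<circ> J1 = Inl\<close> and \<open>\<Phi> \<circ> J2 = Inr\<close>.\<close>

definition glue_comm ::
  "('e, 'x + 'y) vbundle \<Rightarrow> ('a, 'x) vbundle \<Rightarrow> ('b, 'y) vbundle \<Rightarrow> ('a \<Rightarrow> 'e) \<Rightarrow> ('b \<Rightarrow> 'e)
    \<Rightarrow> 'e \<Rightarrow> 'a + 'b" where
  "glue_comm G A B J1 J2 e = (case bproj G e of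
       Inl x \<Rightarrow> Inl (inv_into (vert A x) J1 e)
     | Inr y \<Rightarrow> Inr (inv_into (vert B y) J2 e))"

lemma glue_comm_determined:
  shows "\<lbrakk>inj_on J1 (vert A x); a \<in> vert A x; bproj G (J1 a) = Inl x\<rbrakk>
           \<Longrightarrow> glue_comm G A B J1 J2 (J1 a) = Inl a"
    and "\<lbrakk>inj_on J2 (vert B y); b \<in> vert B y; bproj G (J2 b) = Inr y\<rbrakk>
           \<Longrightarrow> glue_comm G A B J1 J2 (J2 b) = Inr b"
  by (simp_all add: glue_comm_def)

definition \<Phi>_tensor ::
  "('v1, 'x1) vbundle \<Rightarrow> ('v2, 'x2) vbundle \<Rightarrow> 'x1 set \<Rightarrow> ('x1 \<Rightarrow> 'x2) \<Rightarrow> ('v1 \<Rightarrow> 'v2) \<Rightarrow> nat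
    \<Rightarrow> ('x2 \<times> ('v2 \<Rightarrow> real) + 'x1 \<times> ('v1 \<Rightarrow> real), 'x2 + 'x1) tensor
    \<Rightarrow> ('x2 \<times> ('v2 \<Rightarrow> real), 'x2) tensor + ('x1 \<times> ('v1 \<Rightarrow> real), 'x1) tensor" where
  "\<Phi>_tensor V1 V2 Y f F n =
     (let G = dual_glue V1 V2 Y f F
      in glue_comm (tensor_power G n)
           (tensor_power (dual_bundle V2) n) (tensor_power (dual_bundle V1) n)
           (tensor_power_map G n Inl Inl) (tensor_power_map G n Inr Inr))"

definition dual_lift_power ::
  "('v1, 'x1) vbundle \<Rightarrow> 'x1 set \<Rightarrow> ('x1 \<Rightarrow> 'x2) \<Rightarrow> ('v1 \<Rightarrow> 'v2) \<Rightarrow> nat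
    \<Rightarrow> ('x2 \<times> ('v2 \<Rightarrow> real), 'x2) tensor \<Rightarrow> ('x1 \<times> ('v1 \<Rightarrow> real), 'x1) tensor" where
  "dual_lift_power V1 Y f F n =
     tensor_power_map (dual_bundle V1) n (inv_into Y f) (dual_lift V1 Y f F)"

definition glued_powers ::
  "('v1, 'x1) vbundle \<Rightarrow> ('v2, 'x2) vbundle \<Rightarrow> 'x1 set \<Rightarrow> ('x1 \<Rightarrow> 'x2) \<Rightarrow> ('v1 \<Rightarrow> 'v2) \<Rightarrow> nat
    \<Rightarrow> (('x2 \<times> ('v2 \<Rightarrow> real), 'x2) tensor + ('x1 \<times> ('v1 \<Rightarrow> real), 'x1) tensor,
        'x2 + 'x1) vbundle" where
  "glued_powers V1 V2 Y f F n =
     glue_bundle (tensor_power (dual_bundle V2) n) (tensor_power (dual_bundle V1) n)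
       (f ` Y) (inv_into Y f) (dual_lift_power V1 Y f F n)"

definition \<Phi>_sum ::
  "('v1, 'x1) vbundle \<Rightarrow> ('v2, 'x2) vbundle \<Rightarrow> 'x1 set \<Rightarrow> ('x1 \<Rightarrow> 'x2) \<Rightarrow> ('v1 \<Rightarrow> 'v2) \<Rightarrow> nat
    \<Rightarrow> (nat \<Rightarrow> ('x2 \<times> ('v2 \<Rightarrow> real), 'x2) tensor + ('x1 \<times> ('v1 \<Rightarrow> real), 'x1) tensor)
    \<Rightarrow> (nat \<Rightarrow> ('x2 \<times> ('v2 \<Rightarrow> real), 'x2) tensor)
       + (nat \<Rightarrow> ('x1 \<times> ('v1 \<Rightarrow> real), 'x1) tensor)" where
  "\<Phi>_sum V1 V2 Y f F k =
     glue_comm (direct_sum {..k} (glued_powers V1 V2 Y f F))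
       (direct_sum {..k} (tensor_power (dual_bundle V2)))
       (direct_sum {..k} (tensor_power (dual_bundle V1)))
       (direct_sum_map (\<lambda>n. Inl)) (direct_sum_map (\<lambda>n. Inr))"

definition fibre_dim :: "('v, 'x) vbundle \<Rightarrow> 'x \<Rightarrow> nat" where
  "fibre_dim V x = vectorspace.dim class_ring (fibre V x)"

definition finite_dim_bundle :: "('v, 'x) vbundle \<Rightarrow> bool" where
  "finite_dim_bundle V \<longleftrightarrow>
     (\<forall>x\<in>pts (base V). vectorspace.fin_dim class_ring (fibre V x))"

definition dual_dim :: "('v1, 'x1) vbundle \<Rightarrow> ('v2, 'x2) vbundle \<Rightarrow> nat" where
  "dual_dim V1 V2 = Sup (fibre_dim (dual_bundle V1) ` pts (base V1) \<union>
                         fibre_dim (dual_bundle V2) ` pts (base V2))"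

definition ext_lift ::
  "('v1, 'x1) vbundle \<Rightarrow> 'x1 set \<Rightarrow> ('x1 \<Rightarrow> 'x2) \<Rightarrow> ('v1 \<Rightarrow> 'v2)
    \<Rightarrow> (nat \<Rightarrow> ('x2 \<times> ('v2 \<Rightarrow> real), 'x2) tensor)
    \<Rightarrow> (nat \<Rightarrow> ('x1 \<times> ('v1 \<Rightarrow> real), 'x1) tensor)" where
  "ext_lift V1 Y f F = direct_sum_map (dual_lift_power V1 Y f F)"

text \<open>No truncation at \<open>k = dual_dim V1 V2\<close> is needed in the inner direct sum of maps, as the
  components beyond \<open>k\<close> of elements of the exterior algebra vanish.\<close>

definition \<Phi>_ext ::
  "('v1, 'x1) vbundle \<Rightarrow> ('v2, 'x2) vbundle \<Rightarrow> 'x1 set \<Rightarrow> ('x1 \<Rightarrow> 'x2) \<Rightarrow> ('v1 \<Rightarrow> 'v2)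
    \<Rightarrow> (nat \<Rightarrow> (('x1 + 'x2) \<times> ('v1 + 'v2 \<Rightarrow> real), 'x1 + 'x2) tensor)
    \<Rightarrow> (nat \<Rightarrow> ('x2 \<times> ('v2 \<Rightarrow> real), 'x2) tensor)
       + (nat \<Rightarrow> ('x1 \<times> ('v1 \<Rightarrow> real), 'x1) tensor)" where
  "\<Phi>_ext V1 V2 Y f F =
     \<Phi>_sum V1 V2 Y f F (dual_dim V1 V2) \<circ>
     direct_sum_map (\<lambda>n. \<Phi>_tensor V1 V2 Y f F n \<circ>
       tensor_power_map (dual_glue V1 V2 Y f F) n (switch_map Y f) (\<Phi>_dual V1 V2 Y f F))"

end

theory Submission
  imports Defs
begin

text \<open>The plots of a tensor power are, locally, finite sums of products of smooth functions with
  \<open>n\<close>-tuples of plots over one curve in the base. The inverse of \<open>\<Phi>\<^sup>\<And>\<close> is induced on either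
  side of the gluing by a smooth map from the dual of \<open>V\<^sub>i\<close> to the dual of the glued bundle, and
  is therefore smooth. Conversely, consider a plot of the exterior algebra of the glued bundle
  near a point. If its base curve lifts to \<open>X\<^sub>1\<close>, then so do all covectors in the local sums,
  those lifting to the dual of \<open>V\<^sub>2\<close> being carried over by the dual of \<open>F\<close>. Otherwise all of them
  lift to the dual of \<open>V\<^sub>2\<close>; as only the components up to the dimension bound are nonzero, one
  neighbourhood serves all of them, and alternating the lifts gives a plot of the exterior
  algebra.\<close>

section \<open>Calculus of smooth functions\<close>

text \<open>A tensor power carries the intersection of all admissible diffeologies, which says
  nothing about individual plots; \<open>tensor_diff\<close> makes them concrete, and
  \<open>tensor_diff_least\<close> shows that it is contained in every admissible one. The obstacle
  lies in the gluing. A covector plot lifts locally to one of the two sides, because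
  \<open>\<Phi>_dual\<close> is a diffeomorphism onto the gluing of the duals, but the factors of
  one tensor may lift to different sides and on different neighbourhoods. The choice of side is
  therefore tied to the base curve, which all factors share. A covector plot lifting to the dual of
  \<open>V1\<close> projects to a lift of the base curve to the base of \<open>V1\<close>; where no
  such lift exists, only the dual of \<open>V2\<close> remains. Where one exists, covectors that
  lift to the dual of \<open>V2\<close> lie over f(Y), the domain of the dual of \<open>F\<close>.
  Since an exterior algebra has infinitely many degrees, and an infinite intersection of
  neighbourhoods need not be open, the bound on the dimensions is what leaves a finite
  intersection.\<close>

lemma openin_Euclidean_space_box:
  assumes U: "openin (Euclidean_space n) U" and u: "u \<in> U"
  obtains e where "e > 0"
    "\<And>v. v \<in> topspace (Euclidean_space n) \<Longrightarrow> (\<And>i. i < n \<Longrightarrow> \<bar>v i - u i\<bar> < e) \<Longrightarrow> v \<in> U"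
proof -
  obtain T where T: "openin (powertop_real UNIV) T" "U = T \<inter> {x. \<forall>i\<ge>n. x i = 0}"
    using U unfolding Euclidean_space_def openin_subtopology by blast
  obtain B where B: "\<And>i. open (B i)" "u \<in> Pi\<^sub>E UNIV B" "Pi\<^sub>E UNIV B \<subseteq> T"
    using T u unfolding openin_product_topology_alt by fastforce
  have "\<forall>i. \<exists>e>0. \<forall>y. \<bar>y - u i\<bar> < e \<longrightarrow> y \<in> B i"
    using B(1,2) unfolding open_dist dist_real_def PiE_def by (auto; meson UNIV_I PiE)
  then obtain e where e: "\<And>i. e i > 0" "\<And>i y. \<bar>y - u i\<bar> < e i \<Longrightarrow> y \<in> B i"
    by metis
  \<comment> \<open>The element \<open>1\<close> keeps the minimum defined for
    \<open>n = 0\<close>.\<close>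
  define d where "d = Min (insert 1 (e ` {..<n}))"
  have d: "d > 0" "\<And>i. i < n \<Longrightarrow> d \<le> e i"
    using e(1) by (auto simp: d_def)
  have "v \<in> U" if v: "v \<in> topspace (Euclidean_space n)" "\<And>i. i < n \<Longrightarrow> \<bar>v i - u i\<bar> < d" for v
  proof -
    \<comment> \<open>Coordinates from \<open>n\<close> on vanish at both points, so only finitely
      many radii enter.\<close>
    have "v i \<in> B i" for i
    proof (cases "i < n")
      case True
      then show ?thesis using v(2)[of i] d(2)[of i] e(2) by force
    next
      case False
      then have "v i = u i" using v(1) u T(2) by (simp add: topspace_Euclidean_space)
      then show ?thesis using e by simp
    qed
    then show ?thesis using B(3) v(1) T(2) by (auto simp: topspace_Euclidean_space)
  qed
  with d(1) show thesis by (rule that)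
qed

lemma openin_Euclidean_space_line:
  assumes "openin (Euclidean_space n) U" "u \<in> U" "i < n"
  obtains e where "e > 0" "\<And>t. \<bar>t - u i\<bar> < e \<Longrightarrow> u(i := t) \<in> U"
proof -
  obtain e where e: "e > 0"
    "\<And>v. v \<in> topspace (Euclidean_space n) \<Longrightarrow> (\<And>i. i < n \<Longrightarrow> \<bar>v i - u i\<bar> < e) \<Longrightarrow> v \<in> U"
    using openin_Euclidean_space_box[OF assms(1,2)] by metis
  have "u \<in> topspace (Euclidean_space n)"
    using assms openin_subset by blast
  then have "u(i := t) \<in> U" if "\<bar>t - u i\<bar> < e" for t
    using that e assms(3) by (intro e(2)) (auto simp: topspace_Euclidean_space)
  with e(1) show thesis by (rule that)
qed

text \<open>An open set contains a segment of every coordinate line through each of its points, so a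
  partial derivative sees only values in \<open>U\<close>. This makes being of class C^k a property
  of the restriction to \<open>U\<close>.\<close>

lemma has_real_derivative_line_cong:
  assumes "openin (Euclidean_space n) U" "u \<in> U" "i < n" "\<And>v. v \<in> U \<Longrightarrow> f v = g v"
    and "((\<lambda>t. f (u(i := t))) has_real_derivative d) (at (u i))"
  shows "((\<lambda>t. g (u(i := t))) has_real_derivative d) (at (u i))"
proof -
  obtain e where "e > 0" and e: "\<And>t. \<bar>t - u i\<bar> < e \<Longrightarrow> u(i := t) \<in> U"
    using openin_Euclidean_space_line[OF assms(1-3)] by metis
  show ?thesis
  proof (rule has_field_derivative_transform_within[OF assms(5) \<open>e > 0\<close>])
    show "f (u(i := t)) = g (u(i := t))" if "dist t (u i) < e" for t
      using that e assms(4) by (simp add: dist_real_def)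
  qed simp
qed

lemma continuous_map_local:
  assumes "\<And>x. x \<in> topspace X \<Longrightarrow> \<exists>W. openin X W \<and> x \<in> W \<and> continuous_map (subtopology X W) Y f"
  shows "continuous_map X Y f"
  unfolding continuous_map_def
proof (intro conjI allI impI)
  show "f \<in> topspace X \<rightarrow> topspace Y"
  proof
    fix x assume x: "x \<in> topspace X"
    then obtain W where "openin X W" "x \<in> W" "continuous_map (subtopology X W) Y f"
      using assms by blast
    then show "f x \<in> topspace Y"
      using x by (auto simp: continuous_map_def Pi_iff)
  qed
next
  fix V assume V: "openin Y V"
  show "openin X {x \<in> topspace X. f x \<in> V}"
  proof (subst openin_subopen, safe)
    fix x assume x: "x \<in> topspace X" "f x \<in> V"
    then obtain W where W: "openin X W" "x \<in> W" "continuous_map (subtopology X W) Y f"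
      using assms by blast
    have "openin (subtopology X W) {y \<in> topspace (subtopology X W). f y \<in> V}"
      using W(3) V by (rule openin_continuous_map_preimage)
    then have "openin X {y \<in> topspace (subtopology X W). f y \<in> V}"
      using W(1) openin_trans_full by blast
    then show "\<exists>T. openin X T \<and> x \<in> T \<and> T \<subseteq> {x \<in> topspace X. f x \<in> V}"
      using x W(2) by (intro exI conjI) (assumption, auto)
  qed
qed

section \<open>Functions of class C^k: restriction, sums, products and locality\<close>

lemma Ck_on_continuous: "Ck_on k n U f \<Longrightarrow> continuous_map (subtopology (Euclidean_space n) U) euclideanreal f"
  by (cases k) auto

lemma Ck_on_cong:
  assumes "openin (Euclidean_space n) U" "\<And>u. u \<in> U \<Longrightarrow> f u = g u" "Ck_on k n U f"
  shows "Ck_on k n U g"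
proof -
  have "continuous_map (subtopology (Euclidean_space n) U) euclideanreal g"
    by (rule continuous_map_eq[OF Ck_on_continuous[OF assms(3)]]) (use assms in auto)
  then show ?thesis
    using assms(3) has_real_derivative_line_cong[OF assms(1), of _ _ f g] assms(2)
    by (cases k) (simp, simp, meson)
qed

text \<open>The product and chain rules multiply a derivative, one class lower, by one of the
  original functions, which therefore has to be weakened to that class.\<close>

lemma Ck_on_Suc_imp: "Ck_on (Suc k) n U f \<Longrightarrow> Ck_on k n U f"
proof (induction k arbitrary: f)
  case (Suc k)
  show ?case
    unfolding Ck_on.simps(2)[of k]
  proof (intro conjI allI impI)
    show "continuous_map (subtopology (Euclidean_space n) U) euclideanreal f"
      by (rule Ck_on_continuous[OF Suc.prems])
    fix i assume "i < n"
    then obtain g where "\<forall>u\<in>U. ((\<lambda>t. f (u(i := t))) has_real_derivative g u) (at (u i))"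
      "Ck_on (Suc k) n U g"
      using Suc.prems unfolding Ck_on.simps(2)[of "Suc k"] by blast
    then show "\<exists>g. (\<forall>u\<in>U. ((\<lambda>t. f (u(i := t))) has_real_derivative g u) (at (u i))) \<and> Ck_on k n U g"
      using Suc.IH by blast
  qed
qed simp

lemma Ck_on_subset: "Ck_on k n U f \<Longrightarrow> W \<subseteq> U \<Longrightarrow> Ck_on k n W f"
proof (induction k arbitrary: f)
  case 0
  then show ?case by (auto intro: continuous_map_from_subtopology_mono)
next
  case (Suc k)
  have "continuous_map (subtopology (Euclidean_space n) W) euclideanreal f"
    using Suc.prems by (auto intro: continuous_map_from_subtopology_mono)
  moreover have "\<exists>g. (\<forall>u\<in>W. ((\<lambda>t. f (u(i := t))) has_real_derivative g u) (at (u i))) \<and> Ck_on k n W g"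
    if "i < n" for i
  proof -
    obtain g where "\<forall>u\<in>U. ((\<lambda>t. f (u(i := t))) has_real_derivative g u) (at (u i))" "Ck_on k n U g"
      using Suc.prems(1) \<open>i < n\<close> unfolding Ck_on.simps by blast
    with Suc.IH Suc.prems(2) show ?thesis by (intro exI[of _ g]) blast
  qed
  ultimately show ?case by simp
qed

lemma Ck_on_const: "Ck_on k n U (\<lambda>_. c)"
  by (induction k arbitrary: c) (auto intro!: exI[of _ "\<lambda>_. 0"])

lemma Ck_on_coord: "Ck_on k n U (\<lambda>u. u i)"
proof -
  have c: "continuous_map (subtopology (Euclidean_space n) U) euclideanreal (\<lambda>u. u i)"
    unfolding Euclidean_space_def
    by (intro continuous_map_from_subtopology continuous_map_product_projection) simp
  show ?thesis
  proof (cases k)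
    case (Suc l)
    have "\<exists>g. (\<forall>u\<in>U. ((\<lambda>t. (u(j := t)) i) has_real_derivative g u) (at (u j))) \<and> Ck_on l n U g" for j
      by (intro exI[of _ "\<lambda>_. if i = j then 1 else 0"]) (auto simp: Ck_on_const)
    with c Suc show ?thesis by simp
  qed (simp add: c)
qed

lemma Ck_on_add: "Ck_on k n U f \<Longrightarrow> Ck_on k n U g \<Longrightarrow> Ck_on k n U (\<lambda>u. f u + g u)"
proof (induction k arbitrary: f g)
  case (Suc k)
  show ?case
    unfolding Ck_on.simps
  proof (intro conjI allI impI)
    show "continuous_map (subtopology (Euclidean_space n) U) euclideanreal (\<lambda>u. f u + g u)"
      using Suc.prems by (intro continuous_map_add) (auto intro: Ck_on_continuous)
    fix i assume "i < n"
    obtain f' where f': "\<forall>u\<in>U. ((\<lambda>t. f (u(i := t))) has_real_derivative f' u) (at (u i))" "Ck_on k n U f'"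
      using Suc.prems(1) \<open>i < n\<close> unfolding Ck_on.simps by blast
    obtain g' where g': "\<forall>u\<in>U. ((\<lambda>t. g (u(i := t))) has_real_derivative g' u) (at (u i))" "Ck_on k n U g'"
      using Suc.prems(2) \<open>i < n\<close> unfolding Ck_on.simps by blast
    show "\<exists>h. (\<forall>u\<in>U. ((\<lambda>t. f (u(i := t)) + g (u(i := t))) has_real_derivative h u) (at (u i))) \<and> Ck_on k n U h"
    proof (intro exI conjI ballI)
      show "((\<lambda>t. f (u(i := t)) + g (u(i := t))) has_real_derivative f' u + g' u) (at (u i))"
        if "u \<in> U" for u
        using DERIV_add[OF f'(1)[rule_format, OF that] g'(1)[rule_format, OF that]] by simp
      show "Ck_on k n U (\<lambda>u. f' u + g' u)"
        by (rule Suc.IH[OF f'(2) g'(2)])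
    qed
  qed
qed (auto intro: continuous_map_add)

lemma Ck_on_mult: "Ck_on k n U f \<Longrightarrow> Ck_on k n U g \<Longrightarrow> Ck_on k n U (\<lambda>u. f u * g u)"
proof (induction k arbitrary: f g)
  case (Suc k)
  show ?case
    unfolding Ck_on.simps
  proof (intro conjI allI impI)
    show "continuous_map (subtopology (Euclidean_space n) U) euclideanreal (\<lambda>u. f u * g u)"
      using Suc.prems by (intro continuous_map_real_mult) (auto intro: Ck_on_continuous)
    fix i assume "i < n"
    obtain f' where f': "\<forall>u\<in>U. ((\<lambda>t. f (u(i := t))) has_real_derivative f' u) (at (u i))" "Ck_on k n U f'"
      using Suc.prems(1) \<open>i < n\<close> unfolding Ck_on.simps by blast
    obtain g' where g': "\<forall>u\<in>U. ((\<lambda>t. g (u(i := t))) has_real_derivative g' u) (at (u i))" "Ck_on k n U g'"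
      using Suc.prems(2) \<open>i < n\<close> unfolding Ck_on.simps by blast
    show "\<exists>h. (\<forall>u\<in>U. ((\<lambda>t. f (u(i := t)) * g (u(i := t))) has_real_derivative h u) (at (u i))) \<and> Ck_on k n U h"
    proof (intro exI conjI ballI)
      show "((\<lambda>t. f (u(i := t)) * g (u(i := t))) has_real_derivative f' u * g u + g' u * f u) (at (u i))"
        if "u \<in> U" for u
        using DERIV_mult[OF f'(1)[rule_format, OF that] g'(1)[rule_format, OF that]] by simp
      show "Ck_on k n U (\<lambda>u. f' u * g u + g' u * f u)"
        by (rule Ck_on_add[OF Suc.IH[OF f'(2) Ck_on_Suc_imp[OF Suc.prems(2)]]
              Suc.IH[OF g'(2) Ck_on_Suc_imp[OF Suc.prems(1)]]])
    qed
  qed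
qed (auto intro: continuous_map_real_mult)

lemma Ck_on_sum: "finite I \<Longrightarrow> (\<And>i. i \<in> I \<Longrightarrow> Ck_on k n U (f i)) \<Longrightarrow> Ck_on k n U (\<lambda>u. \<Sum>i\<in>I. f i u)"
  by (induction I rule: finite_induct) (auto simp: Ck_on_const intro: Ck_on_add)

lemma Ck_on_local:
  assumes "openin (Euclidean_space n) U"
    and "\<And>u. u \<in> U \<Longrightarrow> \<exists>W. openin (Euclidean_space n) W \<and> u \<in> W \<and> W \<subseteq> U \<and> Ck_on k n W f"
  shows "Ck_on k n U f"
  using assms(2)
proof (induction k arbitrary: f)
  case 0
  have "continuous_map (subtopology (Euclidean_space n) U) euclideanreal f"
  proof (rule continuous_map_local)
    fix u assume "u \<in> topspace (subtopology (Euclidean_space n) U)"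
    then obtain W where W: "openin (Euclidean_space n) W" "u \<in> W" "W \<subseteq> U" "Ck_on 0 n W f"
      using 0 by auto
    then show "\<exists>W. openin (subtopology (Euclidean_space n) U) W \<and> u \<in> W \<and>
        continuous_map (subtopology (subtopology (Euclidean_space n) U) W) euclideanreal f"
      by (intro exI[of _ W])
        (auto simp: openin_subset_topspace_eq subtopology_subtopology Int_absorb1 intro: openin_subset_topspace_eq openin_open_subtopology subset_openin_subtopology)
  qed
  then show ?case by simp
next
  case (Suc k)
  have "Ck_on k n U f"
  proof (rule Suc.IH)
    fix u assume "u \<in> U"
    from Suc.prems[OF this] obtain W where "openin (Euclidean_space n) W" "u \<in> W" "W \<subseteq> U" "Ck_on (Suc k) n W f"
      by (elim exE conjE)
    then show "\<exists>W. openin (Euclidean_space n) W \<and> u \<in> W \<and> W \<subseteq> U \<and> Ck_on k n W f"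
      using Ck_on_Suc_imp[of k n W f] by (intro exI[of _ W] conjI)
  qed
  then have c: "continuous_map (subtopology (Euclidean_space n) U) euclideanreal f"
    by (rule Ck_on_continuous)
  have "\<exists>g. (\<forall>u\<in>U. ((\<lambda>t. f (u(i := t))) has_real_derivative g u) (at (u i))) \<and> Ck_on k n U g" if i: "i < n" for i
  proof (intro exI conjI ballI)
    \<comment> \<open>By uniqueness of derivatives, \<open>deriv\<close> agrees with the witness on
      each neighbourhood and so glues the local witnesses to a global one.\<close>
    let ?g = "\<lambda>u. deriv (\<lambda>t. f (u(i := t))) (u i)"
    have *: "\<exists>W. openin (Euclidean_space n) W \<and> u \<in> W \<and> W \<subseteq> U \<and> Ck_on k n W ?g \<and>
         ((\<lambda>t. f (u(i := t))) has_real_derivative ?g u) (at (u i))" if u: "u \<in> U" for u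
    proof -
      from Suc.prems[OF u] obtain W
        where W: "openin (Euclidean_space n) W" "u \<in> W" "W \<subseteq> U" "Ck_on (Suc k) n W f"
        by (elim exE conjE)
      then obtain g where g: "\<forall>u\<in>W. ((\<lambda>t. f (u(i := t))) has_real_derivative g u) (at (u i))" "Ck_on k n W g"
        using i unfolding Ck_on.simps by blast
      have eq: "g v = ?g v" if "v \<in> W" for v
        using DERIV_imp_deriv[OF g(1)[rule_format, OF that]] by simp
      show ?thesis
        using W(1-3) g(1) eq[OF W(2)] Ck_on_cong[OF W(1) eq g(2)] by (intro exI[of _ W]) auto
    qed
    show "((\<lambda>t. f (u(i := t))) has_real_derivative ?g u) (at (u i))" if "u \<in> U" for u
      using *[OF that] by (elim exE conjE)
    show "Ck_on k n U ?g"
    proof (rule Suc.IH)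
      show "\<exists>W. openin (Euclidean_space n) W \<and> u \<in> W \<and> W \<subseteq> U \<and> Ck_on k n W ?g" if "u \<in> U" for u
        using *[OF that] by (elim exE conjE) (intro exI conjI)
    qed
  qed
  with c show ?case by simp
qed

section \<open>The chain rule for a function with continuous partial derivatives\<close>

lemma mean_value_either_order:
  fixes h :: "real \<Rightarrow> real"
  assumes "\<And>z. \<bar>z - a\<bar> \<le> \<bar>b - a\<bar> \<Longrightarrow> (h has_real_derivative h' z) (at z)"
  shows "\<exists>z. \<bar>z - a\<bar> \<le> \<bar>b - a\<bar> \<and> h b - h a = h' z * (b - a)"
proof (cases a b rule: linorder_cases)
  case less
  then obtain z where "a < z" "z < b" "h b - h a = (b - a) * h' z"
    using MVT2[of a b h h'] assms by force
  then show ?thesis by (intro exI[of _ z]) auto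
next
  case greater
  then obtain z where "b < z" "z < a" "h a - h b = (a - b) * h' z"
    using MVT2[of b a h h'] assms by force
  then show ?thesis by (intro exI[of _ z]) (auto simp: algebra_simps)
qed auto

text \<open>The increment from \<open>c t0\<close> to \<open>c t\<close> is split into moves along
  one coordinate at a time. The mean value theorem turns each move into a value of one partial
  derivative times the increment of that coordinate, and continuity of the partial derivatives gives
  the limit.\<close>

lemma has_real_derivative_partials:
  assumes U: "openin (Euclidean_space n) U" and c0: "c t0 \<in> U"
    and cU: "eventually (\<lambda>t. c t \<in> topspace (Euclidean_space n)) (at t0)"
    and c': "\<And>j. j < n \<Longrightarrow> ((\<lambda>t. c t j) has_real_derivative c' j) (at t0)"
    and G: "\<And>j u. j < n \<Longrightarrow> u \<in> U \<Longrightarrow> ((\<lambda>t. f (u(j := t))) has_real_derivative G j u) (at (u j))"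
    and Gc: "\<And>j. j < n \<Longrightarrow> continuous_map (subtopology (Euclidean_space n) U) euclideanreal (G j)"
  shows "((\<lambda>t. f (c t)) has_real_derivative (\<Sum>j<n. G j (c t0) * c' j)) (at t0)"
proof -
  \<comment> \<open>The \<open>j\<close>-th corner of the path of coordinate moves: the first
    \<open>j\<close> coordinates are already those of \<open>c t\<close>.\<close>
  define mix where "mix j t i = (if i < j then c t i else c t0 i)" for j t i
  have c0E: "c t0 \<in> topspace (Euclidean_space n)"
    using U c0 openin_subset by blast
  have mix0: "mix j t0 = c t0" for j by (auto simp: mix_def)
  have mixSuc: "mix (Suc j) t = (mix j t)(j := c t j)" "(mix j t)(j := c t0 j) = mix j t" for j t
    by (auto simp: mix_def)
  have step: "((\<lambda>t. f (mix (Suc j) t) - f (mix j t)) has_real_derivative G j (c t0) * c' j) (at t0)"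
    if j: "j < n" for j
  proof -
    let ?D = "\<lambda>t. f (mix (Suc j) t) - f (mix j t)"
    \<comment> \<open>A difference quotient in the \<open>j\<close>-th coordinate, completed by its
      expected limit where that coordinate does not move; the factorization \<open>Dg\<close> then
      holds without dividing by zero.\<close>
    define g where "g t = (if c t j = c t0 j then G j (c t0) else ?D t / (c t j - c t0 j))" for t
    have Dg: "?D t = g t * (c t j - c t0 j)" for t
    proof (cases "c t j = c t0 j")
      case True
      then have "mix (Suc j) t = mix j t" unfolding mixSuc by (simp add: mix_def fun_eq_iff)
      then show ?thesis using True by simp
    qed (simp add: g_def)
    have "g \<midarrow>t0\<rightarrow> G j (c t0)"
    proof (rule tendstoI)
      fix \<epsilon> :: real assume "\<epsilon> > 0"
      let ?B = "{u \<in> topspace (subtopology (Euclidean_space n) U). G j u \<in> ball (G j (c t0)) \<epsilon>}"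
      have "openin (subtopology (Euclidean_space n) U) ?B"
        by (rule openin_continuous_map_preimage[OF Gc[OF j]]) simp
      then have "openin (Euclidean_space n) ?B"
        using U openin_trans_full by blast
      moreover have "c t0 \<in> ?B"
        using c0 c0E \<open>\<epsilon> > 0\<close> by simp
      ultimately obtain e where "e > 0" and e: "\<And>v. v \<in> topspace (Euclidean_space n) \<Longrightarrow>
          (\<And>i. i < n \<Longrightarrow> \<bar>v i - c t0 i\<bar> < e) \<Longrightarrow> v \<in> ?B"
        by (rule openin_Euclidean_space_box) blast
      have "eventually (\<lambda>t. \<bar>c t i - c t0 i\<bar> < e) (at t0)" if "i < n" for i
      proof -
        have "((\<lambda>t. c t i) \<longlongrightarrow> c t0 i) (at t0)"
          using DERIV_isCont[OF c'[OF that]] by (simp add: isCont_def)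
        from tendstoD[OF this \<open>e > 0\<close>] show ?thesis by (simp add: dist_real_def)
      qed
      then have "eventually (\<lambda>t. \<forall>i\<in>{..<n}. \<bar>c t i - c t0 i\<bar> < e) (at t0)"
        by (intro eventually_ball_finite) auto
      with cU show "eventually (\<lambda>t. dist (g t) (G j (c t0)) < \<epsilon>) (at t0)"
      proof eventually_elim
        case (elim t)
        show ?case
        proof (cases "c t j = c t0 j")
          case False
          \<comment> \<open>Every coordinate of an intermediate point stays within \<open>e\<close>
            of that of \<open>c t0\<close>, so \<open>G j\<close> is there within \<epsilon> of its
            value at \<open>c t0\<close>.\<close>
          have B: "(mix j t)(j := z) \<in> ?B" if "\<bar>z - c t0 j\<bar> \<le> \<bar>c t j - c t0 j\<bar>" for z
          proof (rule e)
            show "(mix j t)(j := z) \<in> topspace (Euclidean_space n)"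
              using j elim(1) c0E by (auto simp: topspace_Euclidean_space mix_def)
            show "\<bar>((mix j t)(j := z)) i - c t0 i\<bar> < e" if "i < n" for i
              using elim(2) that \<open>e > 0\<close> \<open>\<bar>z - c t0 j\<bar> \<le> _\<close> by (auto simp: mix_def intro: le_less_trans)
          qed
          have "\<exists>z. \<bar>z - c t0 j\<bar> \<le> \<bar>c t j - c t0 j\<bar> \<and>
              f ((mix j t)(j := c t j)) - f ((mix j t)(j := c t0 j))
              = G j ((mix j t)(j := z)) * (c t j - c t0 j)"
          proof (rule mean_value_either_order)
            fix z assume "\<bar>z - c t0 j\<bar> \<le> \<bar>c t j - c t0 j\<bar>"
            then have "(mix j t)(j := z) \<in> U" using B by auto
            from G[OF j this] show "((\<lambda>s. f ((mix j t)(j := s))) has_real_derivative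
                G j ((mix j t)(j := z))) (at z)" by simp
          qed
          then obtain z where z: "\<bar>z - c t0 j\<bar> \<le> \<bar>c t j - c t0 j\<bar>"
            "?D t = G j ((mix j t)(j := z)) * (c t j - c t0 j)"
            unfolding mixSuc by blast
          then have "g t = G j ((mix j t)(j := z))"
            using False by (simp add: g_def)
          then show ?thesis using B[OF z(1)] by (simp add: dist_commute)
        qed (simp add: g_def \<open>\<epsilon> > 0\<close>)
      qed
    qed
    moreover have "(\<lambda>t. (c t j - c t0 j) / (t - t0)) \<midarrow>t0\<rightarrow> c' j"
      using c'[OF j] by (simp add: has_field_derivative_iff)
    ultimately have "(\<lambda>t. g t * ((c t j - c t0 j) / (t - t0))) \<midarrow>t0\<rightarrow> G j (c t0) * c' j"
      by (rule tendsto_mult)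
    then show ?thesis
      unfolding has_field_derivative_iff Dg by simp
  qed
  have "((\<lambda>t. f (mix j t)) has_real_derivative (\<Sum>i<j. G i (c t0) * c' i)) (at t0)" if "j \<le> n" for j
    using that
  proof (induction j)
    case 0
    then show ?case by (simp add: mix_def)
  next
    case (Suc j)
    then have "((\<lambda>t. f (mix j t) + (f (mix (Suc j) t) - f (mix j t))) has_real_derivative
        (\<Sum>i<j. G i (c t0) * c' i) + G j (c t0) * c' j) (at t0)"
      by (intro DERIV_add step) auto
    then show ?case by simp
  qed
  from this[of n] have *: "((\<lambda>t. f (mix n t)) has_real_derivative (\<Sum>i<n. G i (c t0) * c' i)) (at t0)"
    by simp
  have "eventually (\<lambda>t. f (mix n t) = f (c t)) (nhds t0)"
    unfolding eventually_nhds_conv_at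
  proof
    show "eventually (\<lambda>t. f (mix n t) = f (c t)) (at t0)"
      using cU
    proof eventually_elim
      case (elim t)
      then have "mix n t = c t"
        using c0E by (auto simp: mix_def topspace_Euclidean_space fun_eq_iff)
      then show ?case by simp
    qed
  qed (simp add: mix0)
  then show ?thesis
    using * by (simp add: DERIV_cong_ev[OF refl _ refl])
qed

lemma continuous_map_components:
  assumes "g ` U \<subseteq> topspace (Euclidean_space m)"
    and "\<And>i. i < m \<Longrightarrow> continuous_map (subtopology (Euclidean_space n) U) euclideanreal (\<lambda>u. g u i)"
  shows "continuous_map (subtopology (Euclidean_space n) U) (Euclidean_space m) g"
  unfolding Euclidean_space_def[of m] continuous_map_in_subtopology continuous_map_componentwise_UNIV
proof (intro conjI allI)
  show "continuous_map (subtopology (Euclidean_space n) U) euclideanreal (\<lambda>u. g u i)" for i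
  proof (cases "i < m")
    case False
    show ?thesis
      by (rule continuous_map_eq[of _ _ "\<lambda>_. 0"]) (use assms(1) False in \<open>auto simp: topspace_Euclidean_space\<close>)
  qed (rule assms(2))
qed (use assms(1) in \<open>auto simp: topspace_Euclidean_space\<close>)

text \<open>By the chain rule, a partial derivative of the composite is a sum of products of some
  \<open>G j\<close> composed with \<open>g\<close> and a partial derivative of \<open>g j\<close>.
  All factors have one class less, which is why the induction on \<open>k\<close> runs over all
  \<open>f\<close>.\<close>

lemma Ck_on_compose:
  assumes "openin (Euclidean_space n) U" "openin (Euclidean_space m) W" "g ` W \<subseteq> U"
    and "\<And>j. j < n \<Longrightarrow> Ck_on k m W (\<lambda>w. g w j)" and "Ck_on k n U f"
  shows "Ck_on k m W (\<lambda>w. f (g w))"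
  using assms(4,5)
proof (induction k arbitrary: f)
  have gE: "g ` W \<subseteq> topspace (Euclidean_space n)"
    using assms(1,3) openin_subset by blast
  have cont: "continuous_map (subtopology (Euclidean_space m) W) euclideanreal (\<lambda>w. f (g w))"
    if "\<And>j. j < n \<Longrightarrow> Ck_on k m W (\<lambda>w. g w j)" and "Ck_on k n U f" for f k
  proof -
    have "continuous_map (subtopology (Euclidean_space m) W) (subtopology (Euclidean_space n) U) g"
      unfolding continuous_map_in_subtopology
      using continuous_map_components[OF gE, of m] Ck_on_continuous[OF that(1)] assms(3)
      by auto
    from continuous_map_compose[OF this Ck_on_continuous[OF that(2)]] show ?thesis
      by (simp add: o_def)
  qed
  {
    case 0
    then show ?case using cont[of 0 f] by simp
  next
    case (Suc k)
    have "\<forall>j. \<exists>G. j < n \<longrightarrow> (\<forall>u\<in>U. ((\<lambda>t. f (u(j := t))) has_real_derivative G u) (at (u j))) \<and> Ck_on k n U G"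
      using Suc.prems(2) unfolding Ck_on.simps by blast
    from choice[OF this] obtain G where
      G: "\<forall>j. j < n \<longrightarrow> (\<forall>u\<in>U. ((\<lambda>t. f (u(j := t))) has_real_derivative G j u) (at (u j))) \<and> Ck_on k n U (G j)"
      by (rule exE)
    have GC: "Ck_on k n U (G j)" if "j < n" for j
      using G that by blast
    have "\<exists>h. (\<forall>w\<in>W. ((\<lambda>t. f (g (w(i := t)))) has_real_derivative h w) (at (w i))) \<and> Ck_on k m W h"
      if i: "i < m" for i
    proof -
      have "\<forall>j. \<exists>g'. j < n \<longrightarrow> (\<forall>w\<in>W. ((\<lambda>t. g (w(i := t)) j) has_real_derivative g' w) (at (w i))) \<and> Ck_on k m W g'"
        using Suc.prems(1) i unfolding Ck_on.simps by blast
      from choice[OF this] obtain g' where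
        g': "\<forall>j. j < n \<longrightarrow> (\<forall>w\<in>W. ((\<lambda>t. g (w(i := t)) j) has_real_derivative g' j w) (at (w i))) \<and> Ck_on k m W (g' j)"
        by (rule exE)
      have gC: "Ck_on k m W (g' j)" if "j < n" for j
        using g' that by blast
      have "Ck_on k m W (\<lambda>w. \<Sum>j<n. G j (g w) * g' j w)"
        using Suc.IH[OF Ck_on_Suc_imp[OF Suc.prems(1)] GC] gC
        by (intro Ck_on_sum Ck_on_mult) auto
      moreover have "((\<lambda>t. f (g (w(i := t)))) has_real_derivative (\<Sum>j<n. G j (g w) * g' j w)) (at (w i))"
        if w: "w \<in> W" for w
      proof -
        obtain e where e: "e > 0" "\<And>t. \<bar>t - w i\<bar> < e \<Longrightarrow> w(i := t) \<in> W"
          using openin_Euclidean_space_line[OF assms(2) w i] by metis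
        have "((\<lambda>t. f (g (w(i := t)))) has_real_derivative (\<Sum>j<n. G j (g (w(i := w i))) * g' j w)) (at (w i))"
        proof (rule has_real_derivative_partials[OF assms(1)])
          show "eventually (\<lambda>t. g (w(i := t)) \<in> topspace (Euclidean_space n)) (at (w i))"
            unfolding eventually_at using e gE by (intro exI[of _ e]) (auto simp: dist_real_def)
          show "g (w(i := w i)) \<in> U"
            using w assms(3) by auto
          show "((\<lambda>t. g (w(i := t)) j) has_real_derivative g' j w) (at (w i))" if "j < n" for j
            using g' w that by blast
          show "((\<lambda>t. f (u(j := t))) has_real_derivative G j u) (at (u j))" if "j < n" "u \<in> U" for j u
            using G that by blast
          show "continuous_map (subtopology (Euclidean_space n) U) euclideanreal (G j)" if "j < n" for j
            using Ck_on_continuous[OF GC[OF that]] .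
        qed
        then show ?thesis by simp
      qed
      ultimately show ?thesis by (intro exI conjI ballI)
    qed
    with cont[OF Suc.prems] show ?case by simp
  }
qed

section \<open>Smooth functions and smooth parametrizations\<close>

lemma smooth_fun_cong:
  "openin (Euclidean_space n) U \<Longrightarrow> smooth_fun n U f \<Longrightarrow> (\<And>u. u \<in> U \<Longrightarrow> f u = g u) \<Longrightarrow> smooth_fun n U g"
  unfolding smooth_fun_def using Ck_on_cong by blast

lemma smooth_fun_subset: "smooth_fun n U f \<Longrightarrow> W \<subseteq> U \<Longrightarrow> smooth_fun n W f"
  unfolding smooth_fun_def using Ck_on_subset by blast

lemma smooth_fun_const: "smooth_fun n U (\<lambda>_. c)"
  unfolding smooth_fun_def using Ck_on_const by blast

lemma smooth_fun_coord: "smooth_fun n U (\<lambda>u. u i)"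
  unfolding smooth_fun_def using Ck_on_coord by blast

lemma smooth_fun_add: "smooth_fun n U f \<Longrightarrow> smooth_fun n U g \<Longrightarrow> smooth_fun n U (\<lambda>u. f u + g u)"
  unfolding smooth_fun_def using Ck_on_add by blast

lemma smooth_fun_mult: "smooth_fun n U f \<Longrightarrow> smooth_fun n U g \<Longrightarrow> smooth_fun n U (\<lambda>u. f u * g u)"
  unfolding smooth_fun_def using Ck_on_mult by blast

lemma smooth_fun_local:
  "openin (Euclidean_space n) U \<Longrightarrow>
   (\<And>u. u \<in> U \<Longrightarrow> \<exists>W. openin (Euclidean_space n) W \<and> u \<in> W \<and> W \<subseteq> U \<and> smooth_fun n W f) \<Longrightarrow>
   smooth_fun n U f"
  unfolding smooth_fun_def using Ck_on_local by metis

lemma smooth_fun_compose: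
  "openin (Euclidean_space n) U \<Longrightarrow> openin (Euclidean_space m) W \<Longrightarrow> g ` W \<subseteq> U \<Longrightarrow>
   smooth_param m W n g \<Longrightarrow> smooth_fun n U f \<Longrightarrow> smooth_fun m W (\<lambda>w. f (g w))"
  unfolding smooth_fun_def smooth_param_def using Ck_on_compose by metis

lemma smooth_param_id: "openin (Euclidean_space n) U \<Longrightarrow> smooth_param n U n (\<lambda>u. u)"
  unfolding smooth_param_def using smooth_fun_coord openin_subset by fastforce

lemma smooth_param_compose:
  assumes "openin (Euclidean_space n) U" "openin (Euclidean_space m) W" "g ` W \<subseteq> U"
    and "smooth_param m W n g" "smooth_param n U l h"
  shows "smooth_param m W l (\<lambda>w. h (g w))"
  unfolding smooth_param_def
proof (intro conjI allI impI)
  show "(\<lambda>w. h (g w)) ` W \<subseteq> topspace (Euclidean_space l)"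
    using assms(3,5) unfolding smooth_param_def by blast
  show "smooth_fun m W (\<lambda>w. h (g w) i)" if "i < l" for i
    by (rule smooth_fun_compose[OF assms(1-4)]) (use assms(5) that in \<open>simp add: smooth_param_def\<close>)
qed

lemma smooth_param_subset: "smooth_param n U m g \<Longrightarrow> W \<subseteq> U \<Longrightarrow> smooth_param n W m g"
  unfolding smooth_param_def using smooth_fun_subset by blast

text \<open>Components of a smooth parametrization are continuous. The openness obtained here
  transports local data back along a reparametrization.\<close>

lemma smooth_param_vimage:
  assumes "openin (Euclidean_space m) W" "smooth_param m W n g" "openin (Euclidean_space n) U"
  shows "openin (Euclidean_space m) {w \<in> W. g w \<in> U}"
proof -
  have "Ck_on 0 m W (\<lambda>w. g w i)" if "i < n" for i
    using assms(2) that unfolding smooth_param_def smooth_fun_def by blast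
  then have "continuous_map (subtopology (Euclidean_space m) W) (Euclidean_space n) g"
    using assms(2) unfolding smooth_param_def by (intro continuous_map_components) auto
  then have "openin (subtopology (Euclidean_space m) W)
      {w \<in> topspace (subtopology (Euclidean_space m) W). g w \<in> U}"
    using assms(3) by (rule openin_continuous_map_preimage)
  moreover have "topspace (subtopology (Euclidean_space m) W) = W"
    using assms(1) openin_subset by auto
  ultimately show ?thesis
    using assms(1) openin_trans_full by fastforce
qed

section \<open>Diffeologies\<close>

lemma diffeologicalI:
  assumes "\<And>n U p. plots D n U p \<Longrightarrow> openin (Euclidean_space n) U"
    and "\<And>n U p u. plots D n U p \<Longrightarrow> u \<in> U \<Longrightarrow> p u \<in> pts D"
    and "\<And>n U p q. plots D n U p \<Longrightarrow> (\<And>u. u \<in> U \<Longrightarrow> q u = p u) \<Longrightarrow> plots D n U q"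
    and "\<And>n U x. x \<in> pts D \<Longrightarrow> openin (Euclidean_space n) U \<Longrightarrow> plots D n U (\<lambda>_. x)"
    and "\<And>n U p. openin (Euclidean_space n) U \<Longrightarrow>
      (\<And>u. u \<in> U \<Longrightarrow> \<exists>W. openin (Euclidean_space n) W \<and> u \<in> W \<and> W \<subseteq> U \<and> plots D n W p) \<Longrightarrow> plots D n U p"
    and "\<And>n U p m W g. plots D n U p \<Longrightarrow> openin (Euclidean_space m) W \<Longrightarrow> smooth_param m W n g \<Longrightarrow>
      g ` W \<subseteq> U \<Longrightarrow> plots D m W (\<lambda>w. p (g w))"
  shows "diffeological D"
  unfolding diffeological_def o_def
proof (intro conjI allI impI ballI)
  fix n U p q assume "plots D n U p \<and> (\<forall>u\<in>U. q u = p u)"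
  then show "plots D n U q" using assms(3)[of n U p q] by simp
next
  fix n U p assume *: "openin (Euclidean_space n) U \<and>
    (\<forall>u\<in>U. \<exists>W. openin (Euclidean_space n) W \<and> u \<in> W \<and> W \<subseteq> U \<and> plots D n W p)"
  show "plots D n U p" by (rule assms(5)) (simp_all add: *)
next
  fix n U p m W g assume *: "plots D n U p \<and> openin (Euclidean_space m) W \<and> smooth_param m W n g \<and> g ` W \<subseteq> U"
  show "plots D m W (\<lambda>w. p (g w))" by (rule assms(6)[of n U]) (simp_all add: *)
qed (use assms(1,2,4) in auto)

context
  fixes D :: "'a dspace"
  assumes D: "diffeological D"
begin

lemma plots_open: "plots D n U p \<Longrightarrow> openin (Euclidean_space n) U"
  using D[unfolded diffeological_def, THEN conjunct1, rule_format, of n U p] by auto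

lemma plots_in: "plots D n U p \<Longrightarrow> u \<in> U \<Longrightarrow> p u \<in> pts D"
  using D[unfolded diffeological_def, THEN conjunct1, rule_format, of n U p] by auto

lemma plots_cong:
  assumes "plots D n U p" "\<And>u. u \<in> U \<Longrightarrow> q u = p u"
  shows "plots D n U q"
  by (rule D[unfolded diffeological_def, THEN conjunct2, THEN conjunct1, rule_format, of n U p q])
    (simp add: assms)

lemma plots_const: "x \<in> pts D \<Longrightarrow> openin (Euclidean_space n) U \<Longrightarrow> plots D n U (\<lambda>_. x)"
  using D[unfolded diffeological_def, THEN conjunct2, THEN conjunct2, THEN conjunct1, rule_format, of x n U]
  by simp

lemma plots_local:
  assumes "openin (Euclidean_space n) U"
    and "\<And>u. u \<in> U \<Longrightarrow> \<exists>W. openin (Euclidean_space n) W \<and> u \<in> W \<and> W \<subseteq> U \<and> plots D n W p"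
  shows "plots D n U p"
  by (rule D[unfolded diffeological_def, THEN conjunct2, THEN conjunct2, THEN conjunct2, THEN conjunct1,
        rule_format, of n U p]) (simp add: assms)

lemma plots_compose:
  assumes "plots D n U p" "openin (Euclidean_space m) W" "smooth_param m W n g" "g ` W \<subseteq> U"
  shows "plots D m W (\<lambda>w. p (g w))"
  using D[unfolded diffeological_def, THEN conjunct2, THEN conjunct2, THEN conjunct2, THEN conjunct2,
        rule_format, of n U p m W g] assms by (simp add: o_def)

lemma plots_subset:
  assumes "plots D n U p" "openin (Euclidean_space n) W" "W \<subseteq> U"
  shows "plots D n W p"
  using plots_compose[OF assms(1,2) smooth_param_id[OF assms(2)]] assms(3) by simp

end

lemma dsmooth_plots: "dsmooth D E f \<Longrightarrow> plots D n U p \<Longrightarrow> plots E n U (\<lambda>u. f (p u))"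
  unfolding dsmooth_def o_def by blast

lemma dsmoothI:
  assumes "\<And>x. x \<in> pts D \<Longrightarrow> f x \<in> pts E"
    and "\<And>n U p. plots D n U p \<Longrightarrow> plots E n U (\<lambda>u. f (p u))"
  shows "dsmooth D E f"
  unfolding dsmooth_def o_def using assms by blast

lemma pts_dsub [simp]: "pts (dsub D S) = pts D \<inter> S"
  by (simp add: dsub_def)

lemma plots_dsub: "plots (dsub D S) n U p \<longleftrightarrow> plots D n U p \<and> (\<forall>u\<in>U. p u \<in> S)"
  by (auto simp: dsub_def)

lemma pts_dprod [simp]: "pts (Defs.dprod D E) = pts D \<times> pts E"
  by (simp add: Defs.dprod_def)

lemma plots_dprod: "plots (Defs.dprod D E) n U p \<longleftrightarrow>
    plots D n U (\<lambda>u. fst (p u)) \<and> plots E n U (\<lambda>u. snd (p u))"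
  by (simp add: Defs.dprod_def o_def)

lemma pts_dreal [simp]: "pts dreal = UNIV"
  by (simp add: dreal_def)

lemma plots_dreal: "plots dreal n U p \<longleftrightarrow> openin (Euclidean_space n) U \<and> smooth_fun n U p"
  by (simp add: dreal_def)

lemma pts_ddom [simp]: "pts (ddom n U) = U"
  by (simp add: ddom_def)

lemma plots_ddom: "plots (ddom n U) m W g \<longleftrightarrow>
    openin (Euclidean_space m) W \<and> smooth_param m W n g \<and> g ` W \<subseteq> U"
  by (simp add: ddom_def)

lemma diffeological_dsub:
  assumes D: "diffeological D"
  shows "diffeological (dsub D S)"
proof (rule diffeologicalI)
  fix n U p assume *: "openin (Euclidean_space n) U"
    "\<And>u. u \<in> U \<Longrightarrow> \<exists>W. openin (Euclidean_space n) W \<and> u \<in> W \<and> W \<subseteq> U \<and> plots (dsub D S) n W p"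
  have "plots D n U p"
  proof (rule plots_local[OF D *(1)])
    fix u assume "u \<in> U"
    from *(2)[OF this] obtain W where
      "openin (Euclidean_space n) W" "u \<in> W" "W \<subseteq> U" "plots (dsub D S) n W p"
      by (elim exE conjE)
    then show "\<exists>W. openin (Euclidean_space n) W \<and> u \<in> W \<and> W \<subseteq> U \<and> plots D n W p"
      by (intro exI[of _ W] conjI) (simp_all add: plots_dsub)
  qed
  moreover have "p u \<in> S" if "u \<in> U" for u
    using *(2)[OF that] by (elim exE conjE) (simp add: plots_dsub)
  ultimately show "plots (dsub D S) n U p"
    by (simp add: plots_dsub)
next
  fix n U p q assume "plots (dsub D S) n U p" "\<And>u. u \<in> U \<Longrightarrow> q u = p u"
  then show "plots (dsub D S) n U q"
    using plots_cong[OF D, of n U p q] by (simp add: plots_dsub)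
next
  fix n U p m W g assume "plots (dsub D S) n U p" "openin (Euclidean_space m) W"
    "smooth_param m W n g" "g ` W \<subseteq> U"
  then show "plots (dsub D S) m W (\<lambda>w. p (g w))"
    using plots_compose[OF D, of n U p m W g] by (auto simp: plots_dsub)
next
  fix n U p u assume p: "plots (dsub D S) n U p"
  then show "openin (Euclidean_space n) U"
    using plots_open[OF D, of n U p] by (simp add: plots_dsub)
  show "p u \<in> pts (dsub D S)" if "u \<in> U"
    using p plots_in[OF D _ that, of n p] that by (simp add: plots_dsub)
qed (simp add: plots_dsub plots_const[OF D])

section \<open>Gluing of diffeological spaces\<close>

lemma glue_map_simps [simp]:
  "z \<in> Y \<Longrightarrow> glue_map Y h (Inl z) = Inr (h z)"
  "z \<notin> Y \<Longrightarrow> glue_map Y h (Inl z) = Inl z"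
  "glue_map Y h (Inr w) = Inr w"
  by (auto simp: glue_map_def)

lemma pts_dglue: "pts (dglue D E Y h) = (\<lambda>z. glue_map Y h (Inl z)) ` pts D \<union> Inr ` pts E"
  unfolding dglue_def dquot_def dsum_def by (auto simp: Plus_def image_Un image_image)

text \<open>The localizations in the quotient and in the disjoint union are merged into one. What
  results is the dichotomy behind all later arguments: locally, a plot of a gluing lifts to the left
  or to the right factor.\<close>

lemma plots_dglue:
  assumes D: "diffeological D" and E: "diffeological E"
  shows "plots (dglue D E Y h) n U p \<longleftrightarrow> openin (Euclidean_space n) U \<and>
    (\<forall>u\<in>U. \<exists>W. openin (Euclidean_space n) W \<and> u \<in> W \<and> W \<subseteq> U \<and>
      ((\<exists>q. plots D n W q \<and> (\<forall>w\<in>W. p w = glue_map Y h (Inl (q w)))) \<or>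
       (\<exists>q. plots E n W q \<and> (\<forall>w\<in>W. p w = Inr (q w)))))" (is "?l \<longleftrightarrow> ?r")
proof
  assume ?l
  then have U: "openin (Euclidean_space n) U"
    and *: "\<forall>u\<in>U. \<exists>W q. openin (Euclidean_space n) W \<and> u \<in> W \<and> W \<subseteq> U \<and>
          plots (dsum D E) n W q \<and> (\<forall>w\<in>W. p w = glue_map Y h (q w))"
    unfolding dglue_def dquot_def dspace.simps by blast+
  show ?r
  proof (intro conjI ballI U)
    fix u assume "u \<in> U"
    then obtain W q where W: "openin (Euclidean_space n) W" "u \<in> W" "W \<subseteq> U"
      and q: "plots (dsum D E) n W q" "\<forall>w\<in>W. p w = glue_map Y h (q w)"
      using * by blast
    obtain W' where W': "openin (Euclidean_space n) W'" "u \<in> W'" "W' \<subseteq> W"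
      and "(\<exists>r. plots D n W' r \<and> (\<forall>w\<in>W'. q w = Inl (r w))) \<or>
           (\<exists>r. plots E n W' r \<and> (\<forall>w\<in>W'. q w = Inr (r w)))"
      using q(1) W(2) unfolding dsum_def dspace.simps by blast
    then have "((\<exists>r. plots D n W' r \<and> (\<forall>w\<in>W'. p w = glue_map Y h (Inl (r w)))) \<or>
       (\<exists>r. plots E n W' r \<and> (\<forall>w\<in>W'. p w = Inr (r w))))"
    proof (elim disjE exE conjE)
      fix r assume r: "plots D n W' r" "\<forall>w\<in>W'. q w = Inl (r w)"
      have "\<forall>w\<in>W'. p w = glue_map Y h (Inl (r w))"
        using r(2) q(2) W'(3) by auto
      then show ?thesis using r(1) by blast
    next
      fix r assume r: "plots E n W' r" "\<forall>w\<in>W'. q w = Inr (r w)"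
      have "\<forall>w\<in>W'. p w = Inr (r w)"
        using r(2) q(2) W'(3) by auto
      then show ?thesis using r(1) by blast
    qed
    then show "\<exists>W. openin (Euclidean_space n) W \<and> u \<in> W \<and> W \<subseteq> U \<and>
      ((\<exists>q. plots D n W q \<and> (\<forall>w\<in>W. p w = glue_map Y h (Inl (q w)))) \<or>
       (\<exists>q. plots E n W q \<and> (\<forall>w\<in>W. p w = Inr (q w))))"
      using W W' by (intro exI[of _ W']) blast
  qed
next
  assume r: ?r
  have "\<exists>W q. openin (Euclidean_space n) W \<and> u \<in> W \<and> W \<subseteq> U \<and>
          plots (dsum D E) n W q \<and> (\<forall>w\<in>W. p w = glue_map Y h (q w))" if "u \<in> U" for u
  proof -
    from r[THEN conjunct2, THEN bspec, OF that]
    obtain W where W: "openin (Euclidean_space n) W" "u \<in> W" "W \<subseteq> U"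
      and "((\<exists>q. plots D n W q \<and> (\<forall>w\<in>W. p w = glue_map Y h (Inl (q w)))) \<or>
       (\<exists>q. plots E n W q \<and> (\<forall>w\<in>W. p w = Inr (q w))))"
      by (elim exE conjE)
    then consider q where "plots D n W q" "\<forall>w\<in>W. p w = glue_map Y h (Inl (q w))"
      | q where "plots E n W q" "\<forall>w\<in>W. p w = Inr (q w)" by blast
    then show ?thesis
    proof cases
      case 1
      then have "plots (dsum D E) n W (\<lambda>w. Inl (q w))"
        using W by (auto simp: dsum_def)
      then show ?thesis using 1 W by blast
    next
      case 2
      then have "plots (dsum D E) n W (\<lambda>w. Inr (q w))"
        using W by (auto simp: dsum_def)
      moreover have "\<forall>w\<in>W. p w = glue_map Y h (Inr (q w))"
        using 2 by simp
      ultimately show ?thesis using W by blast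
    qed
  qed
  then show ?l
    using r[THEN conjunct1] by (simp add: dglue_def dquot_def)
qed

lemma plots_dglueE:
  assumes D: "diffeological D" and E: "diffeological E"
    and "plots (dglue D E Y h) n U p" "u \<in> U"
  obtains (left) W q where "openin (Euclidean_space n) W" "u \<in> W" "W \<subseteq> U" "plots D n W q"
      "\<And>w. w \<in> W \<Longrightarrow> p w = glue_map Y h (Inl (q w))"
    | (right) W q where "openin (Euclidean_space n) W" "u \<in> W" "W \<subseteq> U" "plots E n W q"
      "\<And>w. w \<in> W \<Longrightarrow> p w = Inr (q w)"
proof -
  from assms(3)[unfolded plots_dglue[OF D E], THEN conjunct2, THEN bspec, OF assms(4)]
  obtain W where W: "openin (Euclidean_space n) W" "u \<in> W" "W \<subseteq> U"
    and "((\<exists>q. plots D n W q \<and> (\<forall>w\<in>W. p w = glue_map Y h (Inl (q w)))) \<or>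
     (\<exists>q. plots E n W q \<and> (\<forall>w\<in>W. p w = Inr (q w))))"
    by (elim exE conjE)
  then show thesis
    using left[OF W] right[OF W] by (elim disjE exE conjE) simp_all
qed

lemma plots_dglue_left:
  assumes D: "diffeological D" and E: "diffeological E" and "plots D n U q"
  shows "plots (dglue D E Y h) n U (\<lambda>u. glue_map Y h (Inl (q u)))"
  unfolding plots_dglue[OF D E] using assms(3) plots_open[OF D assms(3)] by blast

lemma plots_dglue_right:
  assumes D: "diffeological D" and E: "diffeological E" and "plots E n U q"
  shows "plots (dglue D E Y h) n U (\<lambda>u. Inr (q u))"
  unfolding plots_dglue[OF D E] using assms(3) plots_open[OF E assms(3)] by blast

lemma diffeological_dglue:
  assumes D: "diffeological D" and E: "diffeological E"
  shows "diffeological (dglue D E Y h)"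
proof (rule diffeologicalI)
  fix n U p assume p: "plots (dglue D E Y h) n U p"
  show "openin (Euclidean_space n) U"
    using p by (simp add: plots_dglue[OF D E])
  show "p u \<in> pts (dglue D E Y h)" if "u \<in> U" for u
    using D E p that
  proof (cases rule: plots_dglueE)
    case (left W q)
    then show ?thesis using plots_in[OF D left(4,2)] by (auto simp: pts_dglue)
  next
    case (right W q)
    then show ?thesis using plots_in[OF E right(4,2)] by (auto simp: pts_dglue)
  qed
  show "plots (dglue D E Y h) n U q" if "\<And>u. u \<in> U \<Longrightarrow> q u = p u" for q
    unfolding plots_dglue[OF D E]
  proof (intro conjI ballI)
    show "openin (Euclidean_space n) U"
      using p by (simp add: plots_dglue[OF D E])
    fix u assume "u \<in> U"
    from p[unfolded plots_dglue[OF D E], THEN conjunct2, THEN bspec, OF this]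
    obtain W where W: "openin (Euclidean_space n) W" "u \<in> W" "W \<subseteq> U"
      "((\<exists>q. plots D n W q \<and> (\<forall>w\<in>W. p w = glue_map Y h (Inl (q w)))) \<or>
       (\<exists>q. plots E n W q \<and> (\<forall>w\<in>W. p w = Inr (q w))))"
      by (elim exE conjE)
    moreover have "\<forall>w\<in>W. q w = p w" using that W(3) by blast
    ultimately show "\<exists>W. openin (Euclidean_space n) W \<and> u \<in> W \<and> W \<subseteq> U \<and>
      ((\<exists>r. plots D n W r \<and> (\<forall>w\<in>W. q w = glue_map Y h (Inl (r w)))) \<or>
       (\<exists>r. plots E n W r \<and> (\<forall>w\<in>W. q w = Inr (r w))))"
      by (intro exI[of _ W]) simp
  qed
next
  fix n U x assume x: "x \<in> pts (dglue D E Y h)" and U: "openin (Euclidean_space n) U"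
  then consider z where "z \<in> pts D" "x = glue_map Y h (Inl z)" | z where "z \<in> pts E" "x = Inr z"
    by (auto simp: pts_dglue)
  then show "plots (dglue D E Y h) n U (\<lambda>_. x)"
  proof cases
    case 1
    then show ?thesis using plots_dglue_left[OF D E plots_const[OF D _ U]] by simp
  next
    case 2
    then show ?thesis using plots_dglue_right[OF D E plots_const[OF E _ U]] by simp
  qed
next
  fix n U p assume U: "openin (Euclidean_space n) U"
    and *: "\<And>u. u \<in> U \<Longrightarrow> \<exists>W. openin (Euclidean_space n) W \<and> u \<in> W \<and> W \<subseteq> U \<and> plots (dglue D E Y h) n W p"
  show "plots (dglue D E Y h) n U p"
    unfolding plots_dglue[OF D E]
  proof (intro conjI ballI U)
    fix u assume "u \<in> U"
    from *[OF this]
    obtain W where W: "openin (Euclidean_space n) W" "u \<in> W" "W \<subseteq> U" "plots (dglue D E Y h) n W p"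
      by (elim exE conjE)
    from W(4)[unfolded plots_dglue[OF D E], THEN conjunct2, THEN bspec, OF W(2)]
    obtain W' where "openin (Euclidean_space n) W'" "u \<in> W'" "W' \<subseteq> W"
      "((\<exists>q. plots D n W' q \<and> (\<forall>w\<in>W'. p w = glue_map Y h (Inl (q w)))) \<or>
       (\<exists>q. plots E n W' q \<and> (\<forall>w\<in>W'. p w = Inr (q w))))"
      by (elim exE conjE)
    then show "\<exists>W. openin (Euclidean_space n) W \<and> u \<in> W \<and> W \<subseteq> U \<and>
      ((\<exists>q. plots D n W q \<and> (\<forall>w\<in>W. p w = glue_map Y h (Inl (q w)))) \<or>
       (\<exists>q. plots E n W q \<and> (\<forall>w\<in>W. p w = Inr (q w))))"
      using W(3) by (intro exI[of _ W']) auto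
  qed
next
  fix n U p m W g assume p: "plots (dglue D E Y h) n U p"
    and W: "openin (Euclidean_space m) W" and g: "smooth_param m W n g" "g ` W \<subseteq> U"
  show "plots (dglue D E Y h) m W (\<lambda>w. p (g w))"
    unfolding plots_dglue[OF D E]
  proof (intro conjI ballI W)
    fix w assume w: "w \<in> W"
    then have "g w \<in> U" using g(2) by blast
    have vi: "openin (Euclidean_space m) {x \<in> W. g x \<in> W'}" "smooth_param m {x \<in> W. g x \<in> W'} n g"
      if "openin (Euclidean_space n) W'" for W'
      using smooth_param_vimage[OF W g(1) that] smooth_param_subset[OF g(1)] by auto
    show "\<exists>W'. openin (Euclidean_space m) W' \<and> w \<in> W' \<and> W' \<subseteq> W \<and>
      ((\<exists>q. plots D m W' q \<and> (\<forall>w\<in>W'. p (g w) = glue_map Y h (Inl (q w)))) \<or>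
       (\<exists>q. plots E m W' q \<and> (\<forall>w\<in>W'. p (g w) = Inr (q w))))"
      using D E p \<open>g w \<in> U\<close>
    proof (cases rule: plots_dglueE)
      case (left W' q)
      have "plots D m {x \<in> W. g x \<in> W'} (\<lambda>x. q (g x))"
        by (rule plots_compose[OF D left(4) vi(1) vi(2)]) (use left in auto)
      then show ?thesis using vi[OF left(1)] left w
        by (intro exI[of _ "{x \<in> W. g x \<in> W'}"]) auto
    next
      case (right W' q)
      have "plots E m {x \<in> W. g x \<in> W'} (\<lambda>x. q (g x))"
        by (rule plots_compose[OF E right(4) vi(1) vi(2)]) (use right in auto)
      then show ?thesis using vi[OF right(1)] right w
        by (intro exI[of _ "{x \<in> W. g x \<in> W'}"]) auto
    qed
  qed
qed

section \<open>Vector spaces and linear maps\<close>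

text \<open>Additive inverses are the multiples by \<open>- 1\<close>, by distributivity and
  \<open>smult0\<close>.\<close>

lemma real_vectorspaceI:
  fixes M :: "(real, 'v) module"
  assumes zero: "\<zero>\<^bsub>M\<^esub> \<in> carrier M"
    and add: "\<And>v w. v \<in> carrier M \<Longrightarrow> w \<in> carrier M \<Longrightarrow> v \<oplus>\<^bsub>M\<^esub> w \<in> carrier M"
    and smult: "\<And>r v. v \<in> carrier M \<Longrightarrow> r \<odot>\<^bsub>M\<^esub> v \<in> carrier M"
    and comm: "\<And>v w. v \<in> carrier M \<Longrightarrow> w \<in> carrier M \<Longrightarrow> v \<oplus>\<^bsub>M\<^esub> w = w \<oplus>\<^bsub>M\<^esub> v"
    and assoc: "\<And>v w x. v \<in> carrier M \<Longrightarrow> w \<in> carrier M \<Longrightarrow> x \<in> carrier M \<Longrightarrow>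
      (v \<oplus>\<^bsub>M\<^esub> w) \<oplus>\<^bsub>M\<^esub> x = v \<oplus>\<^bsub>M\<^esub> (w \<oplus>\<^bsub>M\<^esub> x)"
    and add_id: "\<And>v. v \<in> carrier M \<Longrightarrow> v \<oplus>\<^bsub>M\<^esub> \<zero>\<^bsub>M\<^esub> = v"
    and smult0: "\<And>v. v \<in> carrier M \<Longrightarrow> 0 \<odot>\<^bsub>M\<^esub> v = \<zero>\<^bsub>M\<^esub>"
    and compat: "\<And>r s v. v \<in> carrier M \<Longrightarrow> (r * s) \<odot>\<^bsub>M\<^esub> v = r \<odot>\<^bsub>M\<^esub> (s \<odot>\<^bsub>M\<^esub> v)"
    and smult1: "\<And>v. v \<in> carrier M \<Longrightarrow> 1 \<odot>\<^bsub>M\<^esub> v = v"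
    and distl: "\<And>r s v. v \<in> carrier M \<Longrightarrow> (r + s) \<odot>\<^bsub>M\<^esub> v = r \<odot>\<^bsub>M\<^esub> v \<oplus>\<^bsub>M\<^esub> s \<odot>\<^bsub>M\<^esub> v"
    and distr: "\<And>r v w. v \<in> carrier M \<Longrightarrow> w \<in> carrier M \<Longrightarrow>
      r \<odot>\<^bsub>M\<^esub> (v \<oplus>\<^bsub>M\<^esub> w) = r \<odot>\<^bsub>M\<^esub> v \<oplus>\<^bsub>M\<^esub> r \<odot>\<^bsub>M\<^esub> w"
  shows "vectorspace class_ring M"
proof (rule vs_criteria)
  show "\<forall>v\<in>carrier M. \<exists>w\<in>carrier M. v \<oplus>\<^bsub>M\<^esub> w = \<zero>\<^bsub>M\<^esub>"
  proof
    fix v assume v: "v \<in> carrier M"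
    have "v \<oplus>\<^bsub>M\<^esub> (- 1) \<odot>\<^bsub>M\<^esub> v = (1 + - 1) \<odot>\<^bsub>M\<^esub> v"
      using distl[OF v, of 1 "- 1"] smult1[OF v] by simp
    also have "\<dots> = \<zero>\<^bsub>M\<^esub>" using smult0[OF v] by simp
    finally show "\<exists>w\<in>carrier M. v \<oplus>\<^bsub>M\<^esub> w = \<zero>\<^bsub>M\<^esub>"
      using smult[OF v] by blast
  qed
qed (use assms in \<open>simp_all add: class_field.field_axioms\<close>)

lemma vectorspaceD:
  fixes M :: "(real, 'v) module"
  assumes "vectorspace class_ring M"
  shows "\<zero>\<^bsub>M\<^esub> \<in> carrier M"
    and "v \<in> carrier M \<Longrightarrow> w \<in> carrier M \<Longrightarrow> v \<oplus>\<^bsub>M\<^esub> w \<in> carrier M"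
    and "v \<in> carrier M \<Longrightarrow> r \<odot>\<^bsub>M\<^esub> v \<in> carrier M"
    and "v \<in> carrier M \<Longrightarrow> w \<in> carrier M \<Longrightarrow> v \<oplus>\<^bsub>M\<^esub> w = w \<oplus>\<^bsub>M\<^esub> v"
    and "v \<in> carrier M \<Longrightarrow> w \<in> carrier M \<Longrightarrow> x \<in> carrier M \<Longrightarrow>
      (v \<oplus>\<^bsub>M\<^esub> w) \<oplus>\<^bsub>M\<^esub> x = v \<oplus>\<^bsub>M\<^esub> (w \<oplus>\<^bsub>M\<^esub> x)"
    and "v \<in> carrier M \<Longrightarrow> v \<oplus>\<^bsub>M\<^esub> \<zero>\<^bsub>M\<^esub> = v"
    and "v \<in> carrier M \<Longrightarrow> 0 \<odot>\<^bsub>M\<^esub> v = \<zero>\<^bsub>M\<^esub>"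
    and "v \<in> carrier M \<Longrightarrow> (r * s) \<odot>\<^bsub>M\<^esub> v = r \<odot>\<^bsub>M\<^esub> (s \<odot>\<^bsub>M\<^esub> v)"
    and "v \<in> carrier M \<Longrightarrow> 1 \<odot>\<^bsub>M\<^esub> v = v"
    and "v \<in> carrier M \<Longrightarrow> (r + s) \<odot>\<^bsub>M\<^esub> v = r \<odot>\<^bsub>M\<^esub> v \<oplus>\<^bsub>M\<^esub> s \<odot>\<^bsub>M\<^esub> v"
    and "v \<in> carrier M \<Longrightarrow> w \<in> carrier M \<Longrightarrow>
      r \<odot>\<^bsub>M\<^esub> (v \<oplus>\<^bsub>M\<^esub> w) = r \<odot>\<^bsub>M\<^esub> v \<oplus>\<^bsub>M\<^esub> r \<odot>\<^bsub>M\<^esub> w"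
proof -
  interpret vectorspace "class_ring :: real ring" M by fact
  show "\<zero>\<^bsub>M\<^esub> \<in> carrier M" by simp
  show "v \<in> carrier M \<Longrightarrow> w \<in> carrier M \<Longrightarrow> v \<oplus>\<^bsub>M\<^esub> w \<in> carrier M" by simp
  show "v \<in> carrier M \<Longrightarrow> r \<odot>\<^bsub>M\<^esub> v \<in> carrier M" using smult_closed[of r v] by simp
  show "v \<in> carrier M \<Longrightarrow> w \<in> carrier M \<Longrightarrow> v \<oplus>\<^bsub>M\<^esub> w = w \<oplus>\<^bsub>M\<^esub> v" by (rule M.a_comm)
  show "v \<in> carrier M \<Longrightarrow> w \<in> carrier M \<Longrightarrow> x \<in> carrier M \<Longrightarrow>
      (v \<oplus>\<^bsub>M\<^esub> w) \<oplus>\<^bsub>M\<^esub> x = v \<oplus>\<^bsub>M\<^esub> (w \<oplus>\<^bsub>M\<^esub> x)" by (rule M.a_assoc)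
  show "v \<in> carrier M \<Longrightarrow> v \<oplus>\<^bsub>M\<^esub> \<zero>\<^bsub>M\<^esub> = v" by simp
  show "v \<in> carrier M \<Longrightarrow> 0 \<odot>\<^bsub>M\<^esub> v = \<zero>\<^bsub>M\<^esub>" using lmult_0[of v] by simp
  show "v \<in> carrier M \<Longrightarrow> (r * s) \<odot>\<^bsub>M\<^esub> v = r \<odot>\<^bsub>M\<^esub> (s \<odot>\<^bsub>M\<^esub> v)"
    using smult_assoc1[of r s v] by simp
  show "v \<in> carrier M \<Longrightarrow> 1 \<odot>\<^bsub>M\<^esub> v = v" using smult_one[of v] by simp
  show "v \<in> carrier M \<Longrightarrow> (r + s) \<odot>\<^bsub>M\<^esub> v = r \<odot>\<^bsub>M\<^esub> v \<oplus>\<^bsub>M\<^esub> s \<odot>\<^bsub>M\<^esub> v"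
    using smult_l_distr[of r s v] by simp
  show "v \<in> carrier M \<Longrightarrow> w \<in> carrier M \<Longrightarrow>
      r \<odot>\<^bsub>M\<^esub> (v \<oplus>\<^bsub>M\<^esub> w) = r \<odot>\<^bsub>M\<^esub> v \<oplus>\<^bsub>M\<^esub> r \<odot>\<^bsub>M\<^esub> w"
    using smult_r_distr[of r v w] by simp
qed

lemma linear_mapI:
  fixes M :: "(real, 'v) module" and N :: "(real, 'w) module"
  assumes "vectorspace class_ring M" "vectorspace class_ring N"
    and "\<And>v. v \<in> carrier M \<Longrightarrow> T v \<in> carrier N"
    and "\<And>v w. v \<in> carrier M \<Longrightarrow> w \<in> carrier M \<Longrightarrow> T (v \<oplus>\<^bsub>M\<^esub> w) = T v \<oplus>\<^bsub>N\<^esub> T w"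
    and "\<And>r v. v \<in> carrier M \<Longrightarrow> T (r \<odot>\<^bsub>M\<^esub> v) = r \<odot>\<^bsub>N\<^esub> T v"
  shows "linear_map class_ring M N T"
  using assms unfolding linear_map_def mod_hom_def mod_hom_axioms_def module_hom_def vectorspace_def
  by auto

lemma linear_mapD:
  fixes M :: "(real, 'v) module" and N :: "(real, 'w) module"
  assumes "linear_map class_ring M N T"
  shows "vectorspace class_ring M" "vectorspace class_ring N"
    and "v \<in> carrier M \<Longrightarrow> T v \<in> carrier N"
    and "v \<in> carrier M \<Longrightarrow> w \<in> carrier M \<Longrightarrow> T (v \<oplus>\<^bsub>M\<^esub> w) = T v \<oplus>\<^bsub>N\<^esub> T w"
    and "v \<in> carrier M \<Longrightarrow> T (r \<odot>\<^bsub>M\<^esub> v) = r \<odot>\<^bsub>N\<^esub> T v"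
    and "T \<zero>\<^bsub>M\<^esub> = \<zero>\<^bsub>N\<^esub>"
proof -
  show "vectorspace class_ring M" "vectorspace class_ring N"
    using assms by (simp_all add: linear_map_def)
  have "T \<in> LinearCombinations.module_hom class_ring M N"
    using assms by (simp add: linear_map_def mod_hom_def mod_hom_axioms_def)
  then show "v \<in> carrier M \<Longrightarrow> T v \<in> carrier N"
    and "v \<in> carrier M \<Longrightarrow> w \<in> carrier M \<Longrightarrow> T (v \<oplus>\<^bsub>M\<^esub> w) = T v \<oplus>\<^bsub>N\<^esub> T w"
    and "v \<in> carrier M \<Longrightarrow> T (r \<odot>\<^bsub>M\<^esub> v) = r \<odot>\<^bsub>N\<^esub> T v"
    by (auto simp: LinearCombinations.module_hom_def)
  show "T \<zero>\<^bsub>M\<^esub> = \<zero>\<^bsub>N\<^esub>"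
    using mod_hom.f0_is_0 linear_map.axioms(3)[OF assms] by blast
qed

lemma linear_map_compose:
  fixes M :: "(real, 'v) module" and N :: "(real, 'w) module" and P :: "(real, 'z) module"
  assumes "linear_map class_ring M N T" "linear_map class_ring N P S"
  shows "linear_map class_ring M P (\<lambda>v. S (T v))"
  by (rule linear_mapI) (simp_all add: linear_mapD[OF assms(1)] linear_mapD[OF assms(2)])

lemma linear_map_cong:
  fixes M :: "(real, 'v) module" and N :: "(real, 'w) module"
  assumes "linear_map class_ring M N T" "\<And>v. v \<in> carrier M \<Longrightarrow> S v = T v"
  shows "linear_map class_ring M N S"
  by (rule linear_mapI) (simp_all add: linear_mapD[OF assms(1)] vectorspaceD[OF linear_mapD(1)[OF assms(1)]] assms(2))

lemma linear_map_inverse: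
  fixes M :: "(real, 'v) module" and N :: "(real, 'w) module"
  assumes T: "linear_map class_ring M N T"
    and "\<And>v. v \<in> carrier M \<Longrightarrow> S (T v) = v" and "\<And>w. w \<in> carrier N \<Longrightarrow> S w \<in> carrier M \<and> T (S w) = w"
  shows "linear_map class_ring N M S"
proof (rule linear_mapI)
  note M = vectorspaceD[OF linear_mapD(1)[OF T]]
  fix v w r assume v: "v \<in> carrier N"
  have "T (r \<odot>\<^bsub>M\<^esub> S v) = r \<odot>\<^bsub>N\<^esub> v"
    using v assms(3) linear_mapD[OF T] by simp
  then show "S (r \<odot>\<^bsub>N\<^esub> v) = r \<odot>\<^bsub>M\<^esub> S v"
    using v assms(2)[of "r \<odot>\<^bsub>M\<^esub> S v"] assms(3) M(3) by simp
  assume w: "w \<in> carrier N"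
  have "T (S v \<oplus>\<^bsub>M\<^esub> S w) = v \<oplus>\<^bsub>N\<^esub> w"
    using v w assms(3) linear_mapD[OF T] by simp
  then show "S (v \<oplus>\<^bsub>N\<^esub> w) = S v \<oplus>\<^bsub>M\<^esub> S w"
    using v w assms(2)[of "S v \<oplus>\<^bsub>M\<^esub> S w"] assms(3) M(2) by simp
qed (simp_all add: linear_mapD(1,2)[OF T] assms(3))

text \<open>Transport of structure along a surjection compatible with the operations: every axiom is
  checked on preimages. It serves the inclusions into a gluing, the quotient map to tensor classes
  and the projection given by alternation alike.\<close>

lemma vectorspace_image:
  fixes M :: "(real, 'v) module" and N :: "(real, 'w) module"
  assumes M: "vectorspace class_ring M" and N: "carrier N = T ` carrier M" "\<zero>\<^bsub>N\<^esub> = T \<zero>\<^bsub>M\<^esub>"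
    and add: "\<And>v w. v \<in> carrier M \<Longrightarrow> w \<in> carrier M \<Longrightarrow> T v \<oplus>\<^bsub>N\<^esub> T w = T (v \<oplus>\<^bsub>M\<^esub> w)"
    and smult: "\<And>r v. v \<in> carrier M \<Longrightarrow> r \<odot>\<^bsub>N\<^esub> T v = T (r \<odot>\<^bsub>M\<^esub> v)"
  shows "vectorspace class_ring N" and "linear_map class_ring M N T"
proof -
  note M' = vectorspaceD[OF M]
  show vs: "vectorspace class_ring N"
  proof (rule real_vectorspaceI, unfold N)
    fix v w x and r s :: real assume "v \<in> T ` carrier M"
    then obtain a where a: "a \<in> carrier M" "v = T a" by blast
    show "r \<odot>\<^bsub>N\<^esub> v \<in> T ` carrier M" "v \<oplus>\<^bsub>N\<^esub> T \<zero>\<^bsub>M\<^esub> = v" "0 \<odot>\<^bsub>N\<^esub> v = T \<zero>\<^bsub>M\<^esub>" "1 \<odot>\<^bsub>N\<^esub> v = v"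
      "(r * s) \<odot>\<^bsub>N\<^esub> v = r \<odot>\<^bsub>N\<^esub> (s \<odot>\<^bsub>N\<^esub> v)"
      "(r + s) \<odot>\<^bsub>N\<^esub> v = r \<odot>\<^bsub>N\<^esub> v \<oplus>\<^bsub>N\<^esub> s \<odot>\<^bsub>N\<^esub> v"
      using a by (simp_all add: add smult M')
    assume "w \<in> T ` carrier M"
    then obtain b where b: "b \<in> carrier M" "w = T b" by blast
    show "v \<oplus>\<^bsub>N\<^esub> w \<in> T ` carrier M" "r \<odot>\<^bsub>N\<^esub> (v \<oplus>\<^bsub>N\<^esub> w) = r \<odot>\<^bsub>N\<^esub> v \<oplus>\<^bsub>N\<^esub> r \<odot>\<^bsub>N\<^esub> w"
      using a b by (simp_all add: add smult M')
    show "v \<oplus>\<^bsub>N\<^esub> w = w \<oplus>\<^bsub>N\<^esub> v"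
      using a b M'(4) by (simp add: add)
    assume "x \<in> T ` carrier M"
    then obtain c where c: "c \<in> carrier M" "x = T c" by blast
    show "v \<oplus>\<^bsub>N\<^esub> w \<oplus>\<^bsub>N\<^esub> x = v \<oplus>\<^bsub>N\<^esub> (w \<oplus>\<^bsub>N\<^esub> x)"
      using a b c M'(5) by (simp add: add M')
  qed (simp add: M')
  show "linear_map class_ring M N T"
    by (rule linear_mapI) (simp_all add: M vs N add smult)
qed

section \<open>Pseudo-bundles\<close>

lemma fibre_simps [simp]:
  "carrier (fibre V x) = vert V x"
  "\<zero>\<^bsub>fibre V x\<^esub> = vzero V x"
  "v \<oplus>\<^bsub>fibre V x\<^esub> w = vadd V v w"
  "r \<odot>\<^bsub>fibre V x\<^esub> v = vsmul V r v"
  by (simp_all add: fibre_def)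

lemma real_line_simps [simp]:
  "carrier real_line = UNIV" "\<zero>\<^bsub>real_line\<^esub> = 0" "r \<oplus>\<^bsub>real_line\<^esub> s = r + s" "r \<odot>\<^bsub>real_line\<^esub> s = r * s"
  by (simp_all add: real_line_def)

lemma vectorspace_real_line: "vectorspace class_ring real_line"
  by (rule real_vectorspaceI) (simp_all add: algebra_simps)

context
  fixes V :: "('v, 'x) vbundle"
  assumes V: "pseudo_bundle V"
begin

lemma pseudo_bundle_tot: "diffeological (tot V)"
  and pseudo_bundle_base: "diffeological (base V)"
  and pseudo_bundle_fibre: "x \<in> pts (base V) \<Longrightarrow> vectorspace class_ring (fibre V x)"
  using V unfolding pseudo_bundle_def by simp_all

lemma pseudo_bundle_plots_bproj: "plots (tot V) n U p \<Longrightarrow> plots (base V) n U (\<lambda>u. bproj V (p u))"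
  by (rule dsmooth_plots) (use V in \<open>simp_all add: pseudo_bundle_def\<close>)

lemma pseudo_bundle_plots_vadd:
  assumes "plots (tot V) n U p" "plots (tot V) n U q" "\<And>u. u \<in> U \<Longrightarrow> bproj V (p u) = bproj V (q u)"
  shows "plots (tot V) n U (\<lambda>u. vadd V (p u) (q u))"
proof -
  have "plots (dsub (Defs.dprod (tot V) (tot V)) {(v, w). bproj V v = bproj V w}) n U (\<lambda>u. (p u, q u))"
    using assms by (simp add: plots_dsub plots_dprod)
  moreover have "dsmooth (dsub (Defs.dprod (tot V) (tot V)) {(v, w). bproj V v = bproj V w}) (tot V)
      (\<lambda>(v, w). vadd V v w)"
    using V by (simp add: pseudo_bundle_def)
  ultimately show ?thesis
    using dsmooth_plots by fastforce
qed

lemma pseudo_bundle_plots_vsmul: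
  assumes "smooth_fun n U r" "plots (tot V) n U p"
  shows "plots (tot V) n U (\<lambda>u. vsmul V (r u) (p u))"
proof -
  have "plots (Defs.dprod dreal (tot V)) n U (\<lambda>u. (r u, p u))"
    using assms plots_open[OF pseudo_bundle_tot assms(2)] by (simp add: plots_dprod plots_dreal)
  moreover have "dsmooth (Defs.dprod dreal (tot V)) (tot V) (\<lambda>(r, v). vsmul V r v)"
    using V by (simp add: pseudo_bundle_def)
  ultimately show ?thesis
    using dsmooth_plots by fastforce
qed

lemma pseudo_bundle_plots_vzero: "plots (base V) n U p \<Longrightarrow> plots (tot V) n U (\<lambda>u. vzero V (p u))"
  by (rule dsmooth_plots) (use V in \<open>simp_all add: pseudo_bundle_def\<close>)

end

text \<open>That sums, multiples and zeros stay in the total space is read off from the vector space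
  structure of the fibres, which leaves only conditions on plots.\<close>

lemma pseudo_bundleI:
  assumes "diffeological (tot V)" "diffeological (base V)"
    and "\<And>v. v \<in> pts (tot V) \<Longrightarrow> bproj V v \<in> pts (base V)"
    and "\<And>n U p. plots (tot V) n U p \<Longrightarrow> plots (base V) n U (\<lambda>u. bproj V (p u))"
    and fib: "\<And>x. x \<in> pts (base V) \<Longrightarrow> vectorspace class_ring (fibre V x)"
    and add: "\<And>n U p q. plots (tot V) n U p \<Longrightarrow> plots (tot V) n U q \<Longrightarrow>
      (\<And>u. u \<in> U \<Longrightarrow> bproj V (p u) = bproj V (q u)) \<Longrightarrow> plots (tot V) n U (\<lambda>u. vadd V (p u) (q u))"
    and smul: "\<And>n U r p. smooth_fun n U r \<Longrightarrow> plots (tot V) n U p \<Longrightarrow> plots (tot V) n U (\<lambda>u. vsmul V (r u) (p u))"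
    and zero: "\<And>n U p. plots (base V) n U p \<Longrightarrow> plots (tot V) n U (\<lambda>u. vzero V (p u))"
  shows "pseudo_bundle V"
  unfolding pseudo_bundle_def
proof (intro conjI ballI fib assms(1,2))
  have vert: "vzero V x \<in> vert V x" "v \<in> vert V x \<Longrightarrow> w \<in> vert V x \<Longrightarrow> vadd V v w \<in> vert V x"
    "v \<in> vert V x \<Longrightarrow> vsmul V r v \<in> vert V x" if "x \<in> pts (base V)" for x v w r
    using vectorspaceD(1-3)[OF fib[OF that], simplified] by auto
  have z: "vzero V x \<in> pts (tot V)" "bproj V (vzero V x) = x" if "x \<in> pts (base V)" for x
    using vert(1)[OF that] by (auto simp: vert_def)
  show "dsmooth (tot V) (base V) (bproj V)"
    by (rule dsmoothI) (fact assms(3), fact assms(4))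
  show "bproj V ` pts (tot V) = pts (base V)"
    using assms(3) z by force
  show "dsmooth (base V) (tot V) (vzero V)"
    by (rule dsmoothI) (fact z(1), fact zero)
  show "dsmooth (Defs.dprod dreal (tot V)) (tot V) (\<lambda>(r, v). vsmul V r v)"
  proof (rule dsmoothI)
    fix y assume "y \<in> pts (Defs.dprod dreal (tot V))"
    then have "snd y \<in> vert V (bproj V (snd y))" "bproj V (snd y) \<in> pts (base V)"
      using assms(3) by (auto simp: vert_def)
    then show "(case y of (r, v) \<Rightarrow> vsmul V r v) \<in> pts (tot V)"
      using vert(3)[of "bproj V (snd y)" "snd y" "fst y"] by (auto simp: vert_def split_beta)
  qed (use smul in \<open>simp add: plots_dprod plots_dreal split_beta\<close>)
  show "dsmooth (dsub (Defs.dprod (tot V) (tot V)) {(v, w). bproj V v = bproj V w}) (tot V) (\<lambda>(v, w). vadd V v w)"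
  proof (rule dsmoothI)
    fix y assume "y \<in> pts (dsub (Defs.dprod (tot V) (tot V)) {(v, w). bproj V v = bproj V w})"
    then have "snd y \<in> vert V (bproj V (fst y))" "fst y \<in> vert V (bproj V (fst y))" "bproj V (fst y) \<in> pts (base V)"
      using assms(3) by (auto simp: vert_def)
    then show "(case y of (v, w) \<Rightarrow> vadd V v w) \<in> pts (tot V)"
      using vert(2)[of "bproj V (fst y)" "fst y" "snd y"] by (auto simp: vert_def split_beta)
  qed (use add in \<open>simp add: plots_dsub plots_dprod split_beta\<close>)
qed

lemma vert_in_tot: "v \<in> vert V x \<Longrightarrow> v \<in> pts (tot V)"
  by (simp add: vert_def)

subsection \<open>Fibres of a gluing\<close>

lemma glue_bundle_simps [simp]:
  "tot (glue_bundle A B Y h H) = dglue (tot A) (tot B) (over A Y) H"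
  "base (glue_bundle A B Y h H) = dglue (base A) (base B) Y h"
  "bproj (glue_bundle A B Y h H) = map_sum (bproj A) (bproj B)"
  "vzero (glue_bundle A B Y h H) = map_sum (vzero A) (vzero B)"
  "vsmul (glue_bundle A B Y h H) r = map_sum (vsmul A r) (vsmul B r)"
  "vadd (glue_bundle A B Y h H) (Inl v) (Inl w) = Inl (vadd A v w)"
  "vadd (glue_bundle A B Y h H) (Inr v') (Inr w') = Inr (vadd B v' w')"
  by (simp_all add: glue_bundle_def)

lemma pts_dglue_disjoint:
  assumes "\<And>y. y \<in> Y \<Longrightarrow> y \<in> pts D \<Longrightarrow> h y \<in> pts E"
  shows "pts (dglue D E Y h) = Inl ` (pts D - Y) \<union> Inr ` pts E"
proof -
  have "glue_map Y h (Inl z) \<in> Inl ` (pts D - Y) \<union> Inr ` pts E" if "z \<in> pts D" for z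
    using that assms by (cases "z \<in> Y") auto
  moreover have "Inl z \<in> (\<lambda>z. glue_map Y h (Inl z)) ` pts D" if "z \<in> pts D" "z \<notin> Y" for z
    using that by (intro image_eqI[of _ _ z]) simp_all
  ultimately show ?thesis unfolding pts_dglue by blast
qed

text \<open>Vectors of \<open>A\<close> over \<open>Y\<close> are identified with their images under
  \<open>H\<close>, which are present in \<open>B\<close> already. Hence every fibre of the gluing
  is a copy of a single fibre of one of the factors.\<close>

lemma vert_glue:
  assumes "\<And>v. v \<in> over A Y \<Longrightarrow> H v \<in> pts (tot B)"
  shows "vert (glue_bundle A B Y h H) (Inr y) = Inr ` vert B y"
    and "x \<notin> Y \<Longrightarrow> vert (glue_bundle A B Y h H) (Inl x) = Inl ` vert A x"
proof -
  have *: "pts (dglue (tot A) (tot B) (over A Y) H) = Inl ` (pts (tot A) - over A Y) \<union> Inr ` pts (tot B)"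
    using assms by (rule pts_dglue_disjoint)
  show "vert (glue_bundle A B Y h H) (Inr y) = Inr ` vert B y"
    unfolding vert_def glue_bundle_simps * by auto
  show "vert (glue_bundle A B Y h H) (Inl x) = Inl ` vert A x" if "x \<notin> Y"
    using that unfolding vert_def glue_bundle_simps * by (auto simp: over_def)
qed

lemma linear_map_Inr_glue:
  assumes "\<And>v. v \<in> over A Y \<Longrightarrow> H v \<in> pts (tot B)" and "vectorspace class_ring (fibre B y)"
  shows "linear_map class_ring (fibre B y) (fibre (glue_bundle A B Y h H) (Inr y)) Inr"
  by (rule vectorspace_image(2)[OF assms(2)]) (simp_all add: vert_glue[of A Y H B, OF assms(1)])

lemma linear_map_Inl_glue:
  assumes "\<And>v. v \<in> over A Y \<Longrightarrow> H v \<in> pts (tot B)" and "vectorspace class_ring (fibre A x)" and "x \<notin> Y"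
  shows "linear_map class_ring (fibre A x) (fibre (glue_bundle A B Y h H) (Inl x)) Inl"
  by (rule vectorspace_image(2)[OF assms(2)]) (simp_all add: vert_glue[of A Y H B, OF assms(1)] assms(3))

lemma vectorspace_fibre_glue:
  assumes H: "\<And>v. v \<in> over A Y \<Longrightarrow> H v \<in> pts (tot B)" and h: "\<And>y. y \<in> Y \<Longrightarrow> h y \<in> pts (base B)"
    and A: "\<And>x. x \<in> pts (base A) \<Longrightarrow> vectorspace class_ring (fibre A x)"
    and B: "\<And>x. x \<in> pts (base B) \<Longrightarrow> vectorspace class_ring (fibre B x)"
    and c: "c \<in> pts (base (glue_bundle A B Y h H))"
  shows "vectorspace class_ring (fibre (glue_bundle A B Y h H) c)"
proof -
  consider x where "x \<in> pts (base A)" "x \<notin> Y" "c = Inl x" | y where "y \<in> pts (base B)" "c = Inr y"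
    using c pts_dglue_disjoint[of Y "base A" h "base B"] h by auto
  then show ?thesis
  proof cases
    case 1
    then show ?thesis using linear_mapD(2)[OF linear_map_Inl_glue[of A Y H B, OF H A]] by blast
  next
    case 2
    then show ?thesis using linear_mapD(2)[OF linear_map_Inr_glue[of A Y H B, OF H B]] by blast
  qed
qed

subsection \<open>Dual pseudo-bundles\<close>

lemma dual_bundle_simps [simp]:
  "base (dual_bundle V) = base V" "bproj (dual_bundle V) = fst"
  "vzero (dual_bundle V) x = (x, \<lambda>v\<in>vert V x. 0)"
  "vadd (dual_bundle V) a b = (fst a, \<lambda>v\<in>vert V (fst a). snd a v + snd b v)"
  "vsmul (dual_bundle V) r a = (fst a, \<lambda>v\<in>vert V (fst a). r * snd a v)"
  unfolding dual_bundle_def Let_def by (simp_all add: split_beta fun_eq_iff)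

lemma pts_dual_iff: "a \<in> pts (tot (dual_bundle V)) \<longleftrightarrow>
    fst a \<in> pts (base V) \<and> snd a \<in> extensional (vert V (fst a)) \<and>
    linear_map class_ring (fibre V (fst a)) real_line (snd a) \<and>
    dsmooth (dsub (tot V) (vert V (fst a))) dreal (snd a)"
  by (cases a) (simp add: dual_bundle_def Let_def)

text \<open>A plot of the product of the two domains is a pair of smooth parametrizations with one
  source \<open>T\<close>. The second is absorbed into the plot of \<open>V\<close>, so that a
  covector plot is tested along one reparametrization \<open>a\<close> against plots on the same
  \<open>T\<close>.\<close>

lemma plots_dual_iff:
  assumes V: "diffeological (tot V)"
  shows "plots (tot (dual_bundle V)) m U q \<longleftrightarrow>
    openin (Euclidean_space m) U \<and> (\<forall>u\<in>U. q u \<in> pts (tot (dual_bundle V))) \<and>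
    plots (base V) m U (\<lambda>u. fst (q u)) \<and>
    (\<forall>l T a p. openin (Euclidean_space l) T \<longrightarrow> smooth_param l T m a \<longrightarrow> a ` T \<subseteq> U \<longrightarrow>
      plots (tot V) l T p \<longrightarrow> (\<forall>t\<in>T. fst (q (a t)) = bproj V (p t)) \<longrightarrow>
      smooth_fun l T (\<lambda>t. snd (q (a t)) (p t)))" (is "?l \<longleftrightarrow> ?A \<and> ?B \<and> ?C \<and> ?D")
proof -
  let ?E = "\<lambda>n W p. dsmooth (dsub (Defs.dprod (ddom m U) (ddom n W)) {(u, w). fst (q u) = bproj V (p w)})
      dreal (\<lambda>(u, w). snd (q u) (p w))"
  have "?l \<longleftrightarrow> ?A \<and> ?B \<and> ?C \<and> (\<forall>n W p. plots (tot V) n W p \<longrightarrow> ?E n W p)"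
    by (simp add: dual_bundle_def Let_def image_subset_iff o_def split_beta)
  moreover have "(\<forall>n W p. plots (tot V) n W p \<longrightarrow> ?E n W p) \<longleftrightarrow> ?D"
  proof (intro iffI allI impI)
    fix l T a p assume E: "\<forall>n W p. plots (tot V) n W p \<longrightarrow> ?E n W p"
      and T: "openin (Euclidean_space l) T" and a: "smooth_param l T m a" "a ` T \<subseteq> U"
      and p: "plots (tot V) l T p" "\<forall>t\<in>T. fst (q (a t)) = bproj V (p t)"
    \<comment> \<open>As \<open>p\<close> is a plot on \<open>T\<close> itself, the second
      parametrization is the identity.\<close>
    have "plots (dsub (Defs.dprod (ddom m U) (ddom l T)) {(u, w). fst (q u) = bproj V (p w)}) l T (\<lambda>t. (a t, t))"
      using T a p(2) smooth_param_id[OF T] by (simp add: plots_dsub plots_dprod plots_ddom)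
    from dsmooth_plots[OF E[rule_format, OF p(1)] this]
    show "smooth_fun l T (\<lambda>t. snd (q (a t)) (p t))" by (simp add: plots_dreal)
  next
    fix n W p assume D: ?D and p: "plots (tot V) n W p"
    show "?E n W p"
    proof (rule dsmoothI)
      fix l T c assume "plots (dsub (Defs.dprod (ddom m U) (ddom n W)) {(u, w). fst (q u) = bproj V (p w)}) l T c"
      then have T: "openin (Euclidean_space l) T" and a: "smooth_param l T m (\<lambda>t. fst (c t))" "(\<lambda>t. fst (c t)) ` T \<subseteq> U"
        and b: "smooth_param l T n (\<lambda>t. snd (c t))" "(\<lambda>t. snd (c t)) ` T \<subseteq> W"
        and eq: "\<forall>t\<in>T. fst (q (fst (c t))) = bproj V (p (snd (c t)))"
        by (auto simp: plots_dsub plots_dprod plots_ddom split_beta)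
      from D[rule_format, OF T a(1,2) plots_compose[OF V p T b]] eq
      show "plots dreal l T (\<lambda>t. case c t of (u, w) \<Rightarrow> snd (q u) (p w))"
        using T by (simp add: plots_dreal split_beta)
    qed simp
  qed
  ultimately show ?thesis by blast
qed

lemma plots_dual_eval:
  assumes "diffeological (tot V)" "plots (tot (dual_bundle V)) m U q"
    and "openin (Euclidean_space l) T" "smooth_param l T m a" "a ` T \<subseteq> U"
    and "plots (tot V) l T p" "\<And>t. t \<in> T \<Longrightarrow> fst (q (a t)) = bproj V (p t)"
  shows "smooth_fun l T (\<lambda>t. snd (q (a t)) (p t))"
  using assms(2)[unfolded plots_dual_iff[OF assms(1)], THEN conjunct2, THEN conjunct2, THEN conjunct2,
      rule_format, OF assms(3-6)] assms(7) by blast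

lemma plots_dualI:
  assumes "diffeological (tot V)" "openin (Euclidean_space m) U"
    and "\<And>u. u \<in> U \<Longrightarrow> q u \<in> pts (tot (dual_bundle V))"
    and "plots (base V) m U (\<lambda>u. fst (q u))"
    and "\<And>l T a p. openin (Euclidean_space l) T \<Longrightarrow> smooth_param l T m a \<Longrightarrow> a ` T \<subseteq> U \<Longrightarrow>
      plots (tot V) l T p \<Longrightarrow> (\<And>t. t \<in> T \<Longrightarrow> fst (q (a t)) = bproj V (p t)) \<Longrightarrow>
      smooth_fun l T (\<lambda>t. snd (q (a t)) (p t))"
  shows "plots (tot (dual_bundle V)) m U q"
  unfolding plots_dual_iff[OF assms(1)]
proof (intro conjI allI impI ballI)
  fix l T a p
  show "smooth_fun l T (\<lambda>t. snd (q (a t)) (p t))" if "openin (Euclidean_space l) T" "smooth_param l T m a" "a ` T \<subseteq> U"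
      "plots (tot V) l T p" "\<forall>t\<in>T. fst (q (a t)) = bproj V (p t)"
    by (rule assms(5)[OF that(1-4)]) (use that(5) in simp)
qed (fact assms(2), fact assms(3), fact assms(4))

lemma vert_dual_iff: "a \<in> vert (dual_bundle V) x \<longleftrightarrow> a \<in> pts (tot (dual_bundle V)) \<and> fst a = x"
  by (simp add: vert_def)

lemma dsmooth_drealI:
  assumes "\<And>n U p. plots D n U p \<Longrightarrow> openin (Euclidean_space n) U"
    and "\<And>n U p. plots D n U p \<Longrightarrow> smooth_fun n U (\<lambda>u. f (p u))"
  shows "dsmooth D dreal f"
  by (rule dsmoothI) (simp_all add: plots_dreal assms)

lemma pts_dualI:
  assumes "x \<in> pts (base V)" "linear_map class_ring (fibre V x) real_line \<xi>"
    and "diffeological (tot V)"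
    and "\<And>n U p. plots (tot V) n U p \<Longrightarrow> (\<And>u. u \<in> U \<Longrightarrow> p u \<in> vert V x) \<Longrightarrow> smooth_fun n U (\<lambda>u. \<xi> (p u))"
  shows "(x, restrict \<xi> (vert V x)) \<in> pts (tot (dual_bundle V))"
  unfolding pts_dual_iff fst_conv snd_conv
proof (intro conjI assms(1))
  show "linear_map class_ring (fibre V x) real_line (restrict \<xi> (vert V x))"
    by (rule linear_map_cong[OF assms(2)]) simp
  show "dsmooth (dsub (tot V) (vert V x)) dreal (restrict \<xi> (vert V x))"
  proof (rule dsmooth_drealI)
    fix n U p assume p: "plots (dsub (tot V) (vert V x)) n U p"
    then show U: "openin (Euclidean_space n) U"
      using plots_open[OF assms(3), of n U p] by (simp add: plots_dsub)
    show "smooth_fun n U (\<lambda>u. restrict \<xi> (vert V x) (p u))"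
      by (rule smooth_fun_cong[OF U assms(4)[of n U p]]) (use p in \<open>simp_all add: plots_dsub\<close>)
  qed
qed simp

lemma pts_dual_linear: "a \<in> pts (tot (dual_bundle V)) \<Longrightarrow> linear_map class_ring (fibre V (fst a)) real_line (snd a)"
  and pts_dual_base: "a \<in> pts (tot (dual_bundle V)) \<Longrightarrow> fst a \<in> pts (base V)"
  and pts_dual_ext: "a \<in> pts (tot (dual_bundle V)) \<Longrightarrow> snd a \<in> extensional (vert V (fst a))"
  by (simp_all add: pts_dual_iff)

lemma pts_dual_smooth:
  assumes "a \<in> pts (tot (dual_bundle V))"
    and "plots (tot V) n U p" "\<And>u. u \<in> U \<Longrightarrow> p u \<in> vert V (fst a)"
  shows "smooth_fun n U (\<lambda>u. snd a (p u))"
proof -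
  have "plots (dsub (tot V) (vert V (fst a))) n U p"
    using assms(2,3) by (simp add: plots_dsub)
  with dsmooth_plots[of _ dreal "snd a"] assms(1) show ?thesis
    by (auto simp: pts_dual_iff plots_dreal)
qed

lemma dual_eqI:
  assumes "a \<in> pts (tot (dual_bundle V))" "b \<in> pts (tot (dual_bundle V))" "fst a = fst b"
    and "\<And>v. v \<in> vert V (fst a) \<Longrightarrow> snd a v = snd b v"
  shows "a = b"
  using assms extensionalityI[OF pts_dual_ext[OF assms(1)]] pts_dual_ext[OF assms(2)]
  by (intro prod_eqI) auto

context
  fixes V :: "('v, 'x) vbundle"
  assumes T: "diffeological (tot V)" and B: "diffeological (base V)"
    and fib: "\<And>x. x \<in> pts (base V) \<Longrightarrow> vectorspace class_ring (fibre V x)"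
begin

lemma dual_vadd_closed:
  assumes "a \<in> pts (tot (dual_bundle V))" "b \<in> pts (tot (dual_bundle V))" "fst a = fst b"
  shows "vadd (dual_bundle V) a b \<in> pts (tot (dual_bundle V))"
  unfolding dual_bundle_simps
proof (rule pts_dualI[OF pts_dual_base[OF assms(1)] _ T])
  note a = linear_mapD[OF pts_dual_linear[OF assms(1)]]
  note b = linear_mapD[OF pts_dual_linear[OF assms(2)], folded assms(3)]
  show "linear_map class_ring (fibre V (fst a)) real_line (\<lambda>v. snd a v + snd b v)"
    by (rule linear_mapI[OF a(1,2)]) (use a(4,5) b(4,5) in \<open>simp_all add: algebra_simps\<close>)
  fix n U p assume p: "plots (tot V) n U p" "\<And>u. u \<in> U \<Longrightarrow> p u \<in> vert V (fst a)"
  show "smooth_fun n U (\<lambda>u. snd a (p u) + snd b (p u))"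
    by (rule smooth_fun_add[OF pts_dual_smooth[OF assms(1) p] pts_dual_smooth[OF assms(2) p(1)]])
      (use p(2) assms(3) in simp_all)
qed

lemma dual_vsmul_closed:
  assumes "a \<in> pts (tot (dual_bundle V))"
  shows "vsmul (dual_bundle V) r a \<in> pts (tot (dual_bundle V))"
  unfolding dual_bundle_simps
proof (rule pts_dualI[OF pts_dual_base[OF assms(1)] _ T])
  note a = linear_mapD[OF pts_dual_linear[OF assms(1)]]
  show "linear_map class_ring (fibre V (fst a)) real_line (\<lambda>v. r * snd a v)"
    by (rule linear_mapI[OF a(1,2)]) (use a(4,5) in \<open>simp_all add: algebra_simps\<close>)
  fix n U p assume p: "plots (tot V) n U p" "\<And>u. u \<in> U \<Longrightarrow> p u \<in> vert V (fst a)"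
  show "smooth_fun n U (\<lambda>u. r * snd a (p u))"
    by (rule smooth_fun_mult[OF smooth_fun_const pts_dual_smooth[OF assms(1) p]])
qed

lemma dual_vzero_closed:
  assumes "x \<in> pts (base V)"
  shows "vzero (dual_bundle V) x \<in> pts (tot (dual_bundle V))"
  unfolding dual_bundle_simps
  by (rule pts_dualI[OF assms _ T])
    (auto intro!: linear_mapI[OF fib[OF assms] vectorspace_real_line] smooth_fun_const)

lemma vectorspace_fibre_dual:
  assumes x: "x \<in> pts (base V)"
  shows "vectorspace class_ring (fibre (dual_bundle V) x)"
proof -
  note cl = dual_vadd_closed dual_vsmul_closed dual_vzero_closed[OF x]
  note v = vectorspaceD(2,3)[OF fib[OF x], simplified]
  show ?thesis
  proof (rule real_vectorspaceI, unfold fibre_simps vert_dual_iff)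
    fix a b c and r s :: real
    assume a: "a \<in> pts (tot (dual_bundle V)) \<and> fst a = x"
    then show "vsmul (dual_bundle V) r a \<in> pts (tot (dual_bundle V)) \<and> fst (vsmul (dual_bundle V) r a) = x"
      using cl(2)[of a r] by simp
    show "vadd (dual_bundle V) a (vzero (dual_bundle V) x) = a" "vsmul (dual_bundle V) 1 a = a"
      using a pts_dual_ext[of a V] by (auto intro!: prod_eqI simp: extensional_restrict cong: restrict_cong)
    show "vsmul (dual_bundle V) 0 a = vzero (dual_bundle V) x"
      "vsmul (dual_bundle V) (r * s) a = vsmul (dual_bundle V) r (vsmul (dual_bundle V) s a)"
      "vsmul (dual_bundle V) (r + s) a = vadd (dual_bundle V) (vsmul (dual_bundle V) r a) (vsmul (dual_bundle V) s a)"
      using a by (auto simp: restrict_def fun_eq_iff algebra_simps)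
    assume b: "b \<in> pts (tot (dual_bundle V)) \<and> fst b = x"
    show "vadd (dual_bundle V) a b \<in> pts (tot (dual_bundle V)) \<and> fst (vadd (dual_bundle V) a b) = x"
      using cl(1)[of a b] a b by simp
    show "vadd (dual_bundle V) a b = vadd (dual_bundle V) b a"
      "vsmul (dual_bundle V) r (vadd (dual_bundle V) a b) =
        vadd (dual_bundle V) (vsmul (dual_bundle V) r a) (vsmul (dual_bundle V) r b)"
      using a b by (auto simp: restrict_def fun_eq_iff algebra_simps)
    assume c: "c \<in> pts (tot (dual_bundle V)) \<and> fst c = x"
    show "vadd (dual_bundle V) (vadd (dual_bundle V) a b) c = vadd (dual_bundle V) a (vadd (dual_bundle V) b c)"
      using a b c by (auto simp: restrict_def fun_eq_iff algebra_simps)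
  qed (use cl(3) in simp)
qed

lemma diffeological_dual: "diffeological (tot (dual_bundle V))"
proof (rule diffeologicalI)
  fix n U p assume p: "plots (tot (dual_bundle V)) n U p"
  note pd = p[unfolded plots_dual_iff[OF T]]
  show U: "openin (Euclidean_space n) U" using pd by blast
  show pin: "p u \<in> pts (tot (dual_bundle V))" if "u \<in> U" for u
    using pd[THEN conjunct2, THEN conjunct1] that by blast
  show "plots (tot (dual_bundle V)) n U q" if q: "\<And>u. u \<in> U \<Longrightarrow> q u = p u" for q
  proof (rule plots_dualI[OF T U])
    show "plots (base V) n U (\<lambda>u. fst (q u))"
      by (rule plots_cong[OF B pd[THEN conjunct2, THEN conjunct2, THEN conjunct1]]) (simp add: q)
    fix l S a r assume a: "openin (Euclidean_space l) S" "smooth_param l S n a" "a ` S \<subseteq> U" "plots (tot V) l S r"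
      and eq: "\<And>t. t \<in> S \<Longrightarrow> fst (q (a t)) = bproj V (r t)"
    have "\<And>t. t \<in> S \<Longrightarrow> q (a t) = p (a t)" using q a(3) by auto
    then show "smooth_fun l S (\<lambda>t. snd (q (a t)) (r t))"
      using eq by (intro smooth_fun_cong[OF a(1) plots_dual_eval[OF T p a]]) auto
  qed (simp add: q pin)
  fix m W g assume W: "openin (Euclidean_space m) W" "smooth_param m W n g" "g ` W \<subseteq> U"
  show "plots (tot (dual_bundle V)) m W (\<lambda>w. p (g w))"
  proof (rule plots_dualI[OF T W(1)])
    show "p (g w) \<in> pts (tot (dual_bundle V))" if "w \<in> W" for w
      using pin W(3) that by auto
    show "plots (base V) m W (\<lambda>w. fst (p (g w)))"
      by (rule plots_compose[OF B pd[THEN conjunct2, THEN conjunct2, THEN conjunct1] W])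
    fix l S a r assume a: "openin (Euclidean_space l) S" "smooth_param l S m a" "a ` S \<subseteq> W" "plots (tot V) l S r"
      and eq: "\<And>t. t \<in> S \<Longrightarrow> fst (p (g (a t))) = bproj V (r t)"
    show "smooth_fun l S (\<lambda>t. snd (p (g (a t))) (r t))"
      by (rule plots_dual_eval[OF T p a(1) smooth_param_compose[OF W(1) a(1,3,2) W(2)] _ a(4)])
        (use a(3) W(3) eq in auto)
  qed
next
  fix n U x assume x: "x \<in> pts (tot (dual_bundle V))" and U: "openin (Euclidean_space n) U"
  show "plots (tot (dual_bundle V)) n U (\<lambda>_. x)"
  proof (rule plots_dualI[OF T U])
    show "plots (base V) n U (\<lambda>_. fst x)"
      by (rule plots_const[OF B pts_dual_base[OF x] U])
    fix l S a r assume "plots (tot V) l S r" "\<And>t. t \<in> S \<Longrightarrow> fst x = bproj V (r t)"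
    then show "smooth_fun l S (\<lambda>t. snd x (r t))"
      using plots_in[OF T] by (intro pts_dual_smooth[OF x]) (simp_all add: vert_def)
  qed (rule x)
next
  fix n U p assume U: "openin (Euclidean_space n) U"
    and loc: "\<And>u. u \<in> U \<Longrightarrow> \<exists>W. openin (Euclidean_space n) W \<and> u \<in> W \<and> W \<subseteq> U \<and> plots (tot (dual_bundle V)) n W p"
  show "plots (tot (dual_bundle V)) n U p"
  proof (rule plots_dualI[OF T U])
    show "p u \<in> pts (tot (dual_bundle V))" if "u \<in> U" for u
      using loc[OF that] unfolding plots_dual_iff[OF T] by blast
    show "plots (base V) n U (\<lambda>u. fst (p u))"
    proof (rule plots_local[OF B U])
      fix u assume "u \<in> U"
      from loc[OF this] obtain W where "openin (Euclidean_space n) W" "u \<in> W" "W \<subseteq> U" "plots (tot (dual_bundle V)) n W p"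
        by (elim exE conjE)
      then show "\<exists>W. openin (Euclidean_space n) W \<and> u \<in> W \<and> W \<subseteq> U \<and> plots (base V) n W (\<lambda>u. fst (p u))"
        by (intro exI[of _ W]) (simp add: plots_dual_iff[OF T])
    qed
    fix l S a r assume a: "openin (Euclidean_space l) S" "smooth_param l S n a" "a ` S \<subseteq> U" "plots (tot V) l S r"
      and eq: "\<And>t. t \<in> S \<Longrightarrow> fst (p (a t)) = bproj V (r t)"
    show "smooth_fun l S (\<lambda>t. snd (p (a t)) (r t))"
    proof (rule smooth_fun_local[OF a(1)])
      fix t assume t: "t \<in> S"
      then have "a t \<in> U" using a(3) by blast
      from loc[OF this] obtain W where W: "openin (Euclidean_space n) W" "a t \<in> W" "W \<subseteq> U" "plots (tot (dual_bundle V)) n W p"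
        by (elim exE conjE)
      \<comment> \<open>Locality of \<open>p\<close> at \<open>a t\<close> is pulled back along
        \<open>a\<close> to a neighbourhood of \<open>t\<close>.\<close>
      let ?S = "{s \<in> S. a s \<in> W}"
      have S: "openin (Euclidean_space l) ?S" by (rule smooth_param_vimage[OF a(1,2) W(1)])
      have "smooth_fun l ?S (\<lambda>t. snd (p (a t)) (r t))"
        by (rule plots_dual_eval[OF T W(4) S smooth_param_subset[OF a(2)] _ plots_subset[OF T a(4) S]])
          (use eq in auto)
      then show "\<exists>W. openin (Euclidean_space l) W \<and> t \<in> W \<and> W \<subseteq> S \<and> smooth_fun l W (\<lambda>t. snd (p (a t)) (r t))"
        using S t W(2) by (intro exI[of _ ?S]) auto
    qed
  qed
qed

lemma pseudo_bundle_dual: "pseudo_bundle (dual_bundle V)"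
proof (rule pseudo_bundleI)
  show "diffeological (tot (dual_bundle V))" by (rule diffeological_dual)
  show "vectorspace class_ring (fibre (dual_bundle V) x)" if "x \<in> pts (base (dual_bundle V))" for x
    using vectorspace_fibre_dual that by simp
  have pl: "plots (base V) n U (\<lambda>u. fst (p u))" if "plots (tot (dual_bundle V)) n U p" for n U p
    using that unfolding plots_dual_iff[OF T] by blast
  then show "plots (base (dual_bundle V)) n U (\<lambda>u. bproj (dual_bundle V) (p u))"
    if "plots (tot (dual_bundle V)) n U p" for n U p
    using that by simp
  note pin = plots_in[OF diffeological_dual] and popen = plots_open[OF diffeological_dual]

  fix n U p assume p: "plots (tot (dual_bundle V)) n U p"
  show "plots (tot (dual_bundle V)) n U (\<lambda>u. vadd (dual_bundle V) (p u) (q u))"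
    if q: "plots (tot (dual_bundle V)) n U q" and e: "\<And>u. u \<in> U \<Longrightarrow> bproj (dual_bundle V) (p u) = bproj (dual_bundle V) (q u)" for q
  proof (rule plots_dualI[OF T popen[OF p]])
    show "vadd (dual_bundle V) (p u) (q u) \<in> pts (tot (dual_bundle V))" if "u \<in> U" for u
      using dual_vadd_closed[OF pin[OF p that] pin[OF q that]] e[OF that] by simp
    show "plots (base V) n U (\<lambda>u. fst (vadd (dual_bundle V) (p u) (q u)))"
      using pl[OF p] by simp
    fix l S a r assume a: "openin (Euclidean_space l) S" "smooth_param l S n a" "a ` S \<subseteq> U" "plots (tot V) l S r"
      and eq: "\<And>t. t \<in> S \<Longrightarrow> fst (vadd (dual_bundle V) (p (a t)) (q (a t))) = bproj V (r t)"
    have eq': "fst (p (a t)) = bproj V (r t)" "fst (q (a t)) = bproj V (r t)" if "t \<in> S" for t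
      using eq[OF that] e[of "a t"] that a(3) by auto
    show "smooth_fun l S (\<lambda>t. snd (vadd (dual_bundle V) (p (a t)) (q (a t))) (r t))"
      unfolding dual_bundle_simps snd_conv
      by (rule smooth_fun_cong[OF a(1) smooth_fun_add[OF plots_dual_eval[OF T p a eq'(1)] plots_dual_eval[OF T q a eq'(2)]]])
        (simp_all add: vert_def eq' plots_in[OF T a(4)])
  qed
  show "plots (tot (dual_bundle V)) n U (\<lambda>u. vsmul (dual_bundle V) (s u) (p u))" if s: "smooth_fun n U s" for s
  proof (rule plots_dualI[OF T popen[OF p]])
    show "vsmul (dual_bundle V) (s u) (p u) \<in> pts (tot (dual_bundle V))" if "u \<in> U" for u
      by (rule dual_vsmul_closed[OF pin[OF p that]])
    show "plots (base V) n U (\<lambda>u. fst (vsmul (dual_bundle V) (s u) (p u)))"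
      using pl[OF p] by simp
    fix l S a r assume a: "openin (Euclidean_space l) S" "smooth_param l S n a" "a ` S \<subseteq> U" "plots (tot V) l S r"
      and eq: "\<And>t. t \<in> S \<Longrightarrow> fst (vsmul (dual_bundle V) (s (a t)) (p (a t))) = bproj V (r t)"
    have eq': "fst (p (a t)) = bproj V (r t)" if "t \<in> S" for t
      using eq[OF that] by simp
    show "smooth_fun l S (\<lambda>t. snd (vsmul (dual_bundle V) (s (a t)) (p (a t))) (r t))"
      unfolding dual_bundle_simps snd_conv
      by (rule smooth_fun_cong[OF a(1) smooth_fun_mult[OF smooth_fun_compose[OF popen[OF p] a(1,3,2) s] plots_dual_eval[OF T p a eq']]])
        (simp_all add: vert_def eq' plots_in[OF T a(4)])
  qed
next
  fix n U p assume p: "plots (base (dual_bundle V)) n U p"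
  then have p': "plots (base V) n U p" by simp
  show "plots (tot (dual_bundle V)) n U (\<lambda>u. vzero (dual_bundle V) (p u))"
  proof (rule plots_dualI[OF T plots_open[OF B p']])
    show "vzero (dual_bundle V) (p u) \<in> pts (tot (dual_bundle V))" if "u \<in> U" for u
      by (rule dual_vzero_closed[OF plots_in[OF B p' that]])
    show "plots (base V) n U (\<lambda>u. fst (vzero (dual_bundle V) (p u)))"
      using p' by simp
    fix l S a r assume a: "openin (Euclidean_space l) S" "plots (tot V) l S r"
      and eq: "\<And>t. t \<in> S \<Longrightarrow> fst (vzero (dual_bundle V) (p (a t))) = bproj V (r t)"
    show "smooth_fun l S (\<lambda>t. snd (vzero (dual_bundle V) (p (a t))) (r t))"
      by (rule smooth_fun_cong[OF a(1) smooth_fun_const[of _ _ 0]])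
        (use eq plots_in[OF T a(2)] in \<open>simp add: vert_def\<close>)
  qed
qed (simp_all add: B pts_dual_base)

end

section \<open>Duals of gluings\<close>

locale dual_gluing =
  fixes V1 :: "('v1, 'x1) vbundle" and V2 :: "('v2, 'x2) vbundle"
    and Y :: "'x1 set" and f :: "'x1 \<Rightarrow> 'x2" and F :: "'v1 \<Rightarrow> 'v2"
  assumes V1: "pseudo_bundle V1" and V2: "pseudo_bundle V2"
    and gl: "gluing V1 V2 Y f F"
    and f_diffeo: "ddiffeo (dsub (base V1) Y) (dsub (base V2) (f ` Y)) f"
    and commutes: "gluing_dual_commutes V1 V2 Y f F"
begin

abbreviation "G \<equiv> glue_bundle V1 V2 Y f F"
abbreviation "D1 \<equiv> dual_bundle V1"
abbreviation "D2 \<equiv> dual_bundle V2"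
text \<open>\<open>dG\<close> is the dual of the gluing and \<open>DG\<close> the gluing of the
  duals. The latter has \<open>D2\<close> on the left because covectors are pulled back along
  \<open>F\<close>.\<close>

abbreviation "dG \<equiv> dual_bundle G"
abbreviation "DG \<equiv> dual_glue V1 V2 Y f F"
abbreviation "g \<equiv> inv_into Y f"
abbreviation "lift \<equiv> dual_lift V1 Y f F"
abbreviation "\<Phi> \<equiv> \<Phi>_dual V1 V2 Y f F"
abbreviation "sw \<equiv> switch_map Y f"

lemma Y_sub: "y \<in> Y \<Longrightarrow> y \<in> pts (base V1)"
  using gl unfolding gluing_def by blast

lemma f_base: "y \<in> Y \<Longrightarrow> f y \<in> pts (base V2)"
  using gl Y_sub unfolding gluing_def dsmooth_def by auto

lemma f_inj: "inj_on f Y"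
proof -
  have "pts (base V1) \<inter> Y = Y" using Y_sub by blast
  then show ?thesis using f_diffeo unfolding ddiffeo_def bij_betw_def by simp
qed

lemma g_f: "y \<in> Y \<Longrightarrow> g (f y) = y"
  by (rule inv_into_f_f[OF f_inj])

lemma g_in: "x \<in> f ` Y \<Longrightarrow> g x \<in> Y" and f_g: "x \<in> f ` Y \<Longrightarrow> f (g x) = x"
  by (rule inv_into_into, assumption) (rule f_inv_into_f, assumption)

text \<open>The inverse in the hypothesis on \<open>f\<close> is taken on
  \<open>pts (base V1) \<inter> Y\<close>, which is \<open>Y\<close>; it is therefore
  \<open>g\<close>, and its smoothness is part of \<open>f\<close> being a diffeomorphism with its
  image.\<close>

lemma g_plots:
  assumes "plots (base V2) n U p" "\<And>u. u \<in> U \<Longrightarrow> p u \<in> f ` Y"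
  shows "plots (base V1) n U (\<lambda>u. g (p u))"
proof -
  have "pts (base V1) \<inter> Y = Y" using Y_sub by blast
  then have "dsmooth (dsub (base V2) (f ` Y)) (dsub (base V1) Y) g"
    using f_diffeo unfolding ddiffeo_def by simp
  then have "plots (dsub (base V1) Y) n U (\<lambda>u. g (p u))"
    by (rule dsmooth_plots) (simp add: plots_dsub assms)
  then show ?thesis by (simp add: plots_dsub)
qed

lemma F_plots:
  assumes "plots (tot V1) n U p" "\<And>u. u \<in> U \<Longrightarrow> bproj V1 (p u) \<in> Y"
  shows "plots (tot V2) n U (\<lambda>u. F (p u))"
proof (rule dsmooth_plots[of "dsub (tot V1) (over V1 Y)"])
  show "dsmooth (dsub (tot V1) (over V1 Y)) (tot V2) F"
    using gl unfolding gluing_def by blast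
  show "plots (dsub (tot V1) (over V1 Y)) n U p"
    using assms plots_in[OF pseudo_bundle_tot[OF V1] assms(1)] by (simp add: plots_dsub over_def)
qed

lemma F_linear: "y \<in> Y \<Longrightarrow> linear_map class_ring (fibre V1 y) (fibre V2 (f y)) F"
  using gl unfolding gluing_def by blast

lemma F_vert: "y \<in> Y \<Longrightarrow> v \<in> vert V1 y \<Longrightarrow> F v \<in> vert V2 (f y)"
  using linear_mapD(3)[OF F_linear, of y v] by simp

lemma F_over: "v \<in> over V1 Y \<Longrightarrow> F v \<in> pts (tot V2)"
  using F_vert[of "bproj V1 v" v] by (auto simp: over_def vert_def)

lemma G_tot: "diffeological (tot G)" and G_base: "diffeological (base G)"
  using diffeological_dglue pseudo_bundle_tot[OF V1] pseudo_bundle_tot[OF V2]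
    pseudo_bundle_base[OF V1] pseudo_bundle_base[OF V2] by simp_all

lemma G_fibre: "c \<in> pts (base G) \<Longrightarrow> vectorspace class_ring (fibre G c)"
  by (rule vectorspace_fibre_glue[of V1 Y F V2 f, OF F_over f_base pseudo_bundle_fibre[OF V1] pseudo_bundle_fibre[OF V2]])

lemma pts_base_G: "pts (base G) = Inl ` (pts (base V1) - Y) \<union> Inr ` pts (base V2)"
  unfolding glue_bundle_simps using f_base by (rule pts_dglue_disjoint)

lemma vert_G: "vert G (Inr y) = Inr ` vert V2 y" "x \<notin> Y \<Longrightarrow> vert G (Inl x) = Inl ` vert V1 x"
  by (simp_all add: vert_glue[of V1 Y F V2, OF F_over])

lemma D1: "pseudo_bundle D1" and D2: "pseudo_bundle D2" and dG: "pseudo_bundle dG"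
proof -
  show "pseudo_bundle D1"
    by (rule pseudo_bundle_dual[OF pseudo_bundle_tot[OF V1] pseudo_bundle_base[OF V1] pseudo_bundle_fibre[OF V1]])
  show "pseudo_bundle D2"
    by (rule pseudo_bundle_dual[OF pseudo_bundle_tot[OF V2] pseudo_bundle_base[OF V2] pseudo_bundle_fibre[OF V2]])
  show "pseudo_bundle dG"
    by (rule pseudo_bundle_dual[OF G_tot G_base G_fibre])
qed

lemma lift_simps: "fst (lift a) = g (fst a)"
  "snd (lift a) = (\<lambda>v\<in>vert V1 (g (fst a)). snd a (F v))"
  by (simp_all add: dual_lift_def split_beta)

lemma lift_vert:
  assumes "a \<in> pts (tot D2)" "fst a \<in> f ` Y"
  shows "lift a \<in> pts (tot D1)"
proof -
  have y: "g (fst a) \<in> Y" and fy: "f (g (fst a)) = fst a"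
    using g_in f_g assms(2) by auto
  have "(g (fst a), restrict (\<lambda>v. snd a (F v)) (vert V1 (g (fst a)))) \<in> pts (tot D1)"
  proof (rule pts_dualI[OF Y_sub[OF y] _ pseudo_bundle_tot[OF V1]])
    show "linear_map class_ring (fibre V1 (g (fst a))) real_line (\<lambda>v. snd a (F v))"
      by (rule linear_map_compose[OF F_linear[OF y]]) (simp add: fy pts_dual_linear[OF assms(1)])
    fix n U p assume p: "plots (tot V1) n U p" "\<And>u. u \<in> U \<Longrightarrow> p u \<in> vert V1 (g (fst a))"
    show "smooth_fun n U (\<lambda>u. snd a (F (p u)))"
    proof (rule pts_dual_smooth[OF assms(1)])
      show "plots (tot V2) n U (\<lambda>u. F (p u))"
        by (rule F_plots[OF p(1)]) (use p(2) y in \<open>auto simp: vert_def\<close>)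
      show "F (p u) \<in> vert V2 (fst a)" if "u \<in> U" for u
        using F_vert[OF y p(2)[OF that]] fy by simp
    qed
  qed
  then show ?thesis by (simp add: dual_lift_def split_beta)
qed

lemma lift_linear:
  assumes x: "x \<in> f ` Y"
  shows "linear_map class_ring (fibre D2 x) (fibre D1 (g x)) lift"
proof -
  have y: "g x \<in> Y" and fy: "f (g x) = x"
    using g_in f_g x by auto
  have Fv: "F v \<in> vert V2 x" if "v \<in> vert V1 (g x)" for v
    using F_vert[OF y that] fy by simp
  show ?thesis
  proof (rule linear_mapI)
    show "vectorspace class_ring (fibre D2 x)" "vectorspace class_ring (fibre D1 (g x))"
      using pseudo_bundle_fibre[OF D2, of x] pseudo_bundle_fibre[OF D1, of "g x"] f_base[OF y] Y_sub[OF y]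
      by (simp_all add: fy)
  next
    fix a b r assume "a \<in> carrier (fibre D2 x)"
    then have a: "a \<in> pts (tot D2)" "fst a = x" by (simp_all add: vert_def)
    then show "lift a \<in> carrier (fibre D1 (g x))"
      using lift_vert[of a] x by (simp add: vert_def lift_simps)
    show "lift (r \<odot>\<^bsub>fibre D2 x\<^esub> a) = r \<odot>\<^bsub>fibre D1 (g x)\<^esub> lift a"
      by (rule prod_eqI) (simp_all add: lift_simps a Fv cong: restrict_cong)
    assume "b \<in> carrier (fibre D2 x)"
    then have b: "b \<in> pts (tot D2)" "fst b = x" by (simp_all add: vert_def)
    show "lift (a \<oplus>\<^bsub>fibre D2 x\<^esub> b) = lift a \<oplus>\<^bsub>fibre D1 (g x)\<^esub> lift b"
      by (rule prod_eqI) (simp_all add: lift_simps a b Fv cong: restrict_cong)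
  qed
qed

text \<open>Evaluating the lifted covectors on a plot \<open>p\<close> of \<open>V1\<close> amounts
  to evaluating \<open>q\<close> on \<open>F\<close> composed with \<open>p\<close>, a plot of
  \<open>V2\<close> over the same base points. The projection is a plot because \<open>g\<close> is
  smooth on f(Y).\<close>

lemma lift_plots:
  assumes q: "plots (tot D2) n U q" and y: "\<And>u. u \<in> U \<Longrightarrow> fst (q u) \<in> f ` Y"
  shows "plots (tot D1) n U (\<lambda>u. lift (q u))"
proof -
  note T2 = pseudo_bundle_tot[OF V2] and T1 = pseudo_bundle_tot[OF V1]
  show ?thesis
  proof (rule plots_dualI[OF T1 plots_open[OF pseudo_bundle_tot[OF D2] q]])
    show "lift (q u) \<in> pts (tot D1)" if "u \<in> U" for u
      by (rule lift_vert[OF plots_in[OF pseudo_bundle_tot[OF D2] q that] y[OF that]])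
    show "plots (base V1) n U (\<lambda>u. fst (lift (q u)))"
      unfolding lift_simps using pseudo_bundle_plots_bproj[OF D2 q] y by (intro g_plots) simp_all
    fix l S a p assume a: "openin (Euclidean_space l) S" "smooth_param l S n a" "a ` S \<subseteq> U" "plots (tot V1) l S p"
      and eq: "\<And>t. t \<in> S \<Longrightarrow> fst (lift (q (a t))) = bproj V1 (p t)"
    have aU: "a t \<in> U" if "t \<in> S" for t using a(3) that by blast
    have pY: "bproj V1 (p t) \<in> Y" if "t \<in> S" for t
      using eq[OF that] g_in[OF y[OF aU[OF that]]] by (simp add: lift_simps)
    have pv: "p t \<in> vert V1 (g (fst (q (a t))))" if "t \<in> S" for t
      using eq[OF that] plots_in[OF T1 a(4) that] by (simp add: vert_def lift_simps)
    have e: "fst (q (a t)) = bproj V2 (F (p t))" if "t \<in> S" for t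
      using F_vert[OF g_in[OF y[OF aU[OF that]]] pv[OF that]] f_g[OF y[OF aU[OF that]]] by (simp add: vert_def)
    show "smooth_fun l S (\<lambda>t. snd (lift (q (a t))) (p t))"
      by (rule smooth_fun_cong[OF a(1) plots_dual_eval[OF T2 q a(1-3) F_plots[OF a(4) pY] e]])
        (simp_all add: lift_simps pv)
  qed
qed

lemma DG_eq: "DG = glue_bundle D2 D1 (f ` Y) g lift"
  by (simp add: dual_glue_def)

lemma lift_over: "a \<in> over D2 (f ` Y) \<Longrightarrow> lift a \<in> pts (tot D1)"
  using lift_vert by (simp add: over_def)

lemma g_base: "x \<in> f ` Y \<Longrightarrow> g x \<in> pts (base D1)"
  using Y_sub g_in by simp

lemma base_DG: "base DG = dglue (base V2) (base V1) (f ` Y) g"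
  and tot_DG: "tot DG = dglue (tot D2) (tot D1) (over D2 (f ` Y)) lift"
  and bproj_DG: "bproj DG = map_sum fst fst"
  by (simp_all add: DG_eq)

lemma pts_base_DG: "pts (base DG) = Inl ` (pts (base V2) - f ` Y) \<union> Inr ` pts (base V1)"
  unfolding base_DG using g_base by (intro pts_dglue_disjoint) simp

lemma DG_fibre: "c \<in> pts (base DG) \<Longrightarrow> vectorspace class_ring (fibre DG c)"
  unfolding DG_eq
  by (rule vectorspace_fibre_glue[of D2 "f ` Y" lift D1 g, OF lift_over g_base pseudo_bundle_fibre[OF D2] pseudo_bundle_fibre[OF D1]])

lemma vert_DG: "vert DG (Inr y) = Inr ` vert D1 y" "x \<notin> f ` Y \<Longrightarrow> vert DG (Inl x) = Inl ` vert D2 x"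
  by (simp_all add: DG_eq vert_glue[of D2 "f ` Y" lift D1, OF lift_over])

lemma Inr_DG_linear: "x \<in> pts (base V1) \<Longrightarrow> linear_map class_ring (fibre D1 x) (fibre DG (Inr x)) Inr"
  unfolding DG_eq using pseudo_bundle_fibre[OF D1]
  by (intro linear_map_Inr_glue[of D2 "f ` Y" lift D1, OF lift_over]) simp_all

lemma Inl_DG_linear: "x \<in> pts (base V2) \<Longrightarrow> x \<notin> f ` Y \<Longrightarrow> linear_map class_ring (fibre D2 x) (fibre DG (Inl x)) Inl"
  unfolding DG_eq using pseudo_bundle_fibre[OF D2]
  by (intro linear_map_Inl_glue[of D2 "f ` Y" lift D1, OF lift_over]) simp_all

subsection \<open>The switch map\<close>

text \<open>The canonical map of the whole left base to the glued base. Unlike \<open>Inl\<close> it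
  is meaningful on \<open>Y\<close>, and it is smooth, being the quotient projection restricted to
  the left factor.\<close>

definition "i1 x = glue_map Y f (Inl x)"

lemma i1_simps: "x \<in> Y \<Longrightarrow> i1 x = Inr (f x)" "x \<notin> Y \<Longrightarrow> i1 x = Inl x"
  by (simp_all add: i1_def)

lemma i1_base: "x \<in> pts (base V1) \<Longrightarrow> i1 x \<in> pts (base G)"
  by (auto simp: i1_def pts_dglue)

lemma Inr_base_G: "x \<in> pts (base V2) \<Longrightarrow> Inr x \<in> pts (base G)"
  by (auto simp: pts_dglue)

lemma sw_i1: "x \<in> pts (base V1) \<Longrightarrow> sw (i1 x) = Inr x"
  by (cases "x \<in> Y") (simp_all add: i1_simps switch_map_def g_f)

lemma sw_Inr: "sw (Inr x) = glue_map (f ` Y) g (Inl x)"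
  by (simp add: switch_map_def glue_map_def)

text \<open>Points are sorted by their image under the switch map. Points coming from
  \<open>Y\<close> are right-hand points of the glued base but belong to the first case, since the
  switch map sends them to the copy of the base of \<open>V1\<close>.\<close>

lemma sw_cases:
  assumes "c \<in> pts (base G)"
  obtains (left) x where "x \<in> pts (base V1)" "c = i1 x" "sw c = Inr x"
    | (right) x where "x \<in> pts (base V2)" "x \<notin> f ` Y" "c = Inr x" "sw c = Inl x"
proof -
  consider x where "x \<in> pts (base V1)" "x \<notin> Y" "c = Inl x" | x where "x \<in> pts (base V2)" "c = Inr x"
    using assms unfolding pts_base_G by blast
  then show thesis
  proof cases
    case (1 x)
    then show thesis using left[of x] sw_i1[of x] by (simp add: i1_simps)
  next
    case (2 x)
    show thesis
    proof (cases "x \<in> f ` Y")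
      case True
      then have "c = i1 (g x)" using 2 g_in f_g by (simp add: i1_simps)
      then show thesis using left[of "g x"] sw_i1[of "g x"] Y_sub[OF g_in[OF True]] by simp
    next
      case False
      then show thesis using right[of x] 2 by (simp add: switch_map_def)
    qed
  qed
qed

lemma sw_base: "c \<in> pts (base G) \<Longrightarrow> sw c \<in> pts (base DG)"
  by (erule sw_cases) (auto simp: pts_base_DG)

lemma sw_inj: "c \<in> pts (base G) \<Longrightarrow> c' \<in> pts (base G) \<Longrightarrow> sw c = sw c' \<Longrightarrow> c = c'"
  by (erule sw_cases; erule sw_cases) auto

text \<open>The switch map interchanges the canonical maps of the two factors: \<open>i1\<close>
  becomes \<open>Inr\<close>, and \<open>Inr\<close> becomes the quotient projection on the left
  factor. A local lift of a plot thus also lifts its image.\<close>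

lemma sw_plots:
  assumes "plots (base G) n U c"
  shows "plots (base DG) n U (\<lambda>u. sw (c u))"
  unfolding base_DG
proof (rule plots_local[OF diffeological_dglue[OF pseudo_bundle_base[OF V2] pseudo_bundle_base[OF V1]] plots_open[OF G_base assms]])
  note B1 = pseudo_bundle_base[OF V1] and B2 = pseudo_bundle_base[OF V2]
  fix u assume "u \<in> U"
  with B1 B2 assms[unfolded glue_bundle_simps]
  show "\<exists>W. openin (Euclidean_space n) W \<and> u \<in> W \<and> W \<subseteq> U \<and>
      plots (dglue (base V2) (base V1) (f ` Y) g) n W (\<lambda>u. sw (c u))"
  proof (cases rule: plots_dglueE)
    case (left W q)
    have "plots (dglue (base V2) (base V1) (f ` Y) g) n W (\<lambda>u. sw (c u))"
      by (rule plots_cong[OF diffeological_dglue[OF B2 B1] plots_dglue_right[OF B2 B1 left(4)]])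
        (simp add: left(5) sw_i1[unfolded i1_def] plots_in[OF B1 left(4)])
    then show ?thesis using left by blast
  next
    case (right W q)
    have "plots (dglue (base V2) (base V1) (f ` Y) g) n W (\<lambda>u. sw (c u))"
      by (rule plots_cong[OF diffeological_dglue[OF B2 B1] plots_dglue_left[OF B2 B1 right(4)]])
        (simp add: right(5) sw_Inr)
    then show ?thesis using right by blast
  qed
qed

subsection \<open>The commutativity diffeomorphism on fibres\<close>

lemma \<Phi>_bij: "bij_betw \<Phi> (pts (tot dG)) (pts (tot DG))"
  and \<Phi>_plots: "plots (tot dG) n U p \<Longrightarrow> plots (tot DG) n U (\<lambda>u. \<Phi> (p u))"
  and \<Phi>_inv_plots: "plots (tot DG) n U q \<Longrightarrow> plots (tot dG) n U (\<lambda>u. inv_into (pts (tot dG)) \<Phi> (q u))"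
  using commutes unfolding gluing_dual_commutes_def ddiffeo_def by (auto intro: dsmooth_plots)

lemma \<Phi>_Inl: "\<Phi> (Inl x, \<xi>) = Inr (x, restrict (\<lambda>v. \<xi> (Inl v)) (vert V1 x))"
  and \<Phi>_Inr_Y: "y \<in> f ` Y \<Longrightarrow> \<Phi> (Inr y, \<xi>) = Inr (lift (y, restrict (\<lambda>v. \<xi> (Inr v)) (vert V2 y)))"
  and \<Phi>_Inr: "y \<notin> f ` Y \<Longrightarrow> \<Phi> (Inr y, \<xi>) = Inl (y, restrict (\<lambda>v. \<xi> (Inr v)) (vert V2 y))"
  by (simp_all add: \<Phi>_dual_def)

lemma \<Phi>_bproj: "bproj DG (\<Phi> a) = sw (fst a)"
  by (cases a) (auto simp: bproj_DG \<Phi>_dual_def switch_map_def lift_simps split: sum.splits)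

lemma \<Phi>_vert: "a \<in> vert dG c \<Longrightarrow> \<Phi> a \<in> vert DG (sw c)"
  using \<Phi>_bij \<Phi>_bproj[of a] by (auto simp: vert_def bij_betw_def)

lemma \<Phi>_linear:
  assumes c: "c \<in> pts (base G)"
  shows "linear_map class_ring (fibre dG c) (fibre DG (sw c)) \<Phi>"
proof (rule linear_mapI)
  show "vectorspace class_ring (fibre dG c)" "vectorspace class_ring (fibre DG (sw c))"
    using pseudo_bundle_fibre[OF dG] c DG_fibre[OF sw_base[OF c]] by simp_all
  show "\<Phi> a \<in> carrier (fibre DG (sw c))" if "a \<in> carrier (fibre dG c)" for a
    using \<Phi>_vert that by simp
  \<comment> \<open>The three regions on each of which \<open>\<Phi>_dual\<close> is given by one
    formula.\<close>
  consider (1) x where "x \<notin> Y" "c = Inl x" | (2) x where "x \<in> f ` Y" "c = Inr x" | (3) x where "x \<notin> f ` Y" "c = Inr x"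
    using c unfolding pts_base_G by blast
  note cs = this
  have FV: "F v \<in> vert V2 x" if "x \<in> f ` Y" "v \<in> vert V1 (g x)" for x v
    using F_vert[OF g_in[OF that(1)] that(2)] f_g[OF that(1)] by simp
  fix a b r assume "a \<in> carrier (fibre dG c)"
  then have a: "fst a = c" by (simp add: vert_def)
  show "\<Phi> (r \<odot>\<^bsub>fibre dG c\<^esub> a) = r \<odot>\<^bsub>fibre DG (sw c)\<^esub> \<Phi> a"
    using cs
  proof cases
    case 1
    then show ?thesis using a by (cases a) (auto simp: \<Phi>_Inl DG_eq vert_G intro!: restrict_ext)
  next
    case 2
    then show ?thesis using a FV[OF 2(1)]
      by (cases a) (auto simp: \<Phi>_Inr_Y DG_eq vert_G lift_simps intro!: prod_eqI restrict_ext)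
  next
    case 3
    then show ?thesis using a by (cases a) (auto simp: \<Phi>_Inr DG_eq vert_G intro!: restrict_ext)
  qed
  assume "b \<in> carrier (fibre dG c)"
  then have b: "fst b = c" by (simp add: vert_def)
  show "\<Phi> (a \<oplus>\<^bsub>fibre dG c\<^esub> b) = \<Phi> a \<oplus>\<^bsub>fibre DG (sw c)\<^esub> \<Phi> b"
    using cs
  proof cases
    case 1
    then show ?thesis using a b by (cases a; cases b) (auto simp: \<Phi>_Inl DG_eq vert_G intro!: restrict_ext)
  next
    case 2
    then show ?thesis using a b FV[OF 2(1)]
      by (cases a; cases b) (auto simp: \<Phi>_Inr_Y DG_eq vert_G lift_simps intro!: prod_eqI restrict_ext)
  next
    case 3
    then show ?thesis using a b by (cases a; cases b) (auto simp: \<Phi>_Inr DG_eq vert_G intro!: restrict_ext)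
  qed
qed

text \<open>\<open>B1\<close> and \<open>B2\<close> carry covectors of \<open>V1\<close> and
  \<open>V2\<close> to the dual of the gluing: project to the gluing of the duals and invert \<Phi>.
  Both are smooth as composites of smooth maps, and over f(Y) no inverse of \<open>F\<close> or of
  its dual has to be written down.\<close>

definition "B1 \<zeta> = inv_into (pts (tot dG)) \<Phi> (Inr \<zeta>)"
definition "B2 \<eta> = inv_into (pts (tot dG)) \<Phi> (glue_map (over D2 (f ` Y)) lift (Inl \<eta>))"
text \<open>\<open>P1\<close> and \<open>P2\<close> read off the component of \<Phi> on one side.
  They invert \<open>B1\<close> over the image of \<open>i1\<close>, and \<open>B2\<close> over the
  points outside f(Y).\<close>

definition "P1 a = projr (\<Phi> a)"
definition "P2 a = projl (\<Phi> a)"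

text \<open>The base point of the preimage is pinned down by injectivity of the switch map, which
  \<Phi> covers.\<close>

lemma inv_\<Phi>_vert:
  assumes "c \<in> pts (base G)" "b \<in> vert DG (sw c)"
  shows "inv_into (pts (tot dG)) \<Phi> b \<in> vert dG c \<and> \<Phi> (inv_into (pts (tot dG)) \<Phi> b) = b"
proof -
  let ?a = "inv_into (pts (tot dG)) \<Phi> b"
  have "b \<in> \<Phi> ` pts (tot dG)"
    using \<Phi>_bij assms(2) by (simp add: bij_betw_def vert_def)
  then have a: "?a \<in> pts (tot dG)" "\<Phi> ?a = b"
    by (simp_all add: inv_into_into f_inv_into_f)
  have "sw (fst ?a) = sw c"
    using \<Phi>_bproj[of ?a] a(2) assms(2) by (simp add: vert_def)
  then have "fst ?a = c"
    using sw_inj[OF _ assms(1)] pts_dual_base[OF a(1)] by blast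
  with a show ?thesis by (simp add: vert_def)
qed

lemma inv_\<Phi>_linear:
  assumes c: "c \<in> pts (base G)"
  shows "linear_map class_ring (fibre DG (sw c)) (fibre dG c) (inv_into (pts (tot dG)) \<Phi>)"
proof (rule linear_map_inverse[OF \<Phi>_linear[OF c]])
  show "inv_into (pts (tot dG)) \<Phi> (\<Phi> a) = a" if "a \<in> carrier (fibre dG c)" for a
    using that \<Phi>_bij by (simp add: vert_def bij_betw_def)
qed (use inv_\<Phi>_vert[OF c] in simp)

lemma glue_lift: "glue_map (over D2 (f ` Y)) lift (Inl \<eta>) = (if fst \<eta> \<in> f ` Y then Inr (lift \<eta>) else Inl \<eta>)"
  if "\<eta> \<in> pts (tot D2)"
  using that by (simp add: glue_map_def over_def)

lemma glue_lift_bproj: "\<eta> \<in> pts (tot D2) \<Longrightarrow> bproj DG (glue_map (over D2 (f ` Y)) lift (Inl \<eta>)) = sw (Inr (fst \<eta>))"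
  by (auto simp: glue_lift bproj_DG lift_simps sw_Inr)

lemma B1_linear: "x \<in> pts (base V1) \<Longrightarrow> linear_map class_ring (fibre D1 x) (fibre dG (i1 x)) B1"
  unfolding B1_def using inv_\<Phi>_linear[OF i1_base] sw_i1
  by (intro linear_map_compose[OF Inr_DG_linear]) simp_all

text \<open>In the gluing of the duals, a covector over f(Y) and its lift are the same point, so
  they have the same preimage under \<Phi>.\<close>

lemma B2_lift: "\<eta> \<in> pts (tot D2) \<Longrightarrow> fst \<eta> \<in> f ` Y \<Longrightarrow> B2 \<eta> = B1 (lift \<eta>)"
  by (simp add: B1_def B2_def glue_lift)

lemma B2_linear:
  assumes x: "x \<in> pts (base V2)"
  shows "linear_map class_ring (fibre D2 x) (fibre dG (Inr x)) B2"
proof (cases "x \<in> f ` Y")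
  case True
  have "i1 (g x) = Inr x" using True g_in f_g by (simp add: i1_simps)
  then have "linear_map class_ring (fibre D2 x) (fibre dG (Inr x)) (\<lambda>\<eta>. B1 (lift \<eta>))"
    using linear_map_compose[OF lift_linear[OF True] B1_linear] g_base[OF True] by simp
  then show ?thesis
    by (rule linear_map_cong) (use True B2_lift in \<open>auto simp: vert_def\<close>)
next
  case False
  have sw: "sw (Inr x) = Inl x" using False by (simp add: switch_map_def)
  have "linear_map class_ring (fibre D2 x) (fibre dG (Inr x)) (\<lambda>\<eta>. inv_into (pts (tot dG)) \<Phi> (Inl \<eta>))"
    using inv_\<Phi>_linear[OF Inr_base_G[OF x]] sw by (intro linear_map_compose[OF Inl_DG_linear[OF x False]]) simp
  then show ?thesis
    by (rule linear_map_cong) (use False in \<open>auto simp: vert_def B2_def glue_lift\<close>)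
qed

lemma B1_plots: "plots (tot D1) n U q \<Longrightarrow> plots (tot dG) n U (\<lambda>u. B1 (q u))"
  unfolding B1_def
  by (rule \<Phi>_inv_plots, unfold tot_DG, rule plots_dglue_right[OF pseudo_bundle_tot[OF D2] pseudo_bundle_tot[OF D1]])

lemma B2_plots: "plots (tot D2) n U q \<Longrightarrow> plots (tot dG) n U (\<lambda>u. B2 (q u))"
  unfolding B2_def
  by (rule \<Phi>_inv_plots, unfold tot_DG, rule plots_dglue_left[OF pseudo_bundle_tot[OF D2] pseudo_bundle_tot[OF D1]])

lemma i1_plots: "plots (base V1) n U q \<Longrightarrow> plots (base G) n U (\<lambda>u. i1 (q u))"
  unfolding i1_def glue_bundle_simps
  by (rule plots_dglue_left[OF pseudo_bundle_base[OF V1] pseudo_bundle_base[OF V2]])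

lemma i2_plots: "plots (base V2) n U q \<Longrightarrow> plots (base G) n U (\<lambda>u. Inr (q u))"
  unfolding glue_bundle_simps
  by (rule plots_dglue_right[OF pseudo_bundle_base[OF V1] pseudo_bundle_base[OF V2]])

lemma \<Phi>_left: "x \<in> pts (base V1) \<Longrightarrow> a \<in> vert dG (i1 x) \<Longrightarrow> \<Phi> a = Inr (P1 a) \<and> P1 a \<in> vert D1 x"
  using \<Phi>_vert[of a "i1 x"] by (auto simp: sw_i1 vert_DG P1_def)

lemma \<Phi>_right:
  assumes "x \<notin> f ` Y" "a \<in> vert dG (Inr x)"
  shows "\<Phi> a = Inl (P2 a) \<and> P2 a \<in> vert D2 x"
proof -
  have "sw (Inr x) = Inl x" using assms(1) by (simp add: switch_map_def)
  then show ?thesis using \<Phi>_vert[OF assms(2)] vert_DG(2)[OF assms(1)] by (auto simp: P2_def)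
qed

lemma B1_P1: "x \<in> pts (base V1) \<Longrightarrow> a \<in> vert dG (i1 x) \<Longrightarrow> B1 (P1 a) = a"
  using \<Phi>_left[of x a] \<Phi>_bij by (metis B1_def bij_betw_inv_into_left vert_in_tot)

lemma P1_B1: "x \<in> pts (base V1) \<Longrightarrow> b \<in> vert D1 x \<Longrightarrow> P1 (B1 b) = b"
  using inv_\<Phi>_vert[OF i1_base, of x "Inr b"] by (simp add: B1_def P1_def sw_i1 vert_DG)

lemma B2_P2: "x \<notin> f ` Y \<Longrightarrow> a \<in> vert dG (Inr x) \<Longrightarrow> B2 (P2 a) = a"
  using \<Phi>_right[of x a] \<Phi>_bij
  by (metis B2_def bij_betw_inv_into_left glue_lift vert_dual_iff vert_in_tot)

lemma P2_B2:
  assumes "x \<in> pts (base V2)" "x \<notin> f ` Y" "b \<in> vert D2 x"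
  shows "P2 (B2 b) = b"
proof -
  have "sw (Inr x) = Inl x" using assms(2) by (simp add: switch_map_def)
  then show ?thesis
    using inv_\<Phi>_vert[OF Inr_base_G[OF assms(1)], of "Inl b"] assms
    by (simp add: B2_def P2_def vert_DG glue_lift vert_dual_iff)
qed

lemma P1_linear: "x \<in> pts (base V1) \<Longrightarrow> linear_map class_ring (fibre dG (i1 x)) (fibre D1 x) P1"
  by (rule linear_map_inverse[OF B1_linear]) (simp_all add: P1_B1 B1_P1 \<Phi>_left)

lemma P2_linear: "x \<in> pts (base V2) \<Longrightarrow> x \<notin> f ` Y \<Longrightarrow> linear_map class_ring (fibre dG (Inr x)) (fibre D2 x) P2"
  by (rule linear_map_inverse[OF B2_linear]) (simp_all add: P2_B2 B2_P2 \<Phi>_right)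

end

section \<open>Tensor powers of vector spaces\<close>

lemma lookup_scaleR [simp]:
  fixes a :: "('a, real) poly_mapping"
  shows "Poly_Mapping.lookup (r *\<^sub>R a) k = r * Poly_Mapping.lookup a k"
proof -
  have "finite {k. r * Poly_Mapping.lookup a k \<noteq> 0}"
    by (rule finite_subset[of _ "Poly_Mapping.keys a"]) (auto simp: in_keys_iff)
  then show ?thesis
    by (simp add: scaleR_poly_mapping_def)
qed

lemma keys_scaleR_subset:
  fixes a :: "('a, real) poly_mapping"
  shows "Poly_Mapping.keys (r *\<^sub>R a) \<subseteq> Poly_Mapping.keys a"
  by (auto simp: in_keys_iff)

text \<open>Summing over a larger finite set makes the sums for different arguments comparable term
  by term, whence linearity.\<close>

lemma lin_ext_superset:
  "finite S \<Longrightarrow> Poly_Mapping.keys a \<subseteq> S \<Longrightarrow> lin_ext \<phi> a = (\<Sum>l\<in>S. Poly_Mapping.lookup a l *\<^sub>R \<phi> l)"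
  unfolding lin_ext_def by (rule sum.mono_neutral_left) (auto simp: in_keys_iff)

lemma linear_lin_ext: "linear (lin_ext \<phi>)"
proof (rule linearI)
  fix a b :: "('a list, real) poly_mapping" and r :: real
  let ?S = "Poly_Mapping.keys a \<union> Poly_Mapping.keys b"
  show "lin_ext \<phi> (a + b) = lin_ext \<phi> a + lin_ext \<phi> b"
    using Poly_Mapping.keys_add[of a b]
    by (simp add: lin_ext_superset[of ?S] lookup_add scaleR_add_left sum.distrib)
  show "lin_ext \<phi> (r *\<^sub>R a) = r *\<^sub>R lin_ext \<phi> a"
    using keys_scaleR_subset[of r a]
    by (simp add: lin_ext_superset[of "Poly_Mapping.keys a"] scaleR_sum_right)
qed

lemma lin_ext_gen [simp]: "lin_ext \<phi> (gen l) = \<phi> l"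
  by (simp add: lin_ext_def)

lemma poly_mapping_eq_sum_gen:
  fixes a :: "('a list, real) poly_mapping"
  shows "a = (\<Sum>l\<in>Poly_Mapping.keys a. Poly_Mapping.lookup a l *\<^sub>R gen l)"
proof (rule poly_mapping_eqI)
  fix k
  have "(\<Sum>l\<in>Poly_Mapping.keys a. Poly_Mapping.lookup a l * (1 when l = k)) =
      (\<Sum>l\<in>Poly_Mapping.keys a. if l = k then Poly_Mapping.lookup a l else 0)"
    by (intro sum.cong) (auto simp: when_def)
  then show "Poly_Mapping.lookup a k =
      Poly_Mapping.lookup (\<Sum>l\<in>Poly_Mapping.keys a. Poly_Mapping.lookup a l *\<^sub>R gen l) k"
    by (simp add: lookup_sum lookup_single sum.delta in_keys_iff)
qed

text \<open>Entrywise application of \<open>g\<close> on representatives. If \<open>g\<close> is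
  linear on a fibre, it descends to classes, where it is the tensor power of
  \<open>g\<close>.\<close>

definition push :: "('v \<Rightarrow> 'w) \<Rightarrow> ('v list, real) poly_mapping \<Rightarrow> ('w list, real) poly_mapping" where
  "push g = lin_ext (\<lambda>l. gen (map g l))"

lemma linear_push: "linear (push g)"
  unfolding push_def by (rule linear_lin_ext)

lemma push_gen [simp]: "push g (gen l) = gen (map g l)"
  by (simp add: push_def)

lemma linear_eq_on_gens:
  fixes L M :: "('v list, real) poly_mapping \<Rightarrow> 'b::real_vector"
  assumes "linear L" "linear M" "\<And>l. l \<in> S \<Longrightarrow> L (gen l) = M (gen l)" "a \<in> real_vector.span (gen ` S)"
  shows "L a = M a"
  by (rule real_vector.linear_eq_on_span[OF assms(1,2) _ assms(4)]) (use assms(3) in auto)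

lemma gen_span_UNIV: "(a :: ('v list, real) poly_mapping) \<in> real_vector.span (gen ` UNIV)"
  by (subst poly_mapping_eq_sum_gen) (intro real_vector.span_sum real_vector.span_scale real_vector.span_base, simp)

lemma push_push: "push g (push h a) = push (g \<circ> h) a"
  by (rule linear_eq_on_gens[of "\<lambda>a. push g (push h a)" "push (g \<circ> h)", OF _ _ _ gen_span_UNIV])
    (simp_all add: linear_compose[OF linear_push linear_push, unfolded o_def] linear_push)

lemma push_cong:
  "(\<And>l v. l \<in> S \<Longrightarrow> v \<in> set l \<Longrightarrow> g v = h v) \<Longrightarrow> a \<in> real_vector.span (gen ` S) \<Longrightarrow> push g a = push h a"
  by (rule linear_eq_on_gens[OF linear_push linear_push, of S]) (simp_all cong: map_cong)

lemma push_id: "(\<And>l v. l \<in> S \<Longrightarrow> v \<in> set l \<Longrightarrow> g v = v) \<Longrightarrow> a \<in> real_vector.span (gen ` S) \<Longrightarrow> push g a = a"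
  by (rule linear_eq_on_gens[OF linear_push linear_ident, of S]) (simp_all add: map_idI)

lemma linear_image_span_subset:
  assumes "linear L" "\<And>x. x \<in> S \<Longrightarrow> L x \<in> real_vector.span T" "a \<in> real_vector.span S"
  shows "L a \<in> real_vector.span T"
proof -
  have "L ` real_vector.span S \<subseteq> real_vector.span T"
    unfolding linear_span_image[OF assms(1), symmetric]
    by (rule real_vector.span_minimal[OF _ real_vector.subspace_span]) (use assms(2) in auto)
  then show ?thesis using assms(3) by blast
qed

lemma tuples_map: "(\<And>v. v \<in> carrier E \<Longrightarrow> g v \<in> carrier E') \<Longrightarrow> l \<in> tuples E n \<Longrightarrow> map g l \<in> tuples E' n"
  by (auto simp: tuples_def)

lemma tuples_update: "l \<in> tuples E n \<Longrightarrow> v \<in> carrier E \<Longrightarrow> l[i := v] \<in> tuples E n"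
  using set_update_subset_insert[of l i v] by (auto simp: tuples_def)

lemma push_tuples:
  assumes "\<And>v. v \<in> carrier E \<Longrightarrow> g v \<in> carrier E'" "a \<in> real_vector.span (gen ` tuples E n)"
  shows "push g a \<in> real_vector.span (gen ` tuples E' n)"
  by (rule linear_image_span_subset[OF linear_push _ assms(2)])
    (auto intro!: real_vector.span_base imageI tuples_map assms(1))

section \<open>The multilinearity relations and the classes modulo them\<close>

abbreviation "tensor_rel E n \<equiv>
  {gen (l[i := v \<oplus>\<^bsub>E\<^esub> w]) - gen (l[i := v]) - gen (l[i := w]) | l i v w.
     l \<in> tuples E n \<and> i < n \<and> v \<in> carrier E \<and> w \<in> carrier E} \<union>
  {gen (l[i := r \<odot>\<^bsub>E\<^esub> v]) - r *\<^sub>R gen (l[i := v]) | l i r v.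
     l \<in> tuples E n \<and> i < n \<and> v \<in> carrier E}"

lemma tensor_null_subspace: "real_vector.subspace (tensor_null E n)"
  unfolding tensor_null_def by (rule real_vector.subspace_span)

lemma tensor_null_add:
  "l \<in> tuples E n \<Longrightarrow> i < n \<Longrightarrow> v \<in> carrier E \<Longrightarrow> w \<in> carrier E \<Longrightarrow>
    gen (l[i := v \<oplus>\<^bsub>E\<^esub> w]) - gen (l[i := v]) - gen (l[i := w]) \<in> tensor_null E n"
  unfolding tensor_null_def by (rule real_vector.span_base) blast

lemma tensor_null_smult:
  "l \<in> tuples E n \<Longrightarrow> i < n \<Longrightarrow> v \<in> carrier E \<Longrightarrow>
    gen (l[i := r \<odot>\<^bsub>E\<^esub> v]) - r *\<^sub>R gen (l[i := v]) \<in> tensor_null E n"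
  unfolding tensor_null_def by (rule real_vector.span_base) blast

text \<open>As the null space is a span, only the two kinds of relations have to be checked. Both
  \<open>push\<close> and alternation descend to classes by this criterion.\<close>

lemma tensor_null_linear_image:
  assumes L: "linear L" and N: "real_vector.subspace N"
    and add: "\<And>l i v w. l \<in> tuples E n \<Longrightarrow> i < n \<Longrightarrow> v \<in> carrier E \<Longrightarrow> w \<in> carrier E \<Longrightarrow>
      L (gen (l[i := v \<oplus>\<^bsub>E\<^esub> w])) - L (gen (l[i := v])) - L (gen (l[i := w])) \<in> N"
    and smult: "\<And>l i r v. l \<in> tuples E n \<Longrightarrow> i < n \<Longrightarrow> v \<in> carrier E \<Longrightarrow>
      L (gen (l[i := r \<odot>\<^bsub>E\<^esub> v])) - r *\<^sub>R L (gen (l[i := v])) \<in> N"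
    and a: "a \<in> tensor_null E n"
  shows "L a \<in> N"
proof -
  have "L a \<in> real_vector.span N"
  proof (rule linear_image_span_subset[OF L _ a[unfolded tensor_null_def]])
    fix x assume "x \<in> tensor_rel E n"
    then have "L x \<in> N"
      using add smult by (auto simp: linear_diff[OF L] linear_scale[OF L])
    then show "L x \<in> real_vector.span N" by (rule real_vector.span_base)
  qed
  moreover have "real_vector.span N = N"
    using N real_vector.span_eq_iff by blast
  ultimately show ?thesis by simp
qed

lemma push_null:
  assumes g: "linear_map class_ring E E' g" and a: "a \<in> tensor_null E n"
  shows "push g a \<in> tensor_null E' n"
  by (rule tensor_null_linear_image[OF linear_push tensor_null_subspace _ _ a])
    (simp_all add: map_update linear_mapD[OF g] tensor_null_add tensor_null_smult
      tuples_map[of E g E'])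

lemma tensor_class_eq_iff: "tensor_class E n a = tensor_class E n b \<longleftrightarrow> a - b \<in> tensor_null E n"
proof
  assume "tensor_class E n a = tensor_class E n b"
  moreover have "a \<in> tensor_class E n a"
    using real_vector.subspace_0[OF tensor_null_subspace] by (simp add: tensor_class_def)
  ultimately show "a - b \<in> tensor_null E n" by (simp add: tensor_class_def)
next
  assume ab: "a - b \<in> tensor_null E n"
  have "c - a \<in> tensor_null E n \<longleftrightarrow> c - b \<in> tensor_null E n" for c
    using real_vector.subspace_add[OF tensor_null_subspace ab, of "c - a"]
      real_vector.subspace_diff[OF tensor_null_subspace _ ab, of "c - b"] by auto
  then show "tensor_class E n a = tensor_class E n b" by (simp add: tensor_class_def)
qed

lemma tensor_class_self: "a \<in> tensor_class E n a"
  using real_vector.subspace_0[OF tensor_null_subspace] by (simp add: tensor_class_def)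

lemma tensor_class_0: "tensor_class E n 0 = tensor_null E n"
  by (simp add: tensor_class_def)

text \<open>Operations on classes are encoded as unions over all representatives. When the result is
  independent of the representative, all members of the union coincide.\<close>

lemma Union_tensor_class:
  assumes "\<And>a'. a' - a \<in> tensor_null E n \<Longrightarrow> L a' - L a \<in> tensor_null E' m"
  shows "(\<Union>a'\<in>tensor_class E n a. tensor_class E' m (L a')) = tensor_class E' m (L a)"
proof -
  have "tensor_class E' m (L a') = tensor_class E' m (L a)" if "a' \<in> tensor_class E n a" for a'
    unfolding tensor_class_eq_iff using that assms by (simp add: tensor_class_def)
  then show ?thesis using tensor_class_self[of a E n] by blast
qed

subsection \<open>Alternation\<close>

text \<open>Alternation on representatives; it induces \<open>Alt\<close> on classes.\<close>

definition alt_op :: "nat \<Rightarrow> ('v list, real) poly_mapping \<Rightarrow> ('v list, real) poly_mapping" where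
  "alt_op n = lin_ext (\<lambda>l. (1 / fact n) *\<^sub>R
     (\<Sum>\<sigma> | \<sigma> permutes {..<n}. of_int (sign \<sigma>) *\<^sub>R gen (permute_list \<sigma> l)))"

lemma linear_alt_op: "linear (alt_op n)"
  unfolding alt_op_def by (rule linear_lin_ext)

lemma alt_op_gen: "alt_op n (gen l) = (1 / fact n) *\<^sub>R
     (\<Sum>\<sigma> | \<sigma> permutes {..<n}. of_int (sign \<sigma>) *\<^sub>R gen (permute_list \<sigma> l))"
  by (simp add: alt_op_def)

text \<open>Position \<open>j\<close> of the permuted list holds the entry at
  \<open>\<sigma> j\<close>, so entry \<open>i\<close> ends up at the position that \<sigma> maps to
  \<open>i\<close>.\<close>

lemma permute_list_update:
  assumes "\<sigma> permutes {..<length l}" "i < length l"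
  shows "permute_list \<sigma> (l[i := v]) = (permute_list \<sigma> l)[inv_into UNIV \<sigma> i := v]"
proof (rule nth_equalityI)
  fix j assume "j < length (permute_list \<sigma> (l[i := v]))"
  then have j: "j < length l" by simp
  then have "\<sigma> j < length l" using permutes_in_image[OF assms(1), of j] by simp
  moreover have "inv_into UNIV \<sigma> i = j \<longleftrightarrow> \<sigma> j = i"
    using permutes_inv_eq[OF assms(1)] by metis
  ultimately show "permute_list \<sigma> (l[i := v]) ! j = (permute_list \<sigma> l)[inv_into UNIV \<sigma> i := v] ! j"
    using j assms by (auto simp: permute_list_nth nth_list_update)
qed simp

lemma permute_list_tuples: "\<sigma> permutes {..<n} \<Longrightarrow> l \<in> tuples E n \<Longrightarrow> permute_list \<sigma> l \<in> tuples E n"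
  by (auto simp: tuples_def)

text \<open>Permuting the entries of a relation at position \<open>i\<close> gives a relation at the
  position to which \<open>i\<close> is moved, so alternation yields a combination of
  relations.\<close>

lemma alt_op_null:
  assumes "a \<in> tensor_null E n"
  shows "alt_op n a \<in> tensor_null E n"
proof (rule tensor_null_linear_image[OF linear_alt_op tensor_null_subspace _ _ assms])
  note sub = tensor_null_subspace[of E n]
  fix l :: "'a list" and i v and w and r :: real
  assume l: "l \<in> tuples E n" and i: "i < n" and v: "v \<in> carrier E"
  have len: "length l = n" using l by (simp add: tuples_def)
  have upd: "permute_list \<sigma> (l[i := x]) = (permute_list \<sigma> l)[inv_into UNIV \<sigma> i := x]" "inv_into UNIV \<sigma> i < n"
    "permute_list \<sigma> l \<in> tuples E n" if "\<sigma> permutes {..<n}" for \<sigma> x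
    using permute_list_update[of \<sigma> l i x] that i len permute_list_tuples[OF that l]
      permutes_in_image[OF permutes_inv[OF that], of i] by simp_all
  have "alt_op n (gen (l[i := r \<odot>\<^bsub>E\<^esub> v])) - r *\<^sub>R alt_op n (gen (l[i := v])) =
      (1 / fact n) *\<^sub>R (\<Sum>\<sigma> | \<sigma> permutes {..<n}. of_int (sign \<sigma>) *\<^sub>R
        (gen (permute_list \<sigma> (l[i := r \<odot>\<^bsub>E\<^esub> v])) - r *\<^sub>R gen (permute_list \<sigma> (l[i := v]))))"
    by (simp add: alt_op_gen scaleR_sum_right sum_subtractf scaleR_diff_right mult.commute mult.left_commute)
  also have "\<dots> \<in> tensor_null E n"
    by (intro real_vector.subspace_scale[OF sub] real_vector.subspace_sum[OF sub])
      (simp add: upd tensor_null_smult v)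
  finally show "alt_op n (gen (l[i := r \<odot>\<^bsub>E\<^esub> v])) - r *\<^sub>R alt_op n (gen (l[i := v])) \<in> tensor_null E n" .
  assume w: "w \<in> carrier E"
  have "alt_op n (gen (l[i := v \<oplus>\<^bsub>E\<^esub> w])) - alt_op n (gen (l[i := v])) - alt_op n (gen (l[i := w])) =
      (1 / fact n) *\<^sub>R (\<Sum>\<sigma> | \<sigma> permutes {..<n}. of_int (sign \<sigma>) *\<^sub>R
        (gen (permute_list \<sigma> (l[i := v \<oplus>\<^bsub>E\<^esub> w])) - gen (permute_list \<sigma> (l[i := v])) - gen (permute_list \<sigma> (l[i := w]))))"
    by (simp add: alt_op_gen sum_subtractf scaleR_diff_right)
  also have "\<dots> \<in> tensor_null E n"
    by (intro real_vector.subspace_scale[OF sub] real_vector.subspace_sum[OF sub])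
      (simp add: upd tensor_null_add v w)
  finally show "alt_op n (gen (l[i := v \<oplus>\<^bsub>E\<^esub> w])) - alt_op n (gen (l[i := v])) - alt_op n (gen (l[i := w]))
    \<in> tensor_null E n" .
qed

lemma alt_op_tuples:
  assumes "a \<in> real_vector.span (gen ` tuples E n)"
  shows "alt_op n a \<in> real_vector.span (gen ` tuples E n)"
proof (rule linear_image_span_subset[OF linear_alt_op _ assms])
  fix x assume "x \<in> gen ` tuples E n"
  then obtain l where l: "l \<in> tuples E n" "x = gen l" by blast
  have "gen (permute_list \<sigma> l) \<in> real_vector.span (gen ` tuples E n)" if "\<sigma> permutes {..<n}" for \<sigma>
    by (rule real_vector.span_base) (use permute_list_tuples[OF that l(1)] in blast)
  then show "alt_op n x \<in> real_vector.span (gen ` tuples E n)"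
    unfolding l(2) alt_op_gen by (intro real_vector.span_scale real_vector.span_sum) simp
qed

text \<open>Permuting positions commutes with changing entries. Membership in the span provides
  tuples of length \<open>n\<close>, on which the permutations of \<open>{..<n}\<close> act.\<close>

lemma alt_op_push:
  assumes "a \<in> real_vector.span (gen ` tuples E n)"
  shows "alt_op n (push g a) = push g (alt_op n a)"
proof (rule linear_eq_on_gens[OF _ _ _ assms])
  show "linear (\<lambda>a. alt_op n (push g a))" "linear (\<lambda>a. push g (alt_op n a))"
    using linear_compose[OF linear_push linear_alt_op] linear_compose[OF linear_alt_op linear_push]
    by (simp_all add: o_def)
  fix l assume "l \<in> tuples E n"
  then have "length l = n" by (simp add: tuples_def)
  then show "alt_op n (push g (gen l)) = push g (alt_op n (gen l))"
    by (simp add: alt_op_gen linear_scale[OF linear_push] linear_sum[OF linear_push] permute_list_map)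
qed

text \<open>Reindex the sum by composition with \<tau>. The sign is multiplicative and squares to
  one, so it can be moved to the other side.\<close>

lemma alt_op_permute:
  assumes \<tau>: "\<tau> permutes {..<n}" and l: "length l = n"
  shows "alt_op n (gen (permute_list \<tau> l)) = of_int (sign \<tau>) *\<^sub>R alt_op n (gen l)"
proof -
  have p: "permutation \<sigma>" if "\<sigma> permutes {..<n}" for \<sigma>
    using that by (auto simp: permutation_permutes)
  have "(\<Sum>\<sigma> | \<sigma> permutes {..<n}. real_of_int (sign \<sigma>) *\<^sub>R gen (permute_list \<sigma> l)) =
      (\<Sum>\<sigma> | \<sigma> permutes {..<n}. real_of_int (sign (\<tau> \<circ> \<sigma>)) *\<^sub>R gen (permute_list (\<tau> \<circ> \<sigma>) l))"
    by (rule setum_permutations_compose_left[OF \<tau>])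
  also have "\<dots> = (\<Sum>\<sigma> | \<sigma> permutes {..<n}. real_of_int (sign \<tau>) *\<^sub>R
      real_of_int (sign \<sigma>) *\<^sub>R gen (permute_list \<sigma> (permute_list \<tau> l)))"
    by (intro sum.cong) (simp_all add: sign_compose p \<tau> permute_list_compose l)
  finally have "alt_op n (gen l) = real_of_int (sign \<tau>) *\<^sub>R alt_op n (gen (permute_list \<tau> l))"
    by (simp add: alt_op_gen scaleR_sum_right mult.commute)
  then show ?thesis
    by (simp flip: of_int_mult)
qed

text \<open>In the outer alternation each of the n! summands equals the inner one, because the two
  signs cancel; the factor \<open>1 / fact n\<close> then absorbs their number.\<close>

lemma alt_op_idem:
  assumes "a \<in> real_vector.span (gen ` tuples E n)"
  shows "alt_op n (alt_op n a) = alt_op n a"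
proof (rule linear_eq_on_gens[OF _ linear_alt_op _ assms])
  show "linear (\<lambda>a. alt_op n (alt_op n a))"
    using linear_compose[OF linear_alt_op linear_alt_op] by (simp add: o_def)
  fix l assume "l \<in> tuples E n"
  then have l: "length l = n" by (simp add: tuples_def)
  have "alt_op n (alt_op n (gen l)) = (1 / fact n) *\<^sub>R
      (\<Sum>\<sigma> | \<sigma> permutes {..<n}. real_of_int (sign \<sigma>) *\<^sub>R alt_op n (gen (permute_list \<sigma> l)))"
    by (simp only: alt_op_gen[of n l] linear_scale[OF linear_alt_op] linear_sum[OF linear_alt_op])
  also have "\<dots> = (1 / fact n) *\<^sub>R (\<Sum>\<sigma> | \<sigma> permutes {..<n}. alt_op n (gen l))"
    by (intro arg_cong[of _ _ "(*\<^sub>R) _"] sum.cong refl) (simp add: alt_op_permute l flip: of_int_mult)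
  also have "\<dots> = alt_op n (gen l)"
    by (simp add: sum_constant_scaleR card_permutations)
  finally show "alt_op n (alt_op n (gen l)) = alt_op n (gen l)" .
qed

text \<open>Transposing two equal entries fixes the tuple but changes the sign of its alternation,
  so the alternation is its own negative.\<close>

lemma alt_op_repeated:
  assumes "length l = n" "i < n" "j < n" "i \<noteq> j" "l ! i = l ! j"
  shows "alt_op n (gen l) = 0"
proof -
  have \<tau>: "Transposition.transpose i j permutes {..<n}"
    using assms by (intro permutes_swap_id) auto
  have "permute_list (Transposition.transpose i j) l = l"
    using assms \<tau> by (intro nth_equalityI) (auto simp: permute_list_nth Transposition.transpose_def)
  with alt_op_permute[OF \<tau> assms(1)] assms(4) have "alt_op n (gen l) = - alt_op n (gen l)"
    by (simp add: sign_swap_id)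
  then have "alt_op n (gen l) + alt_op n (gen l) = 0" by (metis add.right_inverse)
  then have "2 *\<^sub>R alt_op n (gen l) = 0" by (simp only: scaleR_2)
  then show ?thesis by (simp only: real_vector.scale_eq_0_iff) simp
qed

text \<open>Multilinearity allows to replace the entries of a tuple by elements of a spanning set one
  position at a time; with fewer elements than positions some element is repeated.\<close>

lemma alt_op_vanishes:
  assumes E: "vectorspace class_ring E" and B: "finite B" "B \<subseteq> carrier E" "module.span class_ring E B = carrier E"
    and card: "card B < n" and a: "a \<in> real_vector.span (gen ` tuples E n)"
  shows "alt_op n a \<in> tensor_null E n"
proof -
  note sub = tensor_null_subspace[of E n] and Ev = vectorspaceD[OF E]
  note add = tensor_null_add[of _ E n] and smult = tensor_null_smult[of _ E n]
  \<comment> \<open>The entries from position \<open>i\<close> on already lie in \<open>B\<close>,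
    and \<open>i\<close> counts the unrestricted ones. At \<open>i = 0\<close> all entries are in
    \<open>B\<close>, which is too small for them to be distinct.\<close>
  have gens: "alt_op n (gen l) \<in> tensor_null E n"
    if "l \<in> tuples E n" "i \<le> n" "\<forall>j<n. i \<le> j \<longrightarrow> l ! j \<in> B" for i l
    using that
  proof (induction i arbitrary: l)
    case 0
    then have l: "length l = n" by (simp add: tuples_def)
    have "set l \<subseteq> B" using 0 l by (auto simp: in_set_conv_nth)
    then have "card (set l) < n" using card B(1) card_mono le_less_trans by blast
    then have "\<not> distinct l" using l distinct_card by force
    then obtain i j where "i < n" "j < n" "i \<noteq> j" "l ! i = l ! j"
      using l by (auto simp: distinct_conv_nth)
    then show ?case
      using alt_op_repeated[OF l] real_vector.subspace_0[OF sub] by simp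
  next
    case (Suc i)
    then have l: "l \<in> tuples E n" and i: "i < n" and len: "length l = n" by (simp_all add: tuples_def)
    \<comment> \<open>The vectors that may stand at position \<open>i\<close>. By multilinearity
      they form a subspace, and by the induction hypothesis it contains the spanning set
      \<open>B\<close>.\<close>
    let ?S = "{v \<in> carrier E. alt_op n (gen (l[i := v])) \<in> tensor_null E n}"
    have alt_add: "alt_op n (gen (l[i := v \<oplus>\<^bsub>E\<^esub> w])) - alt_op n (gen (l[i := v])) - alt_op n (gen (l[i := w])) \<in> tensor_null E n"
      if "v \<in> carrier E" "w \<in> carrier E" for v w
      using alt_op_null[OF add[OF l i that]] by (simp add: linear_diff[OF linear_alt_op])
    have alt_smult: "alt_op n (gen (l[i := r \<odot>\<^bsub>E\<^esub> v])) - r *\<^sub>R alt_op n (gen (l[i := v])) \<in> tensor_null E n"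
      if "v \<in> carrier E" for r v
      using alt_op_null[OF smult[OF l i that]] by (simp add: linear_diff[OF linear_alt_op] linear_scale[OF linear_alt_op])
    have "submodule class_ring ?S E"
    proof (rule submodule.intro)
      show "Module.module class_ring E" using E by (simp add: vectorspace_def)
      show "\<zero>\<^bsub>E\<^esub> \<in> ?S"
        using alt_smult[OF Ev(1), of 0] Ev(1) Ev(7)[OF Ev(1)] by simp
      fix v assume v: "v \<in> ?S"
      show "r \<odot>\<^bsub>E\<^esub> v \<in> ?S" for r
        using v Ev(3)
          real_vector.subspace_add[OF sub alt_smult[of v r] real_vector.subspace_scale[OF sub, of "alt_op n (gen (l[i := v]))" r]]
        by simp
      fix w assume w: "w \<in> ?S"
      show "v \<oplus>\<^bsub>E\<^esub> w \<in> ?S"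
        using v w Ev(2) real_vector.subspace_add[OF sub real_vector.subspace_add[OF sub alt_add[of v w]]] by force
    qed auto
    moreover have "B \<subseteq> ?S"
    proof
      fix b assume b: "b \<in> B"
      have "alt_op n (gen (l[i := b])) \<in> tensor_null E n"
        by (rule Suc.IH) (use b B(2) l i len Suc.prems(3) in \<open>auto simp: tuples_update nth_list_update\<close>)
      then show "b \<in> ?S" using b B(2) by blast
    qed
    ultimately have "carrier E \<subseteq> ?S"
      using module.span_is_subset[of class_ring E B ?S] B(3) E by (simp add: vectorspace_def)
    moreover have "l ! i \<in> carrier E" using l i by (auto simp: tuples_def)
    ultimately have "alt_op n (gen (l[i := l ! i])) \<in> tensor_null E n" by blast
    then show ?case by simp
  qed
  \<comment> \<open>\<open>gens\<close> enters at \<open>i = n\<close>, where no entry is required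
    to lie in \<open>B\<close>.\<close>
  have "alt_op n a \<in> real_vector.span (tensor_null E n)"
    by (rule linear_image_span_subset[OF linear_alt_op _ a])
      (auto intro!: real_vector.span_base gens[of _ n])
  moreover have "real_vector.span (tensor_null E n) = tensor_null E n"
    using sub real_vector.span_eq_iff by blast
  ultimately show ?thesis by simp
qed

section \<open>Tensor powers of pseudo-bundles\<close>

abbreviation tspan :: "('v, 'x) vbundle \<Rightarrow> nat \<Rightarrow> 'x \<Rightarrow> ('v list, real) poly_mapping set" where
  "tspan V n x \<equiv> real_vector.span (gen ` tuples (fibre V x) n)"

definition tcls :: "('v, 'x) vbundle \<Rightarrow> nat \<Rightarrow> 'x \<Rightarrow> ('v list, real) poly_mapping \<Rightarrow> ('v, 'x) tensor" where
  "tcls V n x a = (x, tensor_class (fibre V x) n a)"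

lemma fst_tcls [simp]: "fst (tcls V n x a) = x"
  by (simp add: tcls_def)

lemma tcls_eq_iff: "tcls V n x a = tcls V n y b \<longleftrightarrow> x = y \<and> a - b \<in> tensor_null (fibre V x) n"
  by (cases "x = y") (simp_all add: tcls_def tensor_class_eq_iff)

definition tensor_pts :: "('v, 'x) vbundle \<Rightarrow> nat \<Rightarrow> ('v, 'x) tensor set" where
  "tensor_pts V n = {tcls V n x a | x a. x \<in> pts (base V) \<and> a \<in> tspan V n x}"

lemma tensor_pts_alt: "{(x, A). x \<in> pts (base V) \<and> A \<in> tensor_space (fibre V x) n} = tensor_pts V n"
  by (auto simp: tensor_pts_def tcls_def tensor_space_def)

lemma tensor_bundle_with_simps [simp]:
  "tot (tensor_bundle_with D V n) = D" "base (tensor_bundle_with D V n) = base V"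
  "bproj (tensor_bundle_with D V n) = fst"
  by (simp_all add: tensor_bundle_with_def)

lemma tensor_vadd: "vadd (tensor_bundle_with D V n) (tcls V n x a) (tcls V n x b) = tcls V n x (a + b)"
proof -
  note sub = tensor_null_subspace[of "fibre V x" n]
  have "(\<Union>a'\<in>tensor_class (fibre V x) n a. \<Union>b'\<in>tensor_class (fibre V x) n b. tensor_class (fibre V x) n (a' + b')) =
      (\<Union>a'\<in>tensor_class (fibre V x) n a. tensor_class (fibre V x) n (a' + b))"
    by (intro SUP_cong Union_tensor_class refl) simp
  also have "\<dots> = tensor_class (fibre V x) n (a + b)"
    by (intro Union_tensor_class) simp
  finally show ?thesis by (simp add: tensor_bundle_with_def tcls_def)
qed

lemma tensor_vsmul: "vsmul (tensor_bundle_with D V n) r (tcls V n x a) = tcls V n x (r *\<^sub>R a)"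
proof -
  have "(\<Union>a'\<in>tensor_class (fibre V x) n a. tensor_class (fibre V x) n (r *\<^sub>R a')) = tensor_class (fibre V x) n (r *\<^sub>R a)"
    by (intro Union_tensor_class)
      (simp add: real_vector.subspace_scale[OF tensor_null_subspace] flip: scaleR_diff_right)
  then show ?thesis by (simp add: tensor_bundle_with_def tcls_def)
qed

lemma tensor_vzero: "vzero (tensor_bundle_with D V n) x = tcls V n x 0"
  by (simp add: tensor_bundle_with_def tcls_def tensor_class_0)

lemma vert_tensor:
  assumes "pts D = tensor_pts V n" "x \<in> pts (base V)"
  shows "vert (tensor_bundle_with D V n) x = tcls V n x ` tspan V n x"
  using assms by (auto simp: vert_def tensor_pts_def)

text \<open>The fibre is the image of the span of the tuples, a vector space of formal combinations,
  under the class map.\<close>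

lemma vectorspace_fibre_tensor:
  fixes V :: "('v, 'x) vbundle"
  assumes D: "pts D = tensor_pts V n" and x: "x \<in> pts (base V)"
  shows "vectorspace class_ring (fibre (tensor_bundle_with D V n) x)"
proof -
  let ?M = "\<lparr>carrier = tspan V n x, mult = undefined, one = undefined, zero = 0, add = (+), smult = (*\<^sub>R)\<rparr>
    :: (real, ('v list, real) poly_mapping) module"
  have "vectorspace class_ring ?M"
    by (rule real_vectorspaceI)
      (simp_all add: real_vector.span_zero real_vector.span_add real_vector.span_scale algebra_simps)
  then show ?thesis
    by (rule vectorspace_image(1)[where T = "tcls V n x"])
      (simp_all add: vert_tensor[OF D x] tensor_vadd tensor_vsmul tensor_vzero)
qed

text \<open>Sums of products of a smooth function and an \<open>n\<close>-tuple of plots over the same curve \<open>x\<close> in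
  the base: locally, these represent the plots of the tensor power.\<close>

inductive tplot :: "('v, 'x) vbundle \<Rightarrow> nat \<Rightarrow> nat \<Rightarrow> (nat \<Rightarrow> real) set \<Rightarrow> ((nat \<Rightarrow> real) \<Rightarrow> 'x) \<Rightarrow>
    ((nat \<Rightarrow> real) \<Rightarrow> ('v list, real) poly_mapping) \<Rightarrow> bool"
  for V n m W x where
  zero: "tplot V n m W x (\<lambda>w. 0)"
| step: "tplot V n m W x a \<Longrightarrow> smooth_fun m W r \<Longrightarrow> (\<And>w. w \<in> W \<Longrightarrow> length (q w) = n) \<Longrightarrow>
    (\<And>i. i < n \<Longrightarrow> plots (tot V) m W (\<lambda>w. q w ! i)) \<Longrightarrow>
    (\<And>w i. w \<in> W \<Longrightarrow> i < n \<Longrightarrow> bproj V (q w ! i) = x w) \<Longrightarrow>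
    tplot V n m W x (\<lambda>w. a w + r w *\<^sub>R gen (q w))"

lemma tuplesI: "length l = n \<Longrightarrow> (\<And>i. i < n \<Longrightarrow> l ! i \<in> carrier E) \<Longrightarrow> l \<in> tuples E n"
  by (auto simp: tuples_def in_set_conv_nth)

lemma tplot_span:
  assumes V: "diffeological (tot V)" and a: "tplot V n m W x a" and w: "w \<in> W"
  shows "a w \<in> tspan V n (x w)"
  using a
proof induction
  case (step a r q)
  have "q w \<in> tuples (fibre V (x w)) n"
  proof (rule tuplesI)
    show "q w ! i \<in> carrier (fibre V (x w))" if "i < n" for i
      using plots_in[OF V step.hyps(4)[OF that] w] step.hyps(5)[OF w that] by (simp add: vert_def)
  qed (rule step.hyps(3)[OF w])
  then have "gen (q w) \<in> tspan V n (x w)"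
    by (intro real_vector.span_base imageI)
  then show ?case
    by (intro real_vector.span_add step.IH real_vector.span_scale)
qed (simp add: real_vector.span_zero)

lemma tplot_compose:
  assumes V: "diffeological (tot V)" and W: "openin (Euclidean_space m) W"
    and g: "openin (Euclidean_space l) S" "smooth_param l S m g" "g ` S \<subseteq> W"
    and a: "tplot V n m W x a"
  shows "tplot V n l S (\<lambda>s. x (g s)) (\<lambda>s. a (g s))"
  using a
proof induction
  case (step a r q)
  show ?case
  proof (rule tplot.step[OF step.IH])
    show "smooth_fun l S (\<lambda>s. r (g s))"
      by (rule smooth_fun_compose[OF W g(1,3,2) step.hyps(2)])
    show "plots (tot V) l S (\<lambda>s. q (g s) ! i)" if "i < n" for i
      by (rule plots_compose[OF V step.hyps(4)[OF that] g])
  qed (use step.hyps(3,5) g(3) in auto)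
qed (rule tplot.zero)

lemma tplot_subset:
  assumes "diffeological (tot V)" "openin (Euclidean_space m) W"
    and "openin (Euclidean_space m) S" "S \<subseteq> W" "tplot V n m W x a"
  shows "tplot V n m S x a"
  using tplot_compose[OF assms(1,2,3) smooth_param_id[OF assms(3)] _ assms(5)] assms(4) by simp

lemma tplot_cong_base:
  assumes "tplot V n m W x a" "\<And>w. w \<in> W \<Longrightarrow> x w = y w"
  shows "tplot V n m W y a"
  using assms(1)
proof induction
  case (step a r q)
  show ?case
    by (rule tplot.step[OF step.IH step.hyps(2,3,4)]) (use step.hyps(5) assms(2) in simp_all)
qed (rule tplot.zero)

lemma tplot_add:
  assumes "tplot V n m W x a" "tplot V n m W x b"
  shows "tplot V n m W x (\<lambda>w. a w + b w)"
  using assms(2)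
proof induction
  case (step b r q)
  from tplot.step[OF step.IH step.hyps(2-5)] show ?case by (simp add: add.assoc)
qed (simp add: assms(1))

lemma tplot_scale:
  assumes "smooth_fun m W s" "tplot V n m W x a"
  shows "tplot V n m W x (\<lambda>w. s w *\<^sub>R a w)"
  using assms(2)
proof induction
  case (step a r q)
  from tplot.step[OF step.IH smooth_fun_mult[OF assms(1) step.hyps(2)] step.hyps(3-5)]
  show ?case by (simp add: scaleR_add_right)
qed (simp add: tplot.zero)

lemma tplot_sum:
  "finite I \<Longrightarrow> (\<And>i. i \<in> I \<Longrightarrow> tplot V n m W x (a i)) \<Longrightarrow> tplot V n m W x (\<lambda>w. \<Sum>i\<in>I. a i w)"
  by (induction I rule: finite_induct) (auto intro: tplot.zero tplot_add)

lemma tplot_gen: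
  assumes "\<And>w. w \<in> W \<Longrightarrow> length (q w) = n" "\<And>i. i < n \<Longrightarrow> plots (tot V) m W (\<lambda>w. q w ! i)"
    and "\<And>w i. w \<in> W \<Longrightarrow> i < n \<Longrightarrow> bproj V (q w ! i) = x w"
  shows "tplot V n m W x (\<lambda>w. gen (q w))"
  using tplot.step[OF tplot.zero smooth_fun_const[of m W 1], of q n V x] assms by simp

text \<open>Induction over the span: constant families are closed under linear combinations and
  contain the tuples of constant plots.\<close>

lemma tplot_const:
  assumes V: "diffeological (tot V)" and W: "openin (Euclidean_space m) W" and a: "a \<in> tspan V n x"
  shows "tplot V n m W (\<lambda>_. x) (\<lambda>_. a)"
proof -
  show ?thesis
  proof (rule real_vector.span_induct[OF a, of "\<lambda>a. tplot V n m W (\<lambda>_. x) (\<lambda>_. a)"])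
    show "real_vector.subspace {a. tplot V n m W (\<lambda>_. x) (\<lambda>_. a)}"
      by (rule real_vector.subspaceI)
        (auto intro: tplot.zero tplot_add tplot_scale[OF smooth_fun_const])
    fix b assume "b \<in> gen ` tuples (fibre V x) n"
    then obtain l where l: "l \<in> tuples (fibre V x) n" "b = gen l" by blast
    then have "l ! i \<in> vert V x" "length l = n" if "i < n" for i
      using that by (auto simp: tuples_def)
    then have "tplot V n m W (\<lambda>_. x) (\<lambda>_. gen l)"
      using l(1) by (intro tplot_gen plots_const[OF V _ W]) (auto simp: vert_def tuples_def)
    then show "tplot V n m W (\<lambda>_. x) (\<lambda>_. b)" by (simp add: l(2))
  qed
qed

text \<open>An explicit candidate for the finest admissible diffeology. The projection to the base
  is required to be a plot separately, because the empty sum, and for \<open>n = 0\<close> every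
  sum, puts no condition on the base curve in \<open>tplot\<close>.\<close>

definition tensor_diff :: "('v, 'x) vbundle \<Rightarrow> nat \<Rightarrow> ('v, 'x) tensor dspace" where
  "tensor_diff V n = \<lparr>pts = tensor_pts V n,
     plots = (\<lambda>m U p. openin (Euclidean_space m) U \<and> plots (base V) m U (\<lambda>u. fst (p u)) \<and>
       (\<forall>u\<in>U. \<exists>W a. openin (Euclidean_space m) W \<and> u \<in> W \<and> W \<subseteq> U \<and>
          tplot V n m W (\<lambda>w. fst (p w)) a \<and> (\<forall>w\<in>W. p w = tcls V n (fst (p w)) (a w))))\<rparr>"

lemma pts_tensor_diff [simp]: "pts (tensor_diff V n) = tensor_pts V n"
  by (simp add: tensor_diff_def)

lemma plots_tensor_diffD:
  assumes "plots (tensor_diff V n) m U p"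
  shows "openin (Euclidean_space m) U" "plots (base V) m U (\<lambda>u. fst (p u))"
  using assms by (simp_all add: tensor_diff_def)

lemma plots_tensor_diffE:
  assumes "plots (tensor_diff V n) m U p" "u \<in> U"
  obtains W a where "openin (Euclidean_space m) W" "u \<in> W" "W \<subseteq> U"
    "tplot V n m W (\<lambda>w. fst (p w)) a" "\<And>w. w \<in> W \<Longrightarrow> p w = tcls V n (fst (p w)) (a w)"
proof -
  have "\<exists>W a. openin (Euclidean_space m) W \<and> u \<in> W \<and> W \<subseteq> U \<and>
      tplot V n m W (\<lambda>w. fst (p w)) a \<and> (\<forall>w\<in>W. p w = tcls V n (fst (p w)) (a w))"
    using assms by (simp add: tensor_diff_def)
  then show thesis
    by (elim exE conjE) (rule that, assumption+, blast)
qed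

lemma plots_tensor_diffI:
  assumes "openin (Euclidean_space m) U" "plots (base V) m U (\<lambda>u. fst (p u))"
    and "\<And>u. u \<in> U \<Longrightarrow> \<exists>W x a. openin (Euclidean_space m) W \<and> u \<in> W \<and> W \<subseteq> U \<and>
          tplot V n m W x a \<and> (\<forall>w\<in>W. p w = tcls V n (x w) (a w))"
  shows "plots (tensor_diff V n) m U p"
proof -
  have "\<exists>W a. openin (Euclidean_space m) W \<and> u \<in> W \<and> W \<subseteq> U \<and>
      tplot V n m W (\<lambda>w. fst (p w)) a \<and> (\<forall>w\<in>W. p w = tcls V n (fst (p w)) (a w))" if u: "u \<in> U" for u
  proof -
    from assms(3)[OF u] obtain W x a where W: "openin (Euclidean_space m) W" "u \<in> W" "W \<subseteq> U"
      and a: "tplot V n m W x a" "\<forall>w\<in>W. p w = tcls V n (x w) (a w)"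
      by (elim exE conjE)
    have "tplot V n m W (\<lambda>w. fst (p w)) a"
      by (rule tplot_cong_base[OF a(1)]) (use a(2) in simp)
    then show ?thesis using W a(2) by (intro exI[of _ W] exI[of _ a]) simp
  qed
  with assms(1,2) show ?thesis by (simp add: tensor_diff_def)
qed

lemma tensor_diff_diffeological:
  assumes V: "pseudo_bundle V"
  shows "diffeological (tensor_diff V n)"
proof (rule diffeologicalI)
  note T = pseudo_bundle_tot[OF V] and B = pseudo_bundle_base[OF V]
  {
    fix m U p assume p: "plots (tensor_diff V n) m U p"
    note pd = plots_tensor_diffD[OF p]
    show "openin (Euclidean_space m) U" by (rule pd(1))
    show "p u \<in> pts (tensor_diff V n)" if u: "u \<in> U" for u
    proof (rule plots_tensor_diffE[OF p u])
      fix W a assume W: "u \<in> W" "tplot V n m W (\<lambda>w. fst (p w)) a" "\<And>w. w \<in> W \<Longrightarrow> p w = tcls V n (fst (p w)) (a w)"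
      have "fst (p u) \<in> pts (base V)" by (rule plots_in[OF B pd(2) u])
      with tplot_span[OF T W(2,1)] have "tcls V n (fst (p u)) (a u) \<in> tensor_pts V n"
        unfolding tensor_pts_def by blast
      then show ?thesis using W(3)[OF W(1)] by simp
    qed
    show "plots (tensor_diff V n) m U q" if q: "\<And>u. u \<in> U \<Longrightarrow> q u = p u" for q
    proof (rule plots_tensor_diffI[OF pd(1)])
      show "plots (base V) m U (\<lambda>u. fst (q u))"
        by (rule plots_cong[OF B pd(2)]) (simp add: q)
      fix u assume "u \<in> U"
      from p this show "\<exists>W x a. openin (Euclidean_space m) W \<and> u \<in> W \<and> W \<subseteq> U \<and>
          tplot V n m W x a \<and> (\<forall>w\<in>W. q w = tcls V n (x w) (a w))"
      proof (rule plots_tensor_diffE)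
        fix W a assume W: "openin (Euclidean_space m) W" "u \<in> W" "W \<subseteq> U" "tplot V n m W (\<lambda>w. fst (p w)) a"
          and e: "\<And>w. w \<in> W \<Longrightarrow> p w = tcls V n (fst (p w)) (a w)"
        have "q w = tcls V n (fst (p w)) (a w)" if "w \<in> W" for w
          using q[of w] e[OF that] W(3) that by auto
        with W show ?thesis by (intro exI[of _ W] exI[of _ "\<lambda>w. fst (p w)"] exI[of _ a] conjI ballI)
      qed
    qed
    fix l S g assume S: "openin (Euclidean_space l) S" "smooth_param l S m g" "g ` S \<subseteq> U"
    show "plots (tensor_diff V n) l S (\<lambda>w. p (g w))"
    proof (rule plots_tensor_diffI[OF S(1)])
      show "plots (base V) l S (\<lambda>u. fst (p (g u)))"
        by (rule plots_compose[OF B pd(2) S])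
      fix s assume s: "s \<in> S"
      then have "g s \<in> U" using S(3) by blast
      with p show "\<exists>W x a. openin (Euclidean_space l) W \<and> s \<in> W \<and> W \<subseteq> S \<and>
          tplot V n l W x a \<and> (\<forall>w\<in>W. p (g w) = tcls V n (x w) (a w))"
      proof (rule plots_tensor_diffE)
        fix W a assume W: "openin (Euclidean_space m) W" "g s \<in> W" "W \<subseteq> U" "tplot V n m W (\<lambda>w. fst (p w)) a"
          and e: "\<And>w. w \<in> W \<Longrightarrow> p w = tcls V n (fst (p w)) (a w)"
        let ?S = "{t \<in> S. g t \<in> W}"
        have S': "openin (Euclidean_space l) ?S" by (rule smooth_param_vimage[OF S(1,2) W(1)])
        have "tplot V n l ?S (\<lambda>s. fst (p (g s))) (\<lambda>s. a (g s))"
          by (rule tplot_compose[OF T W(1) S' smooth_param_subset[OF S(2)] _ W(4)]) auto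
        moreover have "\<forall>w\<in>?S. p (g w) = tcls V n (fst (p (g w))) (a (g w))" using e by blast
        ultimately show ?thesis using S' s W(2)
          by (intro exI[of _ ?S] exI[of _ "\<lambda>w. fst (p (g w))"] exI[of _ "\<lambda>s. a (g s)"] conjI) auto
      qed
    qed
  next
    fix m U t assume "t \<in> pts (tensor_diff V n)" and U: "openin (Euclidean_space m) U"
    then obtain x a where x: "x \<in> pts (base V)" "a \<in> tspan V n x" "t = tcls V n x a"
      by (auto simp: tensor_pts_def)
    show "plots (tensor_diff V n) m U (\<lambda>_. t)"
    proof (rule plots_tensor_diffI[OF U])
      show "plots (base V) m U (\<lambda>u. fst t)" using plots_const[OF B x(1) U] x(3) by simp
      show "\<exists>W y b. openin (Euclidean_space m) W \<and> u \<in> W \<and> W \<subseteq> U \<and>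
          tplot V n m W y b \<and> (\<forall>w\<in>W. t = tcls V n (y w) (b w))" if "u \<in> U" for u
        using tplot_const[OF T U x(2)] U that x(3)
        by (intro exI[of _ U] exI[of _ "\<lambda>_. x"] exI[of _ "\<lambda>_. a"]) simp
    qed
  next
    fix m U p assume U: "openin (Euclidean_space m) U"
      and loc: "\<And>u. u \<in> U \<Longrightarrow> \<exists>W. openin (Euclidean_space m) W \<and> u \<in> W \<and> W \<subseteq> U \<and> plots (tensor_diff V n) m W p"
    show "plots (tensor_diff V n) m U p"
    proof (rule plots_tensor_diffI[OF U])
      show "plots (base V) m U (\<lambda>u. fst (p u))"
      proof (rule plots_local[OF B U])
        fix u assume "u \<in> U"
        from loc[OF this] obtain W where "openin (Euclidean_space m) W" "u \<in> W" "W \<subseteq> U" "plots (tensor_diff V n) m W p"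
          by (elim exE conjE)
        then show "\<exists>W. openin (Euclidean_space m) W \<and> u \<in> W \<and> W \<subseteq> U \<and> plots (base V) m W (\<lambda>u. fst (p u))"
          using plots_tensor_diffD(2)[of V n m W p] by (intro exI[of _ W]) simp
      qed
      fix u assume "u \<in> U"
      from loc[OF this] obtain W where W: "openin (Euclidean_space m) W" "u \<in> W" "W \<subseteq> U" "plots (tensor_diff V n) m W p"
        by (elim exE conjE)
      from W(4,2) show "\<exists>W x a. openin (Euclidean_space m) W \<and> u \<in> W \<and> W \<subseteq> U \<and>
          tplot V n m W x a \<and> (\<forall>w\<in>W. p w = tcls V n (x w) (a w))"
      proof (rule plots_tensor_diffE)
        fix W' a assume W': "openin (Euclidean_space m) W'" "u \<in> W'" "W' \<subseteq> W" "tplot V n m W' (\<lambda>w. fst (p w)) a"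
          and e: "\<And>w. w \<in> W' \<Longrightarrow> p w = tcls V n (fst (p w)) (a w)"
        then show ?thesis using W(3)
          by (intro exI[of _ W'] exI[of _ "\<lambda>w. fst (p w)"] exI[of _ a] conjI ballI) auto
      qed
    qed
  }
qed

text \<open>The operations act on the representing sums: a smooth multiple changes the coefficients,
  and two plots over one curve are added by concatenating their sums on a common
  neighbourhood.\<close>

lemma tensor_diff_pseudo_bundle:
  assumes V: "pseudo_bundle V"
  shows "pseudo_bundle (tensor_bundle_with (tensor_diff V n) V n)" (is "pseudo_bundle ?T")
proof (rule pseudo_bundleI)
  note T = pseudo_bundle_tot[OF V] and B = pseudo_bundle_base[OF V]
  show "vectorspace class_ring (fibre ?T x)" if "x \<in> pts (base ?T)" for x
    using vectorspace_fibre_tensor[of "tensor_diff V n" V n x] that by simp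
  show "plots (tot ?T) m U (\<lambda>u. vzero ?T (x u))" if "plots (base ?T) m U x" for m U x
    unfolding tensor_bundle_with_simps tensor_vzero
  proof (rule plots_tensor_diffI)
    show U: "openin (Euclidean_space m) U" using plots_open[OF B] that by simp
    show "\<exists>W y a. openin (Euclidean_space m) W \<and> u \<in> W \<and> W \<subseteq> U \<and>
        tplot V n m W y a \<and> (\<forall>w\<in>W. tcls V n (x w) 0 = tcls V n (y w) (a w))" if "u \<in> U" for u
      using U that by (intro exI[of _ U] exI[of _ x] exI[of _ "\<lambda>_. 0"]) (simp add: tplot.zero)
  qed (use that in simp)
  fix m U p assume "plots (tot ?T) m U p"
  then have p: "plots (tensor_diff V n) m U p" by simp
  note pd = plots_tensor_diffD[OF p]
  show "plots (base ?T) m U (\<lambda>u. bproj ?T (p u))" using pd(2) by simp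
  show "plots (tot ?T) m U (\<lambda>u. vsmul ?T (r u) (p u))" if r: "smooth_fun m U r" for r
    unfolding tensor_bundle_with_simps
  proof (rule plots_tensor_diffI[OF pd(1)])
    have pin: "p u \<in> tensor_pts V n" if "u \<in> U" for u
      using plots_in[OF tensor_diff_diffeological[OF V] p that] by simp
    have "fst (vsmul ?T (r u) (p u)) = fst (p u)" if "u \<in> U" for u
      using pin[OF that] by (auto simp: tensor_pts_def tensor_vsmul)
    then show "plots (base V) m U (\<lambda>u. fst (vsmul ?T (r u) (p u)))"
      by (rule plots_cong[OF B pd(2)])
    fix u assume "u \<in> U"
    with p show "\<exists>W x a. openin (Euclidean_space m) W \<and> u \<in> W \<and> W \<subseteq> U \<and>
        tplot V n m W x a \<and> (\<forall>w\<in>W. vsmul ?T (r w) (p w) = tcls V n (x w) (a w))"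
    proof (rule plots_tensor_diffE)
      fix W a assume W: "openin (Euclidean_space m) W" "u \<in> W" "W \<subseteq> U" "tplot V n m W (\<lambda>w. fst (p w)) a"
        and e: "\<And>w. w \<in> W \<Longrightarrow> p w = tcls V n (fst (p w)) (a w)"
      have "vsmul ?T (r w) (p w) = tcls V n (fst (p w)) (r w *\<^sub>R a w)" if "w \<in> W" for w
        using tensor_vsmul[of _ V n "r w" "fst (p w)" "a w"] e[OF that] by simp
      with W tplot_scale[OF smooth_fun_subset[OF r W(3)] W(4)] show ?thesis
        by (intro exI[of _ W] exI[of _ "\<lambda>w. fst (p w)"] exI[of _ "\<lambda>w. r w *\<^sub>R a w"] conjI ballI)
    qed
  qed
  fix q assume "plots (tot ?T) m U q" and eq': "\<And>u. u \<in> U \<Longrightarrow> bproj ?T (p u) = bproj ?T (q u)"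
  then have q: "plots (tensor_diff V n) m U q" and eq: "\<And>u. u \<in> U \<Longrightarrow> fst (p u) = fst (q u)" by simp_all
  show "plots (tot ?T) m U (\<lambda>u. vadd ?T (p u) (q u))"
    unfolding tensor_bundle_with_simps
  proof (rule plots_tensor_diffI[OF pd(1)])
    have add: "vadd ?T (p u) (q u) = tcls V n (fst (p u)) (a + b)"
      if "u \<in> U" "p u = tcls V n (fst (p u)) a" "q u = tcls V n (fst (q u)) b" for u a b
      using tensor_vadd[of _ V n "fst (p u)" a b] that(2,3) eq[OF that(1)] by simp
    have pin: "p u \<in> tensor_pts V n" "q u \<in> tensor_pts V n" if "u \<in> U" for u
      using plots_in[OF tensor_diff_diffeological[OF V] p that] plots_in[OF tensor_diff_diffeological[OF V] q that] by simp_all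
    have "fst (vadd ?T (p u) (q u)) = fst (p u)" if "u \<in> U" for u
      using pin[OF that] add[OF that] by (auto simp: tensor_pts_def)
    then show "plots (base V) m U (\<lambda>u. fst (vadd ?T (p u) (q u)))"
      by (rule plots_cong[OF B pd(2)])
    fix u assume u: "u \<in> U"
    with p show "\<exists>W x a. openin (Euclidean_space m) W \<and> u \<in> W \<and> W \<subseteq> U \<and>
        tplot V n m W x a \<and> (\<forall>w\<in>W. vadd ?T (p w) (q w) = tcls V n (x w) (a w))"
    proof (rule plots_tensor_diffE)
      fix W a assume W: "openin (Euclidean_space m) W" "u \<in> W" "W \<subseteq> U" "tplot V n m W (\<lambda>w. fst (p w)) a"
        and e: "\<And>w. w \<in> W \<Longrightarrow> p w = tcls V n (fst (p w)) (a w)"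
      from q u show ?thesis
      proof (rule plots_tensor_diffE)
        fix W' b assume W': "openin (Euclidean_space m) W'" "u \<in> W'" "W' \<subseteq> U" "tplot V n m W' (\<lambda>w. fst (q w)) b"
          and e': "\<And>w. w \<in> W' \<Longrightarrow> q w = tcls V n (fst (q w)) (b w)"
        let ?W = "W \<inter> W'"
        have o: "openin (Euclidean_space m) ?W" using W(1) W'(1) by (rule openin_Int)
        have "tplot V n m ?W (\<lambda>w. fst (q w)) b"
          by (rule tplot_subset[OF T W'(1) o _ W'(4)]) simp
        then have "tplot V n m ?W (\<lambda>w. fst (p w)) b"
          by (rule tplot_cong_base) (use eq W(3) in auto)
        then have "tplot V n m ?W (\<lambda>w. fst (p w)) (\<lambda>w. a w + b w)"
          by (rule tplot_add[OF tplot_subset[OF T W(1) o _ W(4)], rotated]) simp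
        moreover have "\<forall>w\<in>?W. vadd ?T (p w) (q w) = tcls V n (fst (p w)) (a w + b w)"
          using add[OF _ e e'] W(3) by blast
        ultimately show ?thesis using o W(2,3) W'(2)
          by (intro exI[of _ ?W] exI[of _ "\<lambda>w. fst (p w)"] exI[of _ "\<lambda>w. a w + b w"]) auto
      qed
    qed
  qed
qed (use tensor_diff_diffeological[OF V, of n] pseudo_bundle_base[OF V] in \<open>auto simp: tensor_pts_def\<close>)

lemma plots_fibre_power: "plots (fibre_power V n) m U p \<longleftrightarrow>
    openin (Euclidean_space m) U \<and>
    (\<forall>u\<in>U. fst (p u) \<in> pts (base V) \<and> snd (p u) \<in> tuples (fibre V (fst (p u))) n) \<and>
    plots (base V) m U (\<lambda>u. fst (p u)) \<and> (\<forall>i<n. plots (tot V) m U (\<lambda>u. snd (p u) ! i))"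
  by (auto simp: fibre_power_def Let_def o_def image_subset_iff split_beta)

lemma tuples_fibreD: "l \<in> tuples (fibre V x) n \<Longrightarrow> i < n \<Longrightarrow> bproj V (l ! i) = x"
  "l \<in> tuples E n \<Longrightarrow> length l = n"
  by (auto simp: tuples_def vert_def dest!: nth_mem)

lemma tensor_map_smooth:
  assumes V: "pseudo_bundle V"
  shows "dsmooth (fibre_power V n) (tensor_diff V n) (tensor_map V n)"
proof (rule dsmoothI)
  fix y assume "y \<in> pts (fibre_power V n)"
  then have "fst y \<in> pts (base V)" "snd y \<in> tuples (fibre V (fst y)) n"
    by (auto simp: fibre_power_def Let_def)
  then have "tcls V n (fst y) (gen (snd y)) \<in> tensor_pts V n"
    unfolding tensor_pts_def by (blast intro: real_vector.span_base)
  then show "tensor_map V n y \<in> pts (tensor_diff V n)"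
    by (simp add: tensor_map_def tcls_def split_beta)
next
  fix m U p assume p: "plots (fibre_power V n) m U p"
  note pp = p[unfolded plots_fibre_power]
  have eq: "tensor_map V n (p u) = tcls V n (fst (p u)) (gen (snd (p u)))" for u
    by (simp add: tensor_map_def tcls_def split_beta)
  have t: "tplot V n m U (\<lambda>u. fst (p u)) (\<lambda>u. gen (snd (p u)))"
  proof (rule tplot_gen)
    show "length (snd (p u)) = n" if "u \<in> U" for u
      using pp that tuples_fibreD(2) by blast
    show "bproj V (snd (p u) ! i) = fst (p u)" if "u \<in> U" "i < n" for u i
      using tuples_fibreD(1)[OF pp[THEN conjunct2, THEN conjunct1, rule_format, OF that(1), THEN conjunct2] that(2)] .
    show "plots (tot V) m U (\<lambda>u. snd (p u) ! i)" if "i < n" for i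
      by (rule pp[THEN conjunct2, THEN conjunct2, THEN conjunct2, rule_format, OF that])
  qed
  show "plots (tensor_diff V n) m U (\<lambda>u. tensor_map V n (p u))"
    unfolding eq
  proof (rule plots_tensor_diffI)
    show "\<exists>W x a. openin (Euclidean_space m) W \<and> u \<in> W \<and> W \<subseteq> U \<and> tplot V n m W x a \<and>
        (\<forall>w\<in>W. tcls V n (fst (p w)) (gen (snd (p w))) = tcls V n (x w) (a w))" if "u \<in> U" for u
      using t pp that by (intro exI[of _ U] exI[of _ "\<lambda>u. fst (p u)"] exI[of _ "\<lambda>u. gen (snd (p u))"]) simp
  qed (use pp in simp_all)
qed

text \<open>A sum as in \<open>tplot\<close> arises from smooth plots of tuples by the tensor map,
  scalar multiplication and addition, starting from the zero section. In \<open>D\<close> all of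
  these are smooth, and plots are local.\<close>

lemma tensor_diff_least:
  assumes V: "pseudo_bundle V" and D: "pts D = tensor_pts V n" "pseudo_bundle (tensor_bundle_with D V n)"
    "dsmooth (fibre_power V n) D (tensor_map V n)"
    and p: "plots (tensor_diff V n) m U p"
  shows "plots D m U p"
proof -
  let ?T = "tensor_bundle_with D V n"
  note B = pseudo_bundle_base[OF V] and T = pseudo_bundle_tot[OF V]
  have DD: "diffeological D" using pseudo_bundle_tot[OF D(2)] by simp
  have tp: "plots D m W (\<lambda>w. tcls V n (x w) (a w))"
    if x: "plots (base V) m W x" and "tplot V n m W x a" for W x a
    using that(2)
  proof induction
    case zero
    show ?case using pseudo_bundle_plots_vzero[OF D(2), of m W x] x by (simp add: tensor_vzero)
  next
    case (step a r q)
    have "q w \<in> tuples (fibre V (x w)) n" if "w \<in> W" for w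
    proof (rule tuplesI)
      show "q w ! i \<in> carrier (fibre V (x w))" if "i < n" for i
        using plots_in[OF T step.hyps(4)[OF that] \<open>w \<in> W\<close>] step.hyps(5)[OF \<open>w \<in> W\<close> that] by (simp add: vert_def)
    qed (rule step.hyps(3)[OF that])
    then have "plots (fibre_power V n) m W (\<lambda>w. (x w, q w))"
      using x step.hyps(4) plots_open[OF B x] plots_in[OF B x] by (simp add: plots_fibre_power)
    from dsmooth_plots[OF D(3) this] have "plots D m W (\<lambda>w. tcls V n (x w) (gen (q w)))"
      by (simp add: tensor_map_def tcls_def)
    then have "plots (tot ?T) m W (\<lambda>w. vsmul ?T (r w) (tcls V n (x w) (gen (q w))))"
      by (intro pseudo_bundle_plots_vsmul[OF D(2) step.hyps(2)]) simp
    then have "plots (tot ?T) m W (\<lambda>w. vadd ?T (tcls V n (x w) (a w)) (vsmul ?T (r w) (tcls V n (x w) (gen (q w)))))"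
      using step.IH by (intro pseudo_bundle_plots_vadd[OF D(2)]) (simp_all add: tensor_vsmul)
    then show ?case by (simp add: tensor_vsmul tensor_vadd)
  qed
  show ?thesis
  proof (rule plots_local[OF DD plots_tensor_diffD(1)[OF p]])
    fix u assume "u \<in> U"
    with p show "\<exists>W. openin (Euclidean_space m) W \<and> u \<in> W \<and> W \<subseteq> U \<and> plots D m W p"
    proof (rule plots_tensor_diffE)
      fix W a assume W: "openin (Euclidean_space m) W" "u \<in> W" "W \<subseteq> U" "tplot V n m W (\<lambda>w. fst (p w)) a"
        and e: "\<And>w. w \<in> W \<Longrightarrow> p w = tcls V n (fst (p w)) (a w)"
      have "plots D m W p"
        by (rule plots_cong[OF DD tp[OF plots_subset[OF B plots_tensor_diffD(2)[OF p] W(1,3)] W(4)] e])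
      then show ?thesis using W by blast
    qed
  qed
qed

text \<open>\<open>tensor_diff\<close> is one of the diffeologies being intersected and is contained
  in each of them, hence it is the intersection.\<close>

lemma tensor_power_eq:
  assumes V: "pseudo_bundle V"
  shows "tensor_power V n = tensor_bundle_with (tensor_diff V n) V n"
proof -
  have "(\<forall>D. pts D = tensor_pts V n \<and> pseudo_bundle (tensor_bundle_with D V n) \<and>
      dsmooth (fibre_power V n) D (tensor_map V n) \<longrightarrow> plots D m U p) \<longleftrightarrow> plots (tensor_diff V n) m U p" for m U p
    using tensor_diff_least[OF V, of _ n m U p] tensor_diff_pseudo_bundle[OF V, of n] tensor_map_smooth[OF V, of n]
      pts_tensor_diff[of V n] by blast
  then have "tensor_power V n = tensor_bundle_with \<lparr>pts = tensor_pts V n, plots = plots (tensor_diff V n)\<rparr> V n"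
    unfolding tensor_power_def Let_def tensor_pts_alt by simp
  also have "\<lparr>pts = tensor_pts V n, plots = plots (tensor_diff V n)\<rparr> = tensor_diff V n"
    by (simp add: tensor_diff_def)
  finally show ?thesis .
qed

subsection \<open>Induced maps and alternation\<close>

lemma tensor_power_simps:
  assumes "pseudo_bundle V"
  shows "pts (tot (tensor_power V n)) = tensor_pts V n"
    and "plots (tot (tensor_power V n)) = plots (tensor_diff V n)"
    and "base (tensor_power V n) = base V" and "bproj (tensor_power V n) = fst"
    and "vzero (tensor_power V n) x = tcls V n x 0"
    and "vadd (tensor_power V n) (tcls V n x a) (tcls V n x b) = tcls V n x (a + b)"
    and "vsmul (tensor_power V n) r (tcls V n x a) = tcls V n x (r *\<^sub>R a)"
  by (simp_all add: tensor_power_eq[OF assms] tensor_vzero tensor_vadd tensor_vsmul)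

lemma tensor_power_simps':
  shows "pts (tot (tensor_power V n)) = tensor_pts V n"
    and "bproj (tensor_power V n) = fst" and "base (tensor_power V n) = base V"
  unfolding tensor_power_def Let_def tensor_pts_alt by simp_all

lemma vert_tensor_power: "x \<in> pts (base V) \<Longrightarrow> vert (tensor_power V n) x = tcls V n x ` tspan V n x"
  unfolding tensor_power_def Let_def tensor_pts_alt by (rule vert_tensor) simp_all

lemma pseudo_bundle_tensor_power: "pseudo_bundle V \<Longrightarrow> pseudo_bundle (tensor_power V n)"
  by (simp add: tensor_power_eq tensor_diff_pseudo_bundle)

lemma tensor_power_map_tcls:
  assumes "linear_map class_ring (fibre V x) (fibre W (\<phi> x)) g"
  shows "tensor_power_map W n \<phi> g (tcls V n x a) = tcls W n (\<phi> x) (push g a)"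
proof -
  have "(\<Union>a'\<in>tensor_class (fibre V x) n a. tensor_class (fibre W (\<phi> x)) n (push g a')) =
      tensor_class (fibre W (\<phi> x)) n (push g a)"
    by (rule Union_tensor_class) (simp add: push_null[OF assms] flip: linear_diff[OF linear_push])
  then show ?thesis by (simp add: tensor_power_map_def tcls_def push_def)
qed

lemma Alt_tcls: "Alt V n (tcls V n x a) = tcls V n x (alt_op n a)"
proof -
  have "(\<Union>a'\<in>tensor_class (fibre V x) n a. tensor_class (fibre V x) n (alt_op n a')) =
      tensor_class (fibre V x) n (alt_op n a)"
    by (rule Union_tensor_class) (simp add: alt_op_null flip: linear_diff[OF linear_alt_op])
  then show ?thesis by (simp add: Alt_def tcls_def alt_op_def)
qed

lemma push_tspan:
  assumes "linear_map class_ring (fibre V x) (fibre W y) g" "a \<in> tspan V n x"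
  shows "push g a \<in> tspan W n y"
  by (rule push_tuples[OF linear_mapD(3)[OF assms(1)] assms(2)])

lemma tplot_push:
  assumes "tplot V n m W x a" and V': "diffeological (tot V')"
    and "\<And>p. plots (tot V) m W p \<Longrightarrow> (\<And>w. w \<in> W \<Longrightarrow> bproj V (p w) = x w) \<Longrightarrow>
      plots (tot V') m W (\<lambda>w. g (p w)) \<and> (\<forall>w\<in>W. bproj V' (g (p w)) = y w)"
  shows "tplot V' n m W y (\<lambda>w. push g (a w))"
  using assms(1)
proof induction
  case zero
  show ?case by (simp add: linear_0[OF linear_push] tplot.zero)
next
  case (step a r q)
  have q: "plots (tot V') m W (\<lambda>w. g (q w ! i)) \<and> (\<forall>w\<in>W. bproj V' (g (q w ! i)) = y w)" if "i < n" for i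
    by (rule assms(3)[OF step.hyps(4)[OF that] step.hyps(5)[OF _ that]])
  have nth: "map g (q w) ! i = g (q w ! i)" if "w \<in> W" "i < n" for w i
    using that step.hyps(3)[OF that(1)] by simp
  have "tplot V' n m W y (\<lambda>w. push g (a w) + r w *\<^sub>R gen (map g (q w)))"
  proof (rule tplot.step[OF step.IH step.hyps(2)])
    show "length (map g (q w)) = n" if "w \<in> W" for w
      using step.hyps(3)[OF that] by simp
    show "plots (tot V') m W (\<lambda>w. map g (q w) ! i)" if "i < n" for i
      by (rule plots_cong[OF V' q[OF that, THEN conjunct1]]) (rule nth[OF _ that])
    show "bproj V' (map g (q w) ! i) = y w" if "w \<in> W" "i < n" for w i
      using q[OF that(2)] that(1) by (simp add: nth[OF that])
  qed
  then show ?case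
    by (simp add: linear_add[OF linear_push] linear_scale[OF linear_push])
qed

text \<open>Smoothness of \<open>g\<close> is demanded only on plots over the base curve of
  \<open>p\<close>. This relative form is made for \<open>P1\<close>, whose smoothness is available
  only over curves that lift to the base of \<open>V1\<close>.\<close>

lemma tensor_power_map_plots:
  assumes V: "pseudo_bundle V" and W: "pseudo_bundle W"
    and p: "plots (tot (tensor_power V n)) m U p"
    and lin: "\<And>u. u \<in> U \<Longrightarrow> linear_map class_ring (fibre V (fst (p u))) (fibre W (\<phi> (fst (p u)))) g"
    and g: "\<And>S q. S \<subseteq> U \<Longrightarrow> plots (tot V) m S q \<Longrightarrow> (\<And>w. w \<in> S \<Longrightarrow> bproj V (q w) = fst (p w)) \<Longrightarrow>
      plots (tot W) m S (\<lambda>w. g (q w))"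
    and \<phi>: "plots (base W) m U (\<lambda>u. \<phi> (fst (p u)))"
  shows "plots (tot (tensor_power W n)) m U (\<lambda>u. tensor_power_map W n \<phi> g (p u))"
proof -
  note p' = p[unfolded tensor_power_simps(2)[OF V]]
  note pd = plots_tensor_diffD[OF p']
  have fst: "fst (tensor_power_map W n \<phi> g t) = \<phi> (fst t)" for t
    by (simp add: tensor_power_map_def split_beta)
  have gb: "bproj W (g v) = \<phi> (fst (p u))" if "u \<in> U" "v \<in> pts (tot V)" "bproj V v = fst (p u)" for u v
    using linear_mapD(3)[OF lin[OF that(1)], of v] that(2,3) by (simp add: vert_def)
  show ?thesis
    unfolding tensor_power_simps(2)[OF W]
  proof (rule plots_tensor_diffI[OF pd(1)])
    show "plots (base W) m U (\<lambda>u. fst (tensor_power_map W n \<phi> g (p u)))"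
      unfolding fst by (rule \<phi>)
    fix u assume "u \<in> U"
    with p' show "\<exists>W' x a. openin (Euclidean_space m) W' \<and> u \<in> W' \<and> W' \<subseteq> U \<and> tplot W n m W' x a \<and>
        (\<forall>w\<in>W'. tensor_power_map W n \<phi> g (p w) = tcls W n (x w) (a w))"
    proof (rule plots_tensor_diffE)
      fix S a assume S: "openin (Euclidean_space m) S" "u \<in> S" "S \<subseteq> U" "tplot V n m S (\<lambda>w. fst (p w)) a"
        and e: "\<And>w. w \<in> S \<Longrightarrow> p w = tcls V n (fst (p w)) (a w)"
      have "tplot W n m S (\<lambda>w. \<phi> (fst (p w))) (\<lambda>w. push g (a w))"
      proof (rule tplot_push[OF S(4) pseudo_bundle_tot[OF W]])
        fix q assume q: "plots (tot V) m S q" "\<And>w. w \<in> S \<Longrightarrow> bproj V (q w) = fst (p w)"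
        show "plots (tot W) m S (\<lambda>w. g (q w)) \<and> (\<forall>w\<in>S. bproj W (g (q w)) = \<phi> (fst (p w)))"
        proof (intro conjI ballI)
          show "plots (tot W) m S (\<lambda>w. g (q w))" by (rule g[OF S(3) q])
          show "bproj W (g (q w)) = \<phi> (fst (p w))" if "w \<in> S" for w
            by (rule gb[OF _ plots_in[OF pseudo_bundle_tot[OF V] q(1) that] q(2)[OF that]]) (use S(3) that in blast)
        qed
      qed
      moreover have "tensor_power_map W n \<phi> g (p w) = tcls W n (\<phi> (fst (p w))) (push g (a w))" if "w \<in> S" for w
        using tensor_power_map_tcls[where W = W and \<phi> = \<phi> and a = "a w" and n = n, OF lin[of w]]
          e[OF that] S(3) that by auto
      ultimately show ?thesis using S
        by (intro exI[of _ S] exI[of _ "\<lambda>w. \<phi> (fst (p w))"] exI[of _ "\<lambda>w. push g (a w)"] conjI ballI)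
    qed
  qed
qed

text \<open>Permuting a tuple of plots over one curve gives such a tuple again, and alternation is a
  constant combination of permutations. Local representatives may therefore be alternated without
  leaving the class of representatives of plots.\<close>

lemma tplot_alt_op:
  assumes "tplot V n m W x a" and V: "diffeological (tot V)"
  shows "tplot V n m W x (\<lambda>w. alt_op n (a w))"
  using assms(1)
proof induction
  case zero
  show ?case by (simp add: linear_0[OF linear_alt_op] tplot.zero)
next
  case (step a r q)
  have perm: "tplot V n m W x (\<lambda>w. gen (permute_list \<sigma> (q w)))" if \<sigma>: "\<sigma> permutes {..<n}" for \<sigma>
  proof -
    have lt: "\<sigma> i < n" if "i < n" for i
      using permutes_in_image[OF \<sigma>, of i] that by simp
    have nth: "permute_list \<sigma> (q w) ! i = q w ! \<sigma> i" if "w \<in> W" "i < n" for w i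
      by (rule permute_list_nth) (use \<sigma> that step.hyps(3)[OF that(1)] in simp_all)
    show ?thesis
    proof (rule tplot_gen)
      show "plots (tot V) m W (\<lambda>w. permute_list \<sigma> (q w) ! i)" if "i < n" for i
        by (rule plots_cong[OF V step.hyps(4)[OF lt[OF that]]]) (rule nth[OF _ that])
      show "bproj V (permute_list \<sigma> (q w) ! i) = x w" if "w \<in> W" "i < n" for w i
        using step.hyps(5)[OF that(1) lt[OF that(2)]] by (simp add: nth[OF that])
    qed (simp add: step.hyps(3))
  qed
  have "tplot V n m W x (\<lambda>w. \<Sum>\<sigma> | \<sigma> permutes {..<n}. real_of_int (sign \<sigma>) *\<^sub>R gen (permute_list \<sigma> (q w)))"
    by (rule tplot_sum) (simp_all add: finite_permutations tplot_scale[OF smooth_fun_const perm])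
  then have "tplot V n m W x (\<lambda>w. r w *\<^sub>R alt_op n (gen (q w)))"
    unfolding alt_op_gen by (intro tplot_scale[OF step.hyps(2)] tplot_scale[OF smooth_fun_const])
  from tplot_add[OF step.IH this] show ?case
    by (simp add: linear_add[OF linear_alt_op] linear_scale[OF linear_alt_op])
qed

section \<open>Exterior powers and exterior algebras\<close>

lemma ext_power_simps:
  "base (ext_power V n) = base V" "bproj (ext_power V n) = fst"
  "vadd (ext_power V n) = vadd (tensor_power V n)" "vsmul (ext_power V n) = vsmul (tensor_power V n)"
  "vzero (ext_power V n) = vzero (tensor_power V n)"
  by (simp_all add: ext_power_def sub_bundle_def tensor_power_simps')

lemma Alt_pts:
  assumes "t \<in> tensor_pts V n"
  shows "Alt V n t \<in> tensor_pts V n"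
proof -
  obtain x a where "x \<in> pts (base V)" "a \<in> tspan V n x" "t = tcls V n x a"
    using assms unfolding tensor_pts_def by blast
  then have "Alt V n t = tcls V n x (alt_op n a) \<and> x \<in> pts (base V) \<and> alt_op n a \<in> tspan V n x"
    by (simp add: Alt_tcls alt_op_tuples)
  then show ?thesis unfolding tensor_pts_def by (intro CollectI exI)
qed

lemma pts_ext_power: "pts (tot (ext_power V n)) = Alt V n ` tensor_pts V n"
  using Alt_pts[of _ V n] by (auto simp: ext_power_def sub_bundle_def tensor_power_simps')

lemma plots_ext_power: "plots (tot (ext_power V n)) m U p \<longleftrightarrow>
    plots (tot (tensor_power V n)) m U p \<and> (\<forall>u\<in>U. p u \<in> Alt V n ` tensor_pts V n)"
  by (simp add: ext_power_def sub_bundle_def tensor_power_simps' plots_dsub)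

lemma vert_ext_power:
  fixes V :: "('v, 'x) vbundle"
  assumes x: "x \<in> pts (base V)"
  shows "vert (ext_power V n) x = (\<lambda>a. tcls V n x (alt_op n a)) ` tspan V n x"
proof -
  have "fst (Alt V n t) = fst t" for t :: "('v, 'x) tensor"
    by (simp add: Alt_def split_beta)
  then have "vert (ext_power V n) x = Alt V n ` {t \<in> tensor_pts V n. fst t = x}"
    by (auto simp: vert_def pts_ext_power ext_power_simps)
  also have "{t \<in> tensor_pts V n. fst t = x} = tcls V n x ` tspan V n x"
    using vert_tensor_power[OF x, of n] by (simp add: vert_def tensor_power_simps')
  finally show ?thesis by (simp add: image_image Alt_tcls)
qed

text \<open>Since alternation is idempotent on the span, the representative can be chosen fixed on
  the nose and not merely modulo relations.\<close>

lemma vert_ext_power_alt: 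
  assumes "t \<in> vert (ext_power V n) x" "x \<in> pts (base V)"
  obtains a where "a \<in> tspan V n x" "alt_op n a = a" "t = tcls V n x a"
proof -
  obtain b where b: "b \<in> tspan V n x" "t = tcls V n x (alt_op n b)"
    using assms(1) unfolding vert_ext_power[OF assms(2)] by blast
  show thesis
    by (rule that[of "alt_op n b"]) (simp_all add: b alt_op_idem[OF b(1)] alt_op_tuples)
qed

lemma vert_ext_powerI:
  "x \<in> pts (base V) \<Longrightarrow> a \<in> tspan V n x \<Longrightarrow> alt_op n a = a \<Longrightarrow> tcls V n x a \<in> vert (ext_power V n) x"
  unfolding vert_ext_power by (rule image_eqI[of _ _ a]) simp_all

lemma vectorspace_ext_power:
  assumes V: "pseudo_bundle V" and x: "x \<in> pts (base V)"
  shows "vectorspace class_ring (fibre (ext_power V n) x)"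
proof (rule vectorspace_image(1)[where T = "Alt V n"])
  show "vectorspace class_ring (fibre (tensor_power V n) x)"
    using pseudo_bundle_fibre[OF pseudo_bundle_tensor_power[OF V]] x by (simp add: tensor_power_simps')
qed (auto simp: vert_ext_power[OF x] vert_tensor_power[OF x] ext_power_simps tensor_power_simps[OF V] Alt_tcls image_image
    linear_0[OF linear_alt_op] linear_add[OF linear_alt_op] linear_scale[OF linear_alt_op])

section \<open>The exterior algebra as the direct sum of the exterior powers\<close>

lemma contra_ext_simps:
  "base (contra_ext V) = base V" "bproj (contra_ext V) w = fst (w 0)"
  "vadd (contra_ext V) v w n = vadd (tensor_power V n) (v n) (w n)"
  "vsmul (contra_ext V) r w n = vsmul (tensor_power V n) r (w n)"
  "vzero (contra_ext V) x n = vzero (tensor_power V n) x"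
  by (simp_all add: contra_ext_def direct_sum_def Let_def ext_power_simps)

lemma pts_contra_ext: "w \<in> pts (tot (contra_ext V)) \<longleftrightarrow>
    (\<exists>x\<in>pts (base V). (\<forall>n. w n \<in> vert (ext_power V n) x) \<and> finite {n. w n \<noteq> vzero (tensor_power V n) x})"
  by (simp add: contra_ext_def direct_sum_def Let_def ext_power_simps)

lemma plots_contra_ext: "plots (tot (contra_ext V)) m U p \<longleftrightarrow>
    openin (Euclidean_space m) U \<and> (\<forall>u\<in>U. p u \<in> pts (tot (contra_ext V))) \<and>
    (\<forall>n. plots (tot (ext_power V n)) m U (\<lambda>u. p u n))"
  by (simp add: contra_ext_def direct_sum_def Let_def image_subset_iff)

text \<open>The projection reads only the component of degree 0, but all components of an element
  share their base point.\<close>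

lemma vert_contra_ext:
  assumes "x \<in> pts (base V)"
  shows "w \<in> vert (contra_ext V) x \<longleftrightarrow>
    (\<forall>n. w n \<in> vert (ext_power V n) x) \<and> finite {n. w n \<noteq> vzero (tensor_power V n) x}"
proof -
  have "fst (w 0) = y" if "w 0 \<in> vert (ext_power V 0) y" for y
    using that by (simp add: vert_def ext_power_simps)
  note * = this
  show ?thesis
  proof
    assume "w \<in> vert (contra_ext V) x"
    then have w: "w \<in> pts (tot (contra_ext V))" "fst (w 0) = x"
      by (simp_all add: vert_def contra_ext_simps)
    from w(1)[unfolded pts_contra_ext] obtain y
      where y: "\<forall>n. w n \<in> vert (ext_power V n) y" "finite {n. w n \<noteq> vzero (tensor_power V n) y}"
      by (elim bexE conjE)
    have "y = x" using *[OF y(1)[rule_format, of 0]] w(2) by simp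
    with y show "(\<forall>n. w n \<in> vert (ext_power V n) x) \<and> finite {n. w n \<noteq> vzero (tensor_power V n) x}"
      by simp
  next
    assume w: "(\<forall>n. w n \<in> vert (ext_power V n) x) \<and> finite {n. w n \<noteq> vzero (tensor_power V n) x}"
    then have "w \<in> pts (tot (contra_ext V))"
      unfolding pts_contra_ext using assms by (intro bexI[of _ x])
    moreover have "fst (w 0) = x" using * w by blast
    ultimately show "w \<in> vert (contra_ext V) x"
      by (simp add: vert_def contra_ext_simps)
  qed
qed

lemma vectorspace_contra_ext:
  fixes V :: "('v, 'x) vbundle"
  assumes V: "pseudo_bundle V" and x: "x \<in> pts (base V)"
  shows "vectorspace class_ring (fibre (contra_ext V) x)"
proof -
  note E = vectorspaceD[OF vectorspace_ext_power[OF V x], simplified, unfolded ext_power_simps]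
  let ?z = "\<lambda>n. vzero (tensor_power V n) x"
  show ?thesis
  proof (rule real_vectorspaceI, unfold fibre_simps)
    fix v w y :: "nat \<Rightarrow> ('v, 'x) tensor" and r s :: real
    assume "v \<in> vert (contra_ext V) x"
    then have v: "(\<forall>n. v n \<in> vert (ext_power V n) x) \<and> finite {n. v n \<noteq> ?z n}"
      unfolding vert_contra_ext[OF x] .
    then have v': "v n \<in> vert (ext_power V n) x" for n by blast
    have "{n. vsmul (tensor_power V n) r (v n) \<noteq> ?z n} \<subseteq> {n. v n \<noteq> ?z n}"
      by (auto simp: tensor_power_simps[OF V])
    then have "finite {n. vsmul (tensor_power V n) r (v n) \<noteq> ?z n}"
      using v finite_subset by blast
    then show "vsmul (contra_ext V) r v \<in> vert (contra_ext V) x"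
      unfolding vert_contra_ext[OF x] contra_ext_simps using E(3)[OF v'] by blast
    show "vadd (contra_ext V) v (vzero (contra_ext V) x) = v" "vsmul (contra_ext V) 0 v = vzero (contra_ext V) x"
      "vsmul (contra_ext V) (r * s) v = vsmul (contra_ext V) r (vsmul (contra_ext V) s v)"
      "vsmul (contra_ext V) 1 v = v"
      "vsmul (contra_ext V) (r + s) v = vadd (contra_ext V) (vsmul (contra_ext V) r v) (vsmul (contra_ext V) s v)"
      by (simp_all add: fun_eq_iff contra_ext_simps E(6-10) v')
    assume "w \<in> vert (contra_ext V) x"
    then have w: "(\<forall>n. w n \<in> vert (ext_power V n) x) \<and> finite {n. w n \<noteq> ?z n}"
      unfolding vert_contra_ext[OF x] .
    then have w': "w n \<in> vert (ext_power V n) x" for n by blast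
    have "{n. vadd (tensor_power V n) (v n) (w n) \<noteq> ?z n} \<subseteq> {n. v n \<noteq> ?z n} \<union> {n. w n \<noteq> ?z n}"
      by (auto simp: tensor_power_simps[OF V])
    moreover have "finite ({n. v n \<noteq> ?z n} \<union> {n. w n \<noteq> ?z n})" using v w by blast
    ultimately have "finite {n. vadd (tensor_power V n) (v n) (w n) \<noteq> ?z n}"
      using finite_subset by blast
    then show "vadd (contra_ext V) v w \<in> vert (contra_ext V) x"
      unfolding vert_contra_ext[OF x] contra_ext_simps using E(2)[OF v' w'] by blast
    show "vadd (contra_ext V) v w = vadd (contra_ext V) w v"
      by (simp add: fun_eq_iff contra_ext_simps E(4)[OF v' w'])
    show "vsmul (contra_ext V) r (vadd (contra_ext V) v w) =
        vadd (contra_ext V) (vsmul (contra_ext V) r v) (vsmul (contra_ext V) r w)"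
      by (simp add: fun_eq_iff contra_ext_simps E(11)[OF v' w'])
    assume "y \<in> vert (contra_ext V) x"
    then have y': "y n \<in> vert (ext_power V n) x" for n unfolding vert_contra_ext[OF x] by blast
    show "vadd (contra_ext V) (vadd (contra_ext V) v w) y = vadd (contra_ext V) v (vadd (contra_ext V) w y)"
      by (simp add: fun_eq_iff contra_ext_simps E(5)[OF v' w' y'])
  qed (use E(1) in \<open>simp add: vert_contra_ext[OF x] contra_ext_simps\<close>)
qed

lemma diffeological_ext_power: "pseudo_bundle V \<Longrightarrow> diffeological (tot (ext_power V n))"
  unfolding ext_power_def sub_bundle_def
  by (simp add: diffeological_dsub pseudo_bundle_tot[OF pseudo_bundle_tensor_power])

lemma diffeological_contra_ext:
  assumes V: "pseudo_bundle V"
  shows "diffeological (tot (contra_ext V))"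
proof (rule diffeologicalI)
  note X = diffeological_ext_power[OF V]
  {
    fix m U p assume p: "plots (tot (contra_ext V)) m U p"
    note pc = p[unfolded plots_contra_ext]
    show U: "openin (Euclidean_space m) U" by (rule pc[THEN conjunct1])
    show pin: "p u \<in> pts (tot (contra_ext V))" if "u \<in> U" for u
      by (rule pc[THEN conjunct2, THEN conjunct1, rule_format, OF that])
    note pn = pc[THEN conjunct2, THEN conjunct2, rule_format]
    show "plots (tot (contra_ext V)) m U q" if q: "\<And>u. u \<in> U \<Longrightarrow> q u = p u" for q
      unfolding plots_contra_ext
    proof (intro conjI ballI allI U)
      show "q u \<in> pts (tot (contra_ext V))" if "u \<in> U" for u
        using pin[OF that] q[OF that] by simp
      show "plots (tot (ext_power V n)) m U (\<lambda>u. q u n)" for n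
        by (rule plots_cong[OF X pn]) (simp add: q)
    qed
    fix l S g assume S: "openin (Euclidean_space l) S" "smooth_param l S m g" "g ` S \<subseteq> U"
    show "plots (tot (contra_ext V)) l S (\<lambda>w. p (g w))"
      unfolding plots_contra_ext
    proof (intro conjI ballI allI S(1))
      show "p (g u) \<in> pts (tot (contra_ext V))" if "u \<in> S" for u
        using pin[of "g u"] S(3) that by blast
      show "plots (tot (ext_power V n)) l S (\<lambda>u. p (g u) n)" for n
        by (rule plots_compose[OF X pn S])
    qed
  next
    fix m U w assume w: "w \<in> pts (tot (contra_ext V))" and U: "openin (Euclidean_space m) U"
    from w[unfolded pts_contra_ext] obtain x where "\<forall>n. w n \<in> vert (ext_power V n) x"
      by (elim bexE conjE)
    then have "w n \<in> pts (tot (ext_power V n))" for n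
      using vert_in_tot[of "w n" "ext_power V n" x] by simp
    then show "plots (tot (contra_ext V)) m U (\<lambda>_. w)"
      unfolding plots_contra_ext using w U plots_const[OF X] by simp
  next
    fix m U p assume U: "openin (Euclidean_space m) U"
      and loc: "\<And>u. u \<in> U \<Longrightarrow> \<exists>W. openin (Euclidean_space m) W \<and> u \<in> W \<and> W \<subseteq> U \<and> plots (tot (contra_ext V)) m W p"
    show "plots (tot (contra_ext V)) m U p"
      unfolding plots_contra_ext
    proof (intro conjI ballI allI U)
      show "p u \<in> pts (tot (contra_ext V))" if "u \<in> U" for u
      proof -
        from loc[OF that] obtain W where "u \<in> W" "plots (tot (contra_ext V)) m W p" by (elim exE conjE)
        then show ?thesis by (simp add: plots_contra_ext)
      qed
      fix n show "plots (tot (ext_power V n)) m U (\<lambda>u. p u n)"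
      proof (rule plots_local[OF X U])
        fix u assume "u \<in> U"
        from loc[OF this] obtain W where "openin (Euclidean_space m) W" "u \<in> W" "W \<subseteq> U" "plots (tot (contra_ext V)) m W p"
          by (elim exE conjE)
        then show "\<exists>W. openin (Euclidean_space m) W \<and> u \<in> W \<and> W \<subseteq> U \<and> plots (tot (ext_power V n)) m W (\<lambda>u. p u n)"
          by (intro exI[of _ W]) (simp add: plots_contra_ext)
      qed
    qed
  }
qed

lemma contra_ext_base_plot:
  assumes V: "pseudo_bundle V" and p: "plots (tot (contra_ext V)) m U p"
  shows "plots (base V) m U (\<lambda>u. fst (p u 0))"
proof -
  have "plots (tot (tensor_power V 0)) m U (\<lambda>u. p u 0)"
    using p by (simp add: plots_contra_ext plots_ext_power)
  then show ?thesis
    using plots_tensor_diffD(2) by (simp add: tensor_power_simps[OF V])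
qed

lemma contra_ext_fst: "w \<in> vert (contra_ext V) x \<Longrightarrow> fst (w 0) = x"
  by (simp add: vert_def contra_ext_simps)

lemma contra_ext_vert: "w \<in> pts (tot (contra_ext V)) \<Longrightarrow> w \<in> vert (contra_ext V) (fst (w 0)) \<and> fst (w 0) \<in> pts (base V)"
  by (auto simp: vert_def contra_ext_simps pts_contra_ext ext_power_simps)

lemma contra_ext_comp:
  assumes x: "x \<in> pts (base V)" and w: "w \<in> vert (contra_ext V) x"
  obtains a where "a \<in> tspan V n x" "alt_op n a = a" "w n = tcls V n x a"
proof -
  have "w n \<in> vert (ext_power V n) x" using w unfolding vert_contra_ext[OF x] by blast
  then show thesis using x that by (rule vert_ext_power_alt)
qed

section \<open>Maps of exterior algebras induced by fibrewise linear maps\<close>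

definition ext_map :: "('w, 'y) vbundle \<Rightarrow> ('x \<Rightarrow> 'y) \<Rightarrow> ('v \<Rightarrow> 'w) \<Rightarrow> (nat \<Rightarrow> ('v, 'x) tensor) \<Rightarrow> nat \<Rightarrow> ('w, 'y) tensor"
  where "ext_map W \<phi> g w n = tensor_power_map W n \<phi> g (w n)"

text \<open>Entrywise maps commute with alternation, so alternating representatives remain
  alternating; they preserve zero, so only finitely many components are nonzero.\<close>

lemma ext_map_vert:
  assumes V: "pseudo_bundle V" and W: "pseudo_bundle W"
    and x: "x \<in> pts (base V)" "\<phi> x \<in> pts (base W)"
    and g: "linear_map class_ring (fibre V x) (fibre W (\<phi> x)) g"
    and w: "w \<in> vert (contra_ext V) x"
  shows "ext_map W \<phi> g w \<in> vert (contra_ext W) (\<phi> x)"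
  unfolding vert_contra_ext[OF x(2)]
proof (intro conjI allI)
  fix n
  show "ext_map W \<phi> g w n \<in> vert (ext_power W n) (\<phi> x)"
    by (rule contra_ext_comp[OF x(1) w, of n])
      (simp add: ext_map_def tensor_power_map_tcls[where W = W and \<phi> = \<phi>, OF g] vert_ext_powerI[OF x(2)]
        push_tspan[where W = W, OF g] alt_op_push)
next
  have "ext_map W \<phi> g w n = vzero (tensor_power W n) (\<phi> x)" if "w n = vzero (tensor_power V n) x" for n
    using tensor_power_map_tcls[where W = W and \<phi> = \<phi> and n = n and a = 0, OF g] that
    by (simp add: ext_map_def tensor_power_simps[OF V] tensor_power_simps[OF W] linear_0[OF linear_push])
  then have "{n. ext_map W \<phi> g w n \<noteq> vzero (tensor_power W n) (\<phi> x)} \<subseteq> {n. w n \<noteq> vzero (tensor_power V n) x}"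
    by blast
  moreover have "finite {n. w n \<noteq> vzero (tensor_power V n) x}"
    using w unfolding vert_contra_ext[OF x(1)] by blast
  ultimately show "finite {n. ext_map W \<phi> g w n \<noteq> vzero (tensor_power W n) (\<phi> x)}"
    by (rule finite_subset)
qed

lemma ext_map_linear:
  assumes V: "pseudo_bundle V" and W: "pseudo_bundle W"
    and x: "x \<in> pts (base V)" "\<phi> x \<in> pts (base W)"
    and g: "linear_map class_ring (fibre V x) (fibre W (\<phi> x)) g"
  shows "linear_map class_ring (fibre (contra_ext V) x) (fibre (contra_ext W) (\<phi> x)) (ext_map W \<phi> g)"
proof (rule linear_mapI[OF vectorspace_contra_ext[OF V x(1)] vectorspace_contra_ext[OF W x(2)]])
  note t = tensor_power_map_tcls[where W = W and \<phi> = \<phi>, OF g]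
  fix v w and r assume "v \<in> carrier (fibre (contra_ext V) x)"
  then have v: "v \<in> vert (contra_ext V) x" by simp
  then show "ext_map W \<phi> g v \<in> carrier (fibre (contra_ext W) (\<phi> x))"
    using ext_map_vert[where \<phi> = \<phi>, OF V W x g] by simp
  have "ext_map W \<phi> g (vsmul (contra_ext V) r v) n = vsmul (contra_ext W) r (ext_map W \<phi> g v) n" for n
    by (rule contra_ext_comp[OF x(1) v, of n])
      (simp add: ext_map_def contra_ext_simps tensor_power_simps[OF V] tensor_power_simps[OF W] t linear_scale[OF linear_push])
  then show "ext_map W \<phi> g (r \<odot>\<^bsub>fibre (contra_ext V) x\<^esub> v) = r \<odot>\<^bsub>fibre (contra_ext W) (\<phi> x)\<^esub> ext_map W \<phi> g v"
    by (simp add: fun_eq_iff)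
  assume "w \<in> carrier (fibre (contra_ext V) x)"
  then have w: "w \<in> vert (contra_ext V) x" by simp
  have "ext_map W \<phi> g (vadd (contra_ext V) v w) n = vadd (contra_ext W) (ext_map W \<phi> g v) (ext_map W \<phi> g w) n" for n
    by (rule contra_ext_comp[OF x(1) v, of n]; rule contra_ext_comp[OF x(1) w, of n])
      (simp add: ext_map_def contra_ext_simps tensor_power_simps[OF V] tensor_power_simps[OF W] t linear_add[OF linear_push])
  then show "ext_map W \<phi> g (v \<oplus>\<^bsub>fibre (contra_ext V) x\<^esub> w) =
      ext_map W \<phi> g v \<oplus>\<^bsub>fibre (contra_ext W) (\<phi> x)\<^esub> ext_map W \<phi> g w"
    by (simp add: fun_eq_iff)
qed

text \<open>The composite is compared with a third map \<open>k\<close> that agrees with it on the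
  fibre over \<open>x\<close>. In this form \<open>B1\<close> after \<open>lift\<close> is compared
  with \<open>B2\<close>, where the maps of the bases agree over f(Y).\<close>

lemma ext_map_compose:
  assumes x: "x \<in> pts (base V)" and w: "w \<in> vert (contra_ext V) x"
    and g: "linear_map class_ring (fibre V x) (fibre W (\<phi> x)) g"
    and h: "linear_map class_ring (fibre W (\<phi> x)) (fibre Z (\<psi> (\<phi> x))) h"
    and k: "linear_map class_ring (fibre V x) (fibre Z (\<theta> x)) k"
    and eq: "\<psi> (\<phi> x) = \<theta> x" "\<And>v. v \<in> vert V x \<Longrightarrow> h (g v) = k v"
  shows "ext_map Z \<psi> h (ext_map W \<phi> g w) = ext_map Z \<theta> k w"
proof
  fix n
  obtain a where a: "a \<in> tspan V n x" "w n = tcls V n x a"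
    by (rule contra_ext_comp[OF x w])
  have "push (h \<circ> g) a = push k a"
    by (rule push_cong[OF _ a(1)]) (use eq(2) in \<open>auto simp: tuples_def\<close>)
  then show "ext_map Z \<psi> h (ext_map W \<phi> g w) n = ext_map Z \<theta> k w n"
    by (simp add: ext_map_def a(2) tensor_power_map_tcls[where W = W and \<phi> = \<phi>, OF g]
        tensor_power_map_tcls[where W = Z and \<phi> = \<psi>, OF h] tensor_power_map_tcls[where W = Z and \<phi> = \<theta>, OF k]
        push_push eq(1))
qed

lemma ext_map_inverse:
  assumes x: "x \<in> pts (base V)" and w: "w \<in> vert (contra_ext V) x"
    and g: "linear_map class_ring (fibre V x) (fibre W (\<phi> x)) g"
    and h: "linear_map class_ring (fibre W (\<phi> x)) (fibre V x) h"
    and eq: "\<psi> (\<phi> x) = x" "\<And>v. v \<in> vert V x \<Longrightarrow> h (g v) = v"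
  shows "ext_map V \<psi> h (ext_map W \<phi> g w) = w"
proof
  fix n
  obtain a where a: "a \<in> tspan V n x" "w n = tcls V n x a"
    by (rule contra_ext_comp[OF x w])
  have "push (h \<circ> g) a = a"
    by (rule push_id[OF _ a(1)]) (use eq(2) in \<open>auto simp: tuples_def\<close>)
  then show "ext_map V \<psi> h (ext_map W \<phi> g w) n = w n"
    by (simp add: ext_map_def a(2) tensor_power_map_tcls[where W = W and \<phi> = \<phi>, OF g]
        tensor_power_map_tcls[where W = V and \<phi> = \<psi> and x = "\<phi> x", unfolded eq(1), OF h] push_push)
qed

lemma ext_map_plots:
  assumes V: "pseudo_bundle V" and W: "pseudo_bundle W"
    and p: "plots (tot (contra_ext V)) m U p"
    and lin: "\<And>u. u \<in> U \<Longrightarrow> linear_map class_ring (fibre V (fst (p u 0))) (fibre W (\<phi> (fst (p u 0)))) g"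
    and g: "\<And>S q. S \<subseteq> U \<Longrightarrow> plots (tot V) m S q \<Longrightarrow> (\<And>w. w \<in> S \<Longrightarrow> bproj V (q w) = fst (p w 0)) \<Longrightarrow>
      plots (tot W) m S (\<lambda>w. g (q w))"
    and \<phi>: "plots (base W) m U (\<lambda>u. \<phi> (fst (p u 0)))"
  shows "plots (tot (contra_ext W)) m U (\<lambda>u. ext_map W \<phi> g (p u))"
proof -
  note pc = p[unfolded plots_contra_ext]
  have pv: "p u \<in> vert (contra_ext V) (fst (p u 0))" "fst (p u 0) \<in> pts (base V)" if "u \<in> U" for u
    using contra_ext_vert[of "p u" V] pc[THEN conjunct2, THEN conjunct1, rule_format, OF that] by simp_all
  have fst: "fst (p u n) = fst (p u 0)" if "u \<in> U" for u n
    by (rule contra_ext_comp[OF pv(2,1)[OF that], of n]) simp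
  have mem: "ext_map W \<phi> g (p u) \<in> vert (contra_ext W) (\<phi> (fst (p u 0)))" if "u \<in> U" for u
    by (rule ext_map_vert[where \<phi> = \<phi>, OF V W pv(2)[OF that] plots_in[OF pseudo_bundle_base[OF W] \<phi> that] lin[OF that] pv(1)[OF that]])
  show ?thesis
    unfolding plots_contra_ext plots_ext_power
  proof (intro conjI ballI allI)
    show "openin (Euclidean_space m) U" by (rule pc[THEN conjunct1])
    show "ext_map W \<phi> g (p u) \<in> pts (tot (contra_ext W))" if "u \<in> U" for u
      by (rule vert_in_tot[OF mem[OF that]])
    fix n
    show "ext_map W \<phi> g (p u) n \<in> Alt W n ` tensor_pts W n" if "u \<in> U" for u
    proof -
      have "ext_map W \<phi> g (p u) n \<in> vert (ext_power W n) (\<phi> (fst (p u 0)))"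
        using mem[OF that] unfolding vert_contra_ext[OF plots_in[OF pseudo_bundle_base[OF W] \<phi> that]] by blast
      from vert_in_tot[OF this] show ?thesis unfolding pts_ext_power .
    qed
    have "plots (tot (tensor_power V n)) m U (\<lambda>u. p u n)"
      using pc[THEN conjunct2, THEN conjunct2, rule_format, of n] by (simp add: plots_ext_power)
    then show "plots (tot (tensor_power W n)) m U (\<lambda>u. ext_map W \<phi> g (p u) n)"
      unfolding ext_map_def
    proof (rule tensor_power_map_plots[OF V W])
      show "linear_map class_ring (fibre V (fst (p u n))) (fibre W (\<phi> (fst (p u n)))) g" if "u \<in> U" for u
        using lin[OF that] by (simp add: fst[OF that, of n])
      show "plots (base W) m U (\<lambda>u. \<phi> (fst (p u n)))"
        by (rule plots_cong[OF pseudo_bundle_base[OF W] \<phi>]) (simp add: fst[of _ n])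
      fix S q assume S: "S \<subseteq> U" "plots (tot V) m S q" "\<And>w. w \<in> S \<Longrightarrow> bproj V (q w) = fst (p w n)"
      show "plots (tot W) m S (\<lambda>w. g (q w))"
      proof (rule g[OF S(1,2)])
        show "bproj V (q w) = fst (p w 0)" if "w \<in> S" for w
          using S(1) that by (simp add: S(3) fst[of w n] subset_iff)
      qed
    qed
  qed
qed

subsection \<open>The dimension of the dual\<close>

text \<open>Evaluation on a basis embeds the covectors of a fibre into a coordinate space, which bounds
  the size of linearly independent sets of covectors; a maximal one is a basis.\<close>

lemma fin_dim_injective:
  fixes M :: "(real, 'v) module"
  assumes M: "vectorspace class_ring M" and N: "vectorspace class_ring (N :: (real, 'w) module)"
    and T: "linear_map class_ring M N T" "inj_on T (carrier M)"
    and fin: "vectorspace.fin_dim class_ring N"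
  shows "vectorspace.fin_dim class_ring M \<and> vectorspace.dim class_ring M \<le> vectorspace.dim class_ring N"
proof -
  interpret MV: vectorspace "class_ring :: real ring" M by fact
  interpret NV: vectorspace "class_ring :: real ring" N by fact
  have fin_bound: "card A \<le> NV.dim" if A: "finite A" "A \<subseteq> carrier M" "MV.lin_indpt A" for A
  proof -
    have TA: "T ` A \<subseteq> carrier N" using A(2) linear_mapD(3)[OF T(1)] by blast
    \<comment> \<open>A vanishing combination of the images is the image of a combination, which
      vanishes by injectivity of \<open>T\<close>.\<close>
    have "NV.lin_indpt (T ` A)"
    proof (rule NV.finite_lin_indpt2[OF finite_imageI[OF A(1)] TA])
      fix a assume a: "a \<in> T ` A \<rightarrow> carrier class_ring" and 0: "NV.lincomb a (T ` A) = \<zero>\<^bsub>N\<^esub>"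
      have "T (MV.lincomb (a \<circ> T) A) = T \<zero>\<^bsub>M\<^esub>"
        using linear_map.lincomb_linear_image[OF T A(2) a A(1)] linear_mapD(6)[OF T(1)] 0 by simp
      moreover have aT: "a \<circ> T \<in> A \<rightarrow> carrier class_ring" using a by auto
      moreover have "MV.lincomb (a \<circ> T) A \<in> carrier M"
        by (rule MV.lincomb_closed[OF A(2) aT])
      ultimately have "MV.lincomb (a \<circ> T) A = \<zero>\<^bsub>M\<^esub>"
        using T(2) vectorspaceD(1)[OF M] by (auto dest: inj_onD)
      then have "(a \<circ> T) \<in> A \<rightarrow> {\<zero>\<^bsub>class_ring\<^esub>}"
        using MV.not_lindepD[OF A(3,1) subset_refl aT] by blast
      then show "\<forall>v\<in>T ` A. a v = \<zero>\<^bsub>class_ring\<^esub>" by auto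
    qed
    then have "card (T ` A) \<le> NV.dim" by (rule NV.li_le_dim(2)[OF fin TA])
    moreover have "card (T ` A) = card A"
      by (rule card_image[OF inj_on_subset[OF T(2) A(2)]])
    ultimately show ?thesis by simp
  qed
  have bound: "finite A \<and> card A \<le> NV.dim" if A: "A \<subseteq> carrier M \<and> MV.lin_indpt A" for A
  proof (cases "finite A")
    case False
    \<comment> \<open>An infinite independent set would contain a finite one with one element more
      than the bound.\<close>
    then obtain B where B: "B \<subseteq> A" "finite B" "card B = Suc NV.dim"
      using infinite_arbitrarily_large by metis
    have "MV.lin_indpt B" using A B(1) MV.subset_li_is_li by blast
    then show ?thesis using fin_bound[OF B(2)] A B by auto
  qed (use fin_bound A in blast)
  have "{} \<subseteq> carrier M \<and> MV.lin_indpt {}"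
    by (simp add: MV.lin_dep_def)
  with bound obtain A where A: "finite A" "maximal A (\<lambda>S. S \<subseteq> carrier M \<and> MV.lin_indpt S)"
    using maximal_exists[of "\<lambda>S. S \<subseteq> carrier M \<and> MV.lin_indpt S" NV.dim "{}"] by blast
  then have sub: "A \<subseteq> carrier M \<and> MV.lin_indpt A" by (simp add: maximal_def)
  have gen: "MV.gen_set A" by (rule MV.max_li_is_gen[OF A(2)])
  have "MV.fin_dim" unfolding MV.fin_dim_def using A(1) sub gen by blast
  moreover have "MV.dim \<le> NV.dim"
    using MV.gen_ge_dim[OF A(1) _ gen] bound[OF sub] sub by simp
  ultimately show ?thesis by blast
qed

text \<open>The dual contains only the smooth functionals, so evaluation on a basis is injective but
  in general not onto: the dimension is bounded and not computed.\<close>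

lemma fin_dim_dual:
  assumes V: "pseudo_bundle V" and fin: "vectorspace.fin_dim class_ring (fibre V x)" and x: "x \<in> pts (base V)"
  shows "vectorspace.fin_dim class_ring (fibre (dual_bundle V) x) \<and> fibre_dim (dual_bundle V) x \<le> fibre_dim V x"
proof -
  note vs = pseudo_bundle_fibre[OF V x]
  interpret E: vectorspace "class_ring :: real ring" "fibre V x" by (rule vs)
  obtain \<beta> where \<beta>: "finite \<beta>" "E.basis \<beta>" using E.finite_basis_exists[OF fin] by blast
  then have \<beta>': "\<beta> \<subseteq> vert V x" "E.gen_set \<beta>" "E.dim = card \<beta>"
    using E.dim_basis[OF \<beta>] by (simp_all add: E.basis_def)
  obtain bs where bs: "set bs = \<beta>" "distinct bs" using finite_distinct_list[OF \<beta>(1)] by blast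
  define d where "d = length bs"
  have d: "d = E.dim" using bs \<beta>'(3) distinct_card unfolding d_def by metis
  interpret R: vec_space "TYPE(real)" d .
  define T where "T a = vec d (\<lambda>i. snd a (bs ! i))" for a :: "'b \<times> ('a \<Rightarrow> real)"
  note dvs = pseudo_bundle_fibre[OF pseudo_bundle_dual[OF pseudo_bundle_tot[OF V] pseudo_bundle_base[OF V] pseudo_bundle_fibre[OF V]], of x]
  have bsv: "bs ! i \<in> vert V x" if "i < d" for i
    using that bs(1) \<beta>'(1) by (auto simp: d_def)
  have "linear_map class_ring (fibre (dual_bundle V) x) (module_vec TYPE(real) d) T"
  proof (rule linear_mapI)
    show "vectorspace class_ring (fibre (dual_bundle V) x)" using dvs x by simp
    show "vectorspace class_ring (module_vec TYPE(real) d)" by (rule R.vectorspace_axioms)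
  qed (auto simp: T_def module_vec_simps bsv vert_def[of "dual_bundle V"] intro!: eq_vecI)
  moreover have "inj_on T (carrier (fibre (dual_bundle V) x))"
  proof (rule inj_onI)
    fix a b assume "a \<in> carrier (fibre (dual_bundle V) x)" "b \<in> carrier (fibre (dual_bundle V) x)" and eq: "T a = T b"
    then have a: "a \<in> pts (tot (dual_bundle V))" "fst a = x" and b: "b \<in> pts (tot (dual_bundle V))" "fst b = x"
      by (simp_all add: vert_def)
    note la = linear_mapD[OF pts_dual_linear[OF a(1)], unfolded a(2), simplified]
    note lb = linear_mapD[OF pts_dual_linear[OF b(1)], unfolded b(2), simplified]
    note Ev = vectorspaceD[OF vs, simplified]
    \<comment> \<open>The equalizer of two covectors is a subspace. It contains the basis once the
      evaluation vectors agree, hence is the whole fibre.\<close>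
    let ?S = "{v \<in> vert V x. snd a v = snd b v}"
    have "submodule class_ring ?S (fibre V x)"
      by (rule submodule.intro) (use E.module_axioms Ev la lb in auto)
    moreover have "\<beta> \<subseteq> ?S"
    proof
      fix v assume v: "v \<in> \<beta>"
      then obtain i where i: "i < d" "v = bs ! i" using bs(1) by (auto simp: in_set_conv_nth d_def)
      have "T a $ i = T b $ i" using eq by simp
      then show "v \<in> ?S" using i v \<beta>'(1) by (auto simp: T_def)
    qed
    ultimately have "vert V x \<subseteq> ?S"
      using E.span_is_subset[of \<beta> ?S] \<beta>'(2) by simp
    then show "a = b"
      using a(2) b(2) by (intro dual_eqI[OF a(1) b(1)]) auto
  qed
  moreover have "R.dim = d" "R.fin_dim" by (simp_all add: R.dim_is_n R.fin_dim)
  ultimately show ?thesis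
    using fin_dim_injective[OF _ R.vectorspace_axioms, of "fibre (dual_bundle V) x" T] dvs x d
    by (simp add: fibre_dim_def)
qed

section \<open>The commutativity diffeomorphism of exterior algebras\<close>

text \<open>The set \<open>W\<close> keeps the intersection open also for \<open>n = 0\<close>,
  where the indexed part is the whole type.\<close>

lemma openin_Int_INT_lessThan:
  "openin X W \<Longrightarrow> (\<And>i. i < n \<Longrightarrow> openin X (S i)) \<Longrightarrow> openin X (W \<inter> (\<Inter>i<n. S i))" for n :: nat
proof (induction n)
  case (Suc n)
  have "W \<inter> (\<Inter>i<Suc n. S i) = (W \<inter> (\<Inter>i<n. S i)) \<inter> S n"
    by (auto simp: less_Suc_eq)
  then show ?case using openin_Int[OF Suc.IH Suc.prems(2)[of n]] Suc.prems by simp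
qed simp

text \<open>An alternating representative equals its alternation, which lies in the null space when
  the degree exceeds the size of a basis.\<close>

lemma ext_power_vanishes:
  assumes V: "pseudo_bundle V" and fin: "vectorspace.fin_dim class_ring (fibre V x)" and x: "x \<in> pts (base V)"
    and n: "fibre_dim V x < n" and t: "t \<in> vert (ext_power V n) x"
  shows "t = tcls V n x 0"
proof -
  note vs = pseudo_bundle_fibre[OF V x]
  obtain B where B: "finite B" "vectorspace.basis class_ring (fibre V x) B"
    using vectorspace.finite_basis_exists[OF vs fin] by blast
  then have "B \<subseteq> carrier (fibre V x)" "module.span class_ring (fibre V x) B = carrier (fibre V x)" "card B < n"
    using vectorspace.dim_basis[OF vs B] n unfolding vectorspace.basis_def[OF vs] fibre_dim_def by simp_all
  note B' = this
  obtain a where a: "a \<in> tspan V n x" "alt_op n a = a" "t = tcls V n x a"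
    by (rule vert_ext_power_alt[OF t x])
  then show ?thesis
    using alt_op_vanishes[OF vs B(1) B' a(1)] by (simp add: tcls_eq_iff)
qed

locale ext_gluing = dual_gluing V1 V2 Y f F
  for V1 :: "('v1, 'x1) vbundle" and V2 :: "('v2, 'x2) vbundle" and Y f F +
  assumes fin1: "finite_dim_bundle V1" and fin2: "finite_dim_bundle V2"
    and bdd1: "bdd_above (fibre_dim V1 ` pts (base V1))"
    and bdd2: "bdd_above (fibre_dim V2 ` pts (base V2))"
begin

abbreviation "E1 \<equiv> contra_ext D1"
abbreviation "E2 \<equiv> contra_ext D2"
abbreviation "EG \<equiv> contra_ext dG"
abbreviation "k \<equiv> dual_dim V1 V2"
abbreviation "elift \<equiv> ext_lift V1 Y f F"
abbreviation "H \<equiv> glue_bundle E2 E1 (f ` Y) g elift"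
abbreviation "\<Theta> \<equiv> \<Phi>_ext V1 V2 Y f F"
text \<open>The maps of bases covered by \<open>P1\<close> and \<open>P2\<close>; each is meaningful
  where the switch map takes values on the corresponding side.\<close>

abbreviation "\<phi>1 c \<equiv> projr (sw c)"
abbreviation "\<phi>2 c \<equiv> projl (sw c)"

lemma base_D [simp]: "base D1 = base V1" "base D2 = base V2" "base dG = base G"
  by simp_all

subsection \<open>Components beyond the dimension bound\<close>

text \<open>A supremum of natural numbers is an upper bound only if the set is bounded. The bounds
  for the bundles pass to their duals, whose dimensions can only be smaller.\<close>

lemma bdd_dims: "bdd_above (fibre_dim D1 ` pts (base V1) \<union> fibre_dim D2 ` pts (base V2))"
proof -
  obtain b1 where b1: "\<forall>d\<in>fibre_dim V1 ` pts (base V1). d \<le> b1"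
    using bdd1 unfolding bdd_above_def by (elim exE)
  obtain b2 where b2: "\<forall>d\<in>fibre_dim V2 ` pts (base V2). d \<le> b2"
    using bdd2 unfolding bdd_above_def by (elim exE)
  have d: "fibre_dim D1 x \<le> b1" if "x \<in> pts (base V1)" for x
    using fin_dim_dual[OF V1 fin1[unfolded finite_dim_bundle_def, rule_format, OF that] that] b1 that
    by (meson imageI order_trans)
  have d2: "fibre_dim D2 x \<le> b2" if "x \<in> pts (base V2)" for x
    using fin_dim_dual[OF V2 fin2[unfolded finite_dim_bundle_def, rule_format, OF that] that] b2 that
    by (meson imageI order_trans)
  show ?thesis
    unfolding bdd_above_Un
    by (intro conjI bdd_aboveI[of _ b1] bdd_aboveI[of _ b2]) (use d d2 in blast)+
qed

lemma vanish1: "x \<in> pts (base V1) \<Longrightarrow> k < n \<Longrightarrow> t \<in> vert (ext_power D1 n) x \<Longrightarrow> t = tcls D1 n x 0"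
proof (rule ext_power_vanishes[OF D1])
  assume x: "x \<in> pts (base V1)" and n: "k < n"
  show "vectorspace.fin_dim class_ring (fibre D1 x)"
    by (rule fin_dim_dual[OF V1 fin1[unfolded finite_dim_bundle_def, rule_format, OF x] x, THEN conjunct1])
  have "fibre_dim D1 x \<le> k"
    unfolding dual_dim_def by (rule cSup_upper[OF _ bdd_dims]) (use x in blast)
  then show "fibre_dim D1 x < n" using n by simp
qed simp_all

lemma vanish2: "x \<in> pts (base V2) \<Longrightarrow> k < n \<Longrightarrow> t \<in> vert (ext_power D2 n) x \<Longrightarrow> t = tcls D2 n x 0"
proof (rule ext_power_vanishes[OF D2])
  assume x: "x \<in> pts (base V2)" and n: "k < n"
  show "vectorspace.fin_dim class_ring (fibre D2 x)"
    by (rule fin_dim_dual[OF V2 fin2[unfolded finite_dim_bundle_def, rule_format, OF x] x, THEN conjunct1])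
  have "fibre_dim D2 x \<le> k"
    unfolding dual_dim_def by (rule cSup_upper[OF _ bdd_dims]) (use x in blast)
  then show "fibre_dim D2 x < n" using n by simp
qed simp_all

lemma ext_comp: "x \<in> pts (base V) \<Longrightarrow> w \<in> vert (contra_ext V) x \<Longrightarrow> w n \<in> vert (ext_power V n) x"
  unfolding vert_contra_ext by blast

subsection \<open>The pieces and their inverses\<close>

lemma \<phi>1_i1: "x \<in> pts (base V1) \<Longrightarrow> \<phi>1 (i1 x) = x"
  by (simp add: sw_i1)

lemma \<phi>2_Inr: "x \<notin> f ` Y \<Longrightarrow> \<phi>2 (Inr x) = x"
  by (simp add: switch_map_def)

lemma P1_linear': "x \<in> pts (base V1) \<Longrightarrow> linear_map class_ring (fibre dG (i1 x)) (fibre D1 (\<phi>1 (i1 x))) P1"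
  using P1_linear \<phi>1_i1 by simp

lemma P2_linear': "x \<in> pts (base V2) \<Longrightarrow> x \<notin> f ` Y \<Longrightarrow>
    linear_map class_ring (fibre dG (Inr x)) (fibre D2 (\<phi>2 (Inr x))) P2"
  using P2_linear \<phi>2_Inr by simp

text \<open>In the names from here on, \<open>Q1\<close> and \<open>Q2\<close> stand for the maps of
  exterior algebras induced by \<open>P1\<close> and \<open>P2\<close>, and \<open>R1\<close> and
  \<open>R2\<close> for those induced by \<open>B1\<close> and \<open>B2\<close>.\<close>

lemma Q1_vert: "x \<in> pts (base V1) \<Longrightarrow> w \<in> vert EG (i1 x) \<Longrightarrow> ext_map D1 \<phi>1 P1 w \<in> vert E1 x"
  using ext_map_vert[where \<phi> = \<phi>1, OF dG D1 _ _ P1_linear', of x w] i1_base \<phi>1_i1 by simp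

lemma Q2_vert: "x \<in> pts (base V2) \<Longrightarrow> x \<notin> f ` Y \<Longrightarrow> w \<in> vert EG (Inr x) \<Longrightarrow> ext_map D2 \<phi>2 P2 w \<in> vert E2 x"
  using ext_map_vert[where \<phi> = \<phi>2, OF dG D2 _ _ P2_linear', of x w] Inr_base_G \<phi>2_Inr by simp

lemma R1_vert: "x \<in> pts (base V1) \<Longrightarrow> z \<in> vert E1 x \<Longrightarrow> ext_map dG i1 B1 z \<in> vert EG (i1 x)"
  by (rule ext_map_vert[where \<phi> = i1, OF D1 dG _ _ B1_linear]) (simp_all add: i1_base del: glue_bundle_simps)

lemma R2_vert: "x \<in> pts (base V2) \<Longrightarrow> z \<in> vert E2 x \<Longrightarrow> ext_map dG Inr B2 z \<in> vert EG (Inr x)"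
  by (rule ext_map_vert[where \<phi> = Inr, OF D2 dG _ _ B2_linear]) (simp_all add: Inr_base_G del: glue_bundle_simps)

lemma R1_Q1: "x \<in> pts (base V1) \<Longrightarrow> w \<in> vert EG (i1 x) \<Longrightarrow> ext_map dG i1 B1 (ext_map D1 \<phi>1 P1 w) = w"
  by (rule ext_map_inverse[where \<phi> = \<phi>1 and \<psi> = i1 and x = "i1 x", OF _ _ P1_linear'])
    (simp_all add: i1_base \<phi>1_i1 B1_linear B1_P1 del: glue_bundle_simps)

lemma Q1_R1: "x \<in> pts (base V1) \<Longrightarrow> z \<in> vert E1 x \<Longrightarrow> ext_map D1 \<phi>1 P1 (ext_map dG i1 B1 z) = z"
  by (rule ext_map_inverse[where \<phi> = i1 and \<psi> = \<phi>1 and x = x, OF _ _ B1_linear])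
    (simp_all add: \<phi>1_i1 P1_linear P1_B1)

lemma R2_Q2: "x \<in> pts (base V2) \<Longrightarrow> x \<notin> f ` Y \<Longrightarrow> w \<in> vert EG (Inr x) \<Longrightarrow>
    ext_map dG Inr B2 (ext_map D2 \<phi>2 P2 w) = w"
  by (rule ext_map_inverse[where \<phi> = \<phi>2 and \<psi> = Inr and x = "Inr x", OF _ _ P2_linear'])
    (simp_all add: Inr_base_G \<phi>2_Inr B2_linear B2_P2 del: glue_bundle_simps)

lemma Q2_R2: "x \<in> pts (base V2) \<Longrightarrow> x \<notin> f ` Y \<Longrightarrow> z \<in> vert E2 x \<Longrightarrow>
    ext_map D2 \<phi>2 P2 (ext_map dG Inr B2 z) = z"
  by (rule ext_map_inverse[where \<phi> = Inr and \<psi> = \<phi>2 and x = x, OF _ _ B2_linear])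
    (simp_all add: \<phi>2_Inr P2_linear P2_B2)

lemma elift_eq: "elift = ext_map D1 g lift"
  by (simp add: fun_eq_iff ext_lift_def direct_sum_map_def dual_lift_power_def ext_map_def)

lemma elift_vert:
  assumes "x \<in> f ` Y" "z \<in> vert E2 x"
  shows "elift z \<in> vert E1 (g x)"
  unfolding elift_eq
  by (rule ext_map_vert[where \<phi> = g, OF D2 D1 _ _ lift_linear[OF assms(1)] assms(2)])
    (use assms(1) g_base f_base in auto)

lemma elift_over: "z \<in> over E2 (f ` Y) \<Longrightarrow> elift z \<in> pts (tot E1)"
  using elift_vert[of "fst (z 0)" z] vert_in_tot[of "elift z"]
  by (simp add: over_def vert_def contra_ext_simps)

text \<open>The identity \<open>B2_lift\<close> carried over to exterior algebras. It is the
  compatibility with the identification over f(Y) that lets \<open>R1\<close> and \<open>R2\<close>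
  define a map on the gluing.\<close>

lemma R1_elift:
  assumes x: "x \<in> f ` Y" and z: "z \<in> vert E2 x"
  shows "ext_map dG i1 B1 (elift z) = ext_map dG Inr B2 z"
proof -
  have y: "g x \<in> pts (base V1)" "i1 (g x) = Inr x" "x \<in> pts (base V2)"
    using g_in[OF x] f_g[OF x] Y_sub f_base[OF g_in[OF x]] by (simp_all add: i1_simps)
  show ?thesis
    unfolding elift_eq
    by (rule ext_map_compose[where \<phi> = g and \<psi> = i1 and \<theta> = Inr and x = x, OF _ z lift_linear[OF x] B1_linear[OF y(1)] B2_linear[OF y(3)] y(2)])
      (use y(3) x B2_lift in \<open>auto simp: vert_def\<close>)
qed

subsection \<open>The map \<open>\<Phi>\<^sup>\<And>\<close> on fibres\<close>

text \<open>Treats both sides of the gluing at once: \<open>J'\<close> is the inclusion of the fibre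
  of \<open>D\<close> into that of \<open>DG\<close>, \<open>K\<close> its inverse, and
  \<open>P\<close> the component of \<Phi> with \<open>J' (P v) = \<Phi> v\<close>. The tensor power
  of \<open>P\<close> supplies the preimage, and functoriality shows that it is one.\<close>

lemma tensor_comm_eq:
  assumes c: "c \<in> pts (base G)" and a: "a \<in> tspan dG n c" and sw: "sw c = J x" and x: "x \<in> pts (base D)"
    and J: "linear_map class_ring (fibre D x) (fibre DG (J x)) J'" "\<And>v. v \<in> vert D x \<Longrightarrow> K (J' v) = v"
      "linear_map class_ring (fibre DG (J x)) (fibre D x) K"
    and P: "linear_map class_ring (fibre dG c) (fibre D (\<phi> c)) P" "\<phi> c = x" "\<And>v. v \<in> vert dG c \<Longrightarrow> J' (P v) = \<Phi> v"
  shows "inv_into (vert (tensor_power D n) x) (tensor_power_map DG n J J') (tensor_power_map DG n sw \<Phi> (tcls dG n c a)) =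
    tensor_power_map D n \<phi> P (tcls dG n c a)"
proof (rule inv_into_f_eq)
  note tJ = tensor_power_map_tcls[where W = DG and \<phi> = J and x = x, OF J(1)]
  show "inj_on (tensor_power_map DG n J J') (vert (tensor_power D n) x)"
  proof (rule inj_onI)
    fix s t assume "s \<in> vert (tensor_power D n) x" "t \<in> vert (tensor_power D n) x"
      and e: "tensor_power_map DG n J J' s = tensor_power_map DG n J J' t"
    then obtain b d where b: "b \<in> tspan D n x" "s = tcls D n x b" and d: "d \<in> tspan D n x" "t = tcls D n x d"
      unfolding vert_tensor_power[OF x] by blast
    \<comment> \<open>A left inverse on representatives. As \<open>push K\<close> maps relations to
      relations, injectivity descends to classes.\<close>
    have id: "push K (push J' b) = b" if "b \<in> tspan D n x" for b
      unfolding push_push by (rule push_id[OF _ that]) (use J(2) in \<open>auto simp: tuples_def\<close>)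
    have "push J' b - push J' d \<in> tensor_null (fibre DG (J x)) n"
      using e by (simp add: b d tJ tcls_eq_iff)
    from push_null[OF J(3) this] have "b - d \<in> tensor_null (fibre D x) n"
      by (simp add: linear_diff[OF linear_push] id b(1) d(1))
    then show "s = t" by (simp add: b d tcls_eq_iff)
  qed
  note tP = tensor_power_map_tcls[where W = D and \<phi> = \<phi> and x = c, OF P(1), unfolded P(2)]
  have pa: "push P a \<in> tspan D n x"
    by (rule push_tspan[OF _ a]) (use P(1,2) in simp)
  then show "tensor_power_map D n \<phi> P (tcls dG n c a) \<in> vert (tensor_power D n) x"
    unfolding vert_tensor_power[OF x] tP by (rule imageI)
  have "push (J' \<circ> P) a = push \<Phi> a"
    by (rule push_cong[OF _ a]) (use P(3) in \<open>auto simp: tuples_def\<close>)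
  then show "tensor_power_map DG n J J' (tensor_power_map D n \<phi> P (tcls dG n c a)) = tensor_power_map DG n sw \<Phi> (tcls dG n c a)"
    using tensor_power_map_tcls[where W = DG and \<phi> = sw, OF \<Phi>_linear[OF c]] by (simp add: tP tJ push_push sw)
qed

text \<open>Vanishing above degree \<open>k\<close> is what places \<open>z\<close> in the truncated
  direct sum, whose families are zero outside \<open>{..k}\<close>; there \<open>z\<close> is the
  preimage sought.\<close>

lemma sum_comm_eq:
  assumes V: "pseudo_bundle V" and x: "x \<in> pts (base V)" and z: "z \<in> vert (contra_ext V) x"
    and van: "\<And>n. k < n \<Longrightarrow> z n = tcls V n x 0" and J: "inj J"
  shows "inv_into (vert (direct_sum {..k} (tensor_power V)) x) (direct_sum_map (\<lambda>n. J)) (\<lambda>n. J (z n)) = z"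
proof (rule inv_into_f_eq)
  show "inj_on (direct_sum_map (\<lambda>n. J)) (vert (direct_sum {..k} (tensor_power V)) x)"
  proof (rule inj_onI, rule ext)
    fix v w n assume "direct_sum_map (\<lambda>n. J) v = direct_sum_map (\<lambda>n. J) w"
    then have "J (v n) = J (w n)" by (simp add: direct_sum_map_def fun_eq_iff)
    with J show "v n = w n" by (rule injD)
  qed
  have "z n \<in> vert (tensor_power V n) x" for n
    by (rule contra_ext_comp[OF x z, of n]) (simp add: vert_tensor_power[OF x])
  moreover have "z n = vzero (tensor_power V n) x" if "k < n" for n
    using van[OF that] by (simp add: tensor_power_simps[OF V])
  moreover have "w \<in> vert (direct_sum {..k} (tensor_power V)) x"
    if "\<And>n. w n \<in> vert (tensor_power V n) x" "\<And>n. k < n \<Longrightarrow> w n = vzero (tensor_power V n) x" "fst (w 0) = x" for w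
    unfolding vert_def[of "direct_sum {..k} (tensor_power V)"]
    using that x by (auto simp: direct_sum_def Let_def tensor_power_simps')
  ultimately show "z \<in> vert (direct_sum {..k} (tensor_power V)) x"
    using contra_ext_fst[OF z] by blast
qed (simp add: direct_sum_map_def)

lemma glued_powers_bproj: "bproj (direct_sum {..k} (glued_powers V1 V2 Y f F)) e = map_sum fst fst (e 0)"
  by (simp add: direct_sum_def Let_def glued_powers_def tensor_power_simps')

lemma \<Phi>_tensor_simps:
  "fst e = Inl x \<Longrightarrow> \<Phi>_tensor V1 V2 Y f F n e =
     Inl (inv_into (vert (tensor_power D2 n) x) (tensor_power_map DG n Inl Inl) e)"
  "fst e = Inr x' \<Longrightarrow> \<Phi>_tensor V1 V2 Y f F n e =
     Inr (inv_into (vert (tensor_power D1 n) x') (tensor_power_map DG n Inr Inr) e)"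
  by (simp_all add: \<Phi>_tensor_def Let_def glue_comm_def tensor_power_simps')

lemma tensor_power_map_fst: "fst (tensor_power_map W n \<phi> h t) = \<phi> (fst t)"
  by (simp add: tensor_power_map_def split_beta)

text \<open>The inverses hidden in the commutativity maps are resolved degree by degree through
  \<open>tensor_comm_eq\<close> and, for the sum, through \<open>sum_comm_eq\<close>. What remains
  is an induced map, to which functoriality applies.\<close>

lemma \<Theta>_left:
  assumes x: "x \<in> pts (base V1)" and w: "w \<in> vert EG (i1 x)"
  shows "\<Theta> w = Inr (ext_map D1 \<phi>1 P1 w)"
proof -
  let ?z = "ext_map D1 \<phi>1 P1 w"
  note z = Q1_vert[OF x w]
  have c: "i1 x \<in> pts (base dG)" using i1_base[OF x] by simp
  have "\<Phi>_tensor V1 V2 Y f F n (tensor_power_map DG n sw \<Phi> (w n)) = Inr (?z n)" for n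
  proof -
    obtain a where a: "a \<in> tspan dG n (i1 x)" "w n = tcls dG n (i1 x) a"
      by (rule contra_ext_comp[OF c w])
    have K: "linear_map class_ring (fibre DG (Inr x)) (fibre D1 x) projr"
      by (rule linear_map_inverse[OF Inr_DG_linear[OF x]]) (auto simp: vert_DG)
    have "inv_into (vert (tensor_power D1 n) x) (tensor_power_map DG n Inr Inr) (tensor_power_map DG n sw \<Phi> (tcls dG n (i1 x) a)) =
        tensor_power_map D1 n \<phi>1 P1 (tcls dG n (i1 x) a)"
      by (rule tensor_comm_eq[where J = Inr and \<phi> = \<phi>1 and x = x, OF i1_base[OF x] a(1) sw_i1[OF x] _ Inr_DG_linear[OF x] _ K P1_linear'[OF x] \<phi>1_i1[OF x]])
        (use x \<Phi>_left in simp_all)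
    then show ?thesis
      by (subst \<Phi>_tensor_simps(2)[of _ x]) (simp_all add: a(2) tensor_power_map_fst sw_i1[OF x] ext_map_def)
  qed
  then have 1: "\<Theta> w = \<Phi>_sum V1 V2 Y f F k (\<lambda>n. Inr (?z n))"
    by (simp add: \<Phi>_ext_def direct_sum_map_def)
  have van: "?z n = tcls D1 n x 0" if "k < n" for n
    by (rule vanish1[OF x]) (rule that, rule ext_comp[OF _ z], use x in simp)
  have "\<Phi>_sum V1 V2 Y f F k (\<lambda>n. Inr (?z n)) = Inr ?z"
    using x by (simp add: \<Phi>_sum_def glue_comm_def glued_powers_bproj contra_ext_fst[OF z] sum_comm_eq[OF D1 _ z van])
  with 1 show ?thesis by (rule trans)
qed

lemma \<Theta>_right:
  assumes x: "x \<in> pts (base V2)" "x \<notin> f ` Y" and w: "w \<in> vert EG (Inr x)"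
  shows "\<Theta> w = Inl (ext_map D2 \<phi>2 P2 w)"
proof -
  let ?z = "ext_map D2 \<phi>2 P2 w"
  note z = Q2_vert[OF x w]
  have c: "Inr x \<in> pts (base dG)" using Inr_base_G[OF x(1)] by simp
  have sw: "sw (Inr x) = Inl x" using x(2) by (simp add: switch_map_def)
  have "\<Phi>_tensor V1 V2 Y f F n (tensor_power_map DG n sw \<Phi> (w n)) = Inl (?z n)" for n
  proof -
    obtain a where a: "a \<in> tspan dG n (Inr x)" "w n = tcls dG n (Inr x) a"
      by (rule contra_ext_comp[OF c w])
    have K: "linear_map class_ring (fibre DG (Inl x)) (fibre D2 x) projl"
      by (rule linear_map_inverse[OF Inl_DG_linear[OF x]]) (auto simp: vert_DG x(2))
    have "inv_into (vert (tensor_power D2 n) x) (tensor_power_map DG n Inl Inl) (tensor_power_map DG n sw \<Phi> (tcls dG n (Inr x) a)) =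
        tensor_power_map D2 n \<phi>2 P2 (tcls dG n (Inr x) a)"
      by (rule tensor_comm_eq[where J = Inl and \<phi> = \<phi>2 and x = x, OF Inr_base_G[OF x(1)] a(1) sw _ Inl_DG_linear[OF x] _ K P2_linear'[OF x] \<phi>2_Inr[OF x(2)]])
        (use x \<Phi>_right in simp_all)
    then show ?thesis
      by (subst \<Phi>_tensor_simps(1)[of _ x]) (simp_all add: a(2) tensor_power_map_fst sw ext_map_def)
  qed
  then have 1: "\<Theta> w = \<Phi>_sum V1 V2 Y f F k (\<lambda>n. Inl (?z n))"
    by (simp add: \<Phi>_ext_def direct_sum_map_def)
  have van: "?z n = tcls D2 n x 0" if "k < n" for n
    by (rule vanish2[OF x(1)]) (rule that, rule ext_comp[OF _ z], use x in simp)
  have "\<Phi>_sum V1 V2 Y f F k (\<lambda>n. Inl (?z n)) = Inl ?z"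
    using x by (simp add: \<Phi>_sum_def glue_comm_def glued_powers_bproj contra_ext_fst[OF z] sum_comm_eq[OF D2 _ z van])
  with 1 show ?thesis by (rule trans)
qed

subsection \<open>The inverse\<close>

text \<open>The candidate for the inverse, given separately on the two factors of the gluing. By
  \<open>R1_elift\<close> its value on a glued element can be computed from any
  representative.\<close>

definition "\<Omega> = case_sum (ext_map dG Inr B2) (ext_map dG i1 B1)"

lemma \<Omega>_simps: "\<Omega> (Inl z) = ext_map dG Inr B2 z" "\<Omega> (Inr z') = ext_map dG i1 B1 z'"
  by (simp_all add: \<Omega>_def)

lemma glue_elift: "glue_map (over E2 (f ` Y)) elift (Inl z) = (if x \<in> f ` Y then Inr (elift z) else Inl z)"
  if "z \<in> vert E2 x" for z
  using that contra_ext_fst[OF that] by (auto simp: glue_map_def over_def vert_def)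

lemma \<Omega>_glue: "z \<in> vert E2 x \<Longrightarrow> \<Omega> (glue_map (over E2 (f ` Y)) elift (Inl z)) = ext_map dG Inr B2 z"
  by (simp add: glue_elift \<Omega>_simps R1_elift)

lemma E_diff: "diffeological (tot E1)" "diffeological (tot E2)" "diffeological (tot EG)"
  using diffeological_contra_ext[OF D1] diffeological_contra_ext[OF D2] diffeological_contra_ext[OF dG] .

lemma vert_H: "vert H (Inr y) = Inr ` vert E1 y" "x \<notin> f ` Y \<Longrightarrow> vert H (Inl x) = Inl ` vert E2 x"
  by (simp_all add: vert_glue[of E2 "f ` Y" elift E1, OF elift_over])

lemma pts_H: "pts (tot H) = Inl ` (pts (tot E2) - over E2 (f ` Y)) \<union> Inr ` pts (tot E1)"
  unfolding glue_bundle_simps using elift_over by (intro pts_dglue_disjoint)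

lemma \<Theta>_vert: "c \<in> pts (base G) \<Longrightarrow> w \<in> vert EG c \<Longrightarrow> \<Theta> w \<in> vert H (sw c) \<and> \<Omega> (\<Theta> w) = w"
  by (erule sw_cases)
    (auto simp: \<Theta>_left \<Theta>_right vert_H \<Omega>_simps R1_Q1 R2_Q2 Q1_vert Q2_vert)

lemma EG_vert: "w \<in> pts (tot EG) \<Longrightarrow> w \<in> vert EG (fst (w 0)) \<and> fst (w 0) \<in> pts (base G)"
  using contra_ext_vert[of w dG] by simp

text \<open>Over f(Y) the element comes from \<open>V1\<close> as well, by \<open>R1_elift\<close>,
  and \<Theta> inverts \<open>R1\<close> there; elsewhere it inverts \<open>R2\<close>. The single
  formula covers curves that enter and leave f(Y).\<close>

lemma \<Theta>_glue:
  assumes x: "x \<in> pts (base V2)" and z: "z \<in> vert E2 x"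
  shows "\<Theta> (ext_map dG Inr B2 z) = glue_map (over E2 (f ` Y)) elift (Inl z)"
proof (cases "x \<in> f ` Y")
  case True
  have y: "g x \<in> pts (base V1)" using g_base[OF True] by simp
  have e: "elift z \<in> vert E1 (g x)" by (rule elift_vert[OF True z])
  have "\<Theta> (ext_map dG i1 B1 (elift z)) = Inr (elift z)"
    by (simp add: \<Theta>_left[OF y R1_vert[OF y e]] Q1_R1[OF y e])
  then show ?thesis using True by (simp add: R1_elift[OF True z] glue_elift[OF z])
next
  case False
  show ?thesis
    by (simp add: \<Theta>_right[OF x False R2_vert[OF x z]] Q2_R2[OF x False z] glue_elift[OF z] False)
qed

lemma \<Omega>_pts: "b \<in> pts (tot H) \<Longrightarrow> \<Omega> b \<in> pts (tot EG) \<and> \<Theta> (\<Omega> b) = b"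
proof -
  assume "b \<in> pts (tot H)"
  then consider z where "z \<in> pts (tot E2)" "z \<notin> over E2 (f ` Y)" "b = Inl z" | z where "z \<in> pts (tot E1)" "b = Inr z"
    unfolding pts_H by blast
  then show ?thesis
  proof cases
    case 1
    have x: "z \<in> vert E2 (fst (z 0))" "fst (z 0) \<in> pts (base V2)"
      using contra_ext_vert[OF 1(1)] by simp_all
    then show ?thesis
      using 1 R2_vert[OF x(2,1)] \<Theta>_glue[OF x(2,1)] vert_in_tot by (auto simp: \<Omega>_simps)
  next
    case 2
    have x: "z \<in> vert E1 (fst (z 0))" "fst (z 0) \<in> pts (base V1)"
      using contra_ext_vert[OF 2(1)] by simp_all
    have "\<Theta> (ext_map dG i1 B1 z) = Inr z"
      by (simp add: \<Theta>_left[OF x(2) R1_vert[OF x(2,1)]] Q1_R1[OF x(2,1)])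
    then show ?thesis
      using 2 vert_in_tot[OF R1_vert[OF x(2,1)]] by (simp add: \<Omega>_simps)
  qed
qed

lemma \<Theta>_bij: "bij_betw \<Theta> (pts (tot EG)) (pts (tot H))"
proof (rule bij_betw_byWitness[where f' = \<Omega>])
  show "\<forall>w\<in>pts (tot EG). \<Omega> (\<Theta> w) = w"
    using EG_vert \<Theta>_vert by blast
  show "\<Theta> ` pts (tot EG) \<subseteq> pts (tot H)"
  proof
    fix b assume "b \<in> \<Theta> ` pts (tot EG)"
    then obtain w where "w \<in> pts (tot EG)" "b = \<Theta> w" by blast
    with EG_vert[of w] have "b \<in> vert H (sw (fst (w 0)))"
      using \<Theta>_vert by blast
    then show "b \<in> pts (tot H)" by (rule vert_in_tot)
  qed
qed (use \<Omega>_pts in blast)+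

subsection \<open>Smoothness\<close>

lemma R1_plots:
  assumes p: "plots (tot E1) m U p"
  shows "plots (tot EG) m U (\<lambda>u. ext_map dG i1 B1 (p u))"
proof (rule ext_map_plots[OF D1 dG p])
  note b = contra_ext_base_plot[OF D1 p, unfolded base_D]
  show "linear_map class_ring (fibre D1 (fst (p u 0))) (fibre dG (i1 (fst (p u 0)))) B1" if "u \<in> U" for u
    by (rule B1_linear[OF plots_in[OF pseudo_bundle_base[OF V1] b that]])
  show "plots (base dG) m U (\<lambda>u. i1 (fst (p u 0)))"
    using i1_plots[OF b] by simp
qed (rule B1_plots)

lemma R2_plots:
  assumes p: "plots (tot E2) m U p"
  shows "plots (tot EG) m U (\<lambda>u. ext_map dG Inr B2 (p u))"
proof (rule ext_map_plots[OF D2 dG p])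
  note b = contra_ext_base_plot[OF D2 p, unfolded base_D]
  show "linear_map class_ring (fibre D2 (fst (p u 0))) (fibre dG (Inr (fst (p u 0)))) B2" if "u \<in> U" for u
    by (rule B2_linear[OF plots_in[OF pseudo_bundle_base[OF V2] b that]])
  show "plots (base dG) m U (\<lambda>u. Inr (fst (p u 0)))"
    using i2_plots[OF b] by simp
qed (rule B2_plots)

text \<open>A local lift to the left factor may meet f(Y), but \<open>\<Omega>_glue\<close>
  expresses \<Omega> by the lift uniformly, so both kinds of lifts are mapped by one smooth induced
  map.\<close>

lemma \<Omega>_plots:
  assumes b: "plots (tot H) m U b"
  shows "plots (tot EG) m U (\<lambda>u. \<Omega> (b u))"
proof (rule plots_local[OF E_diff(3)])
  note b' = b[unfolded glue_bundle_simps]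
  show "openin (Euclidean_space m) U"
    by (rule plots_open[OF diffeological_dglue[OF E_diff(2,1)] b'])
  fix u assume "u \<in> U"
  with E_diff(2,1) b' show "\<exists>W. openin (Euclidean_space m) W \<and> u \<in> W \<and> W \<subseteq> U \<and> plots (tot EG) m W (\<lambda>u. \<Omega> (b u))"
  proof (cases rule: plots_dglueE)
    case (left W q)
    have "plots (tot EG) m W (\<lambda>u. \<Omega> (b u))"
    proof (rule plots_cong[OF E_diff(3) R2_plots[OF left(4)]])
      fix w assume w: "w \<in> W"
      have "q w \<in> vert E2 (fst (q w 0))"
        using contra_ext_vert[OF plots_in[OF E_diff(2) left(4) w]] by blast
      from \<Omega>_glue[OF this] show "\<Omega> (b w) = ext_map dG Inr B2 (q w)"
        by (simp add: left(5)[OF w])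
    qed
    with left show ?thesis by (intro exI[of _ W] conjI)
  next
    case (right W q)
    have "plots (tot EG) m W (\<lambda>u. \<Omega> (b u))"
      by (rule plots_cong[OF E_diff(3) R1_plots[OF right(4)]]) (simp add: right(5) \<Omega>_simps)
    with right show ?thesis by (intro exI[of _ W] conjI)
  qed
qed

text \<open>The base points lie in the image of \<open>i1\<close>, so the switch map sends them to
  right-hand points. This forces a local lift of \<Phi> composed with \<xi> to \<open>D2\<close> to
  lie over f(Y), where it can be carried to \<open>D1\<close> smoothly.\<close>

lemma P1_plots:
  assumes \<xi>: "plots (tot dG) m U \<xi>" and base: "\<And>u. u \<in> U \<Longrightarrow> x u \<in> pts (base V1) \<and> fst (\<xi> u) = i1 (x u)"
  shows "plots (tot D1) m U (\<lambda>u. P1 (\<xi> u))"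
proof (rule plots_local[OF pseudo_bundle_tot[OF D1] plots_open[OF pseudo_bundle_tot[OF dG] \<xi>]])
  note T1 = pseudo_bundle_tot[OF D1] and T2 = pseudo_bundle_tot[OF D2]
  fix u assume "u \<in> U"
  with T2 T1 \<Phi>_plots[OF \<xi>, unfolded tot_DG]
  show "\<exists>W. openin (Euclidean_space m) W \<and> u \<in> W \<and> W \<subseteq> U \<and> plots (tot D1) m W (\<lambda>u. P1 (\<xi> u))"
  proof (cases rule: plots_dglueE)
    case (left W q)
    have q: "fst (q w) \<in> f ` Y \<and> P1 (\<xi> w) = lift (q w)" if w: "w \<in> W" for w
    proof -
      have "sw (fst (\<xi> w)) = Inr (x w)"
        using base[of w] left(3) w by (auto simp: sw_i1)
      then have "bproj DG (glue_map (over D2 (f ` Y)) lift (Inl (q w))) = Inr (x w)"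
        using \<Phi>_bproj[of "\<xi> w"] left(5)[OF w] by simp
      then have "fst (q w) \<in> f ` Y"
        using glue_lift_bproj[OF plots_in[OF T2 left(4) w]] by (auto simp: switch_map_def split: if_splits)
      then show ?thesis
        using left(5)[OF w] glue_lift[OF plots_in[OF T2 left(4) w]] by (simp add: P1_def)
    qed
    have "plots (tot D1) m W (\<lambda>u. P1 (\<xi> u))"
      by (rule plots_cong[OF T1 lift_plots[OF left(4)]]) (use q in simp_all)
    with left show ?thesis by (intro exI[of _ W] conjI)
  next
    case (right W q)
    have "plots (tot D1) m W (\<lambda>u. P1 (\<xi> u))"
      by (rule plots_cong[OF T1 right(4)]) (simp add: P1_def right(5))
    with right show ?thesis by (intro exI[of _ W] conjI)
  qed
qed

text \<open>A lift to \<open>D1\<close> on a neighbourhood of \<open>u\<close> would project to a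
  lift of the base curve, which \<open>no\<close> excludes. The local lift is therefore to
  \<open>D2\<close>, and \<open>B2\<close> recovers \<xi> from it.\<close>

lemma B2_lift_plot:
  assumes \<xi>: "plots (tot dG) m U \<xi>" and u: "u \<in> U"
    and no: "\<And>W x. openin (Euclidean_space m) W \<Longrightarrow> u \<in> W \<Longrightarrow> W \<subseteq> U \<Longrightarrow> plots (base V1) m W x \<Longrightarrow>
      \<exists>w\<in>W. fst (\<xi> w) \<noteq> i1 (x w)"
  shows "\<exists>W \<eta>. openin (Euclidean_space m) W \<and> u \<in> W \<and> W \<subseteq> U \<and> plots (tot D2) m W \<eta> \<and> (\<forall>w\<in>W. \<xi> w = B2 (\<eta> w))"
proof -
  note T1 = pseudo_bundle_tot[OF D1] and T2 = pseudo_bundle_tot[OF D2] and TG = pseudo_bundle_tot[OF dG]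
  from T2 T1 \<Phi>_plots[OF \<xi>, unfolded tot_DG] u show ?thesis
  proof (cases rule: plots_dglueE)
    case (left W q)
    have "\<xi> w = B2 (q w)" if "w \<in> W" for w
    proof -
      have "\<xi> w \<in> pts (tot dG)" using plots_in[OF TG \<xi>, of w] left(3) that by blast
      then have "inv_into (pts (tot dG)) \<Phi> (\<Phi> (\<xi> w)) = \<xi> w"
        using \<Phi>_bij by (simp add: bij_betw_def)
      then show ?thesis by (simp add: B2_def left(5)[OF that])
    qed
    with left show ?thesis by (intro exI[of _ W] exI[of _ q] conjI ballI)
  next
    case (right W q)
    have "fst (\<xi> w) = i1 (fst (q w))" if w: "w \<in> W" for w
    proof -
      have x: "fst (q w) \<in> pts (base V1)" by (rule pts_dual_base[OF plots_in[OF T1 right(4) w]])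
      have c: "fst (\<xi> w) \<in> pts (base G)"
        using pts_dual_base[OF plots_in[OF TG \<xi>, of w]] right(3) w by blast
      have "sw (fst (\<xi> w)) = sw (i1 (fst (q w)))"
        using \<Phi>_bproj[of "\<xi> w"] right(5)[OF w] x by (simp add: bproj_DG sw_i1)
      then show ?thesis by (rule sw_inj[OF c i1_base[OF x]])
    qed
    moreover have "plots (base V1) m W (\<lambda>w. fst (q w))"
      using pseudo_bundle_plots_bproj[OF D1 right(4)] by simp
    ultimately show ?thesis using no[OF right(1-3)] by blast
  qed
qed

text \<open>Each of the finitely many covector plots in the sum lifts on its own neighbourhood of
  \<open>u\<close>, and these are intersected term by term. Smallness does no harm, since
  \<open>no\<close> speaks of every neighbourhood of \<open>u\<close> in \<open>W\<close>.\<close>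

lemma tplot_B2_lift:
  assumes W: "openin (Euclidean_space m) W" and u: "u \<in> W" and a: "tplot dG n m W c a"
    and c: "\<And>w. w \<in> W \<Longrightarrow> c w = Inr (x w)"
    and no: "\<And>S y. openin (Euclidean_space m) S \<Longrightarrow> u \<in> S \<Longrightarrow> S \<subseteq> W \<Longrightarrow> plots (base V1) m S y \<Longrightarrow>
      \<exists>w\<in>S. c w \<noteq> i1 (y w)"
  shows "\<exists>S b. openin (Euclidean_space m) S \<and> u \<in> S \<and> S \<subseteq> W \<and> tplot D2 n m S x b \<and> (\<forall>w\<in>S. a w = push B2 (b w))"
  using a
proof induction
  case zero
  show ?case
    using W u by (intro exI[of _ W] exI[of _ "\<lambda>_. 0"]) (simp add: tplot.zero linear_0[OF linear_push])
next
  case (step a r q)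
  note T2 = pseudo_bundle_tot[OF D2]
  from step.IH obtain S b where S: "openin (Euclidean_space m) S" "u \<in> S" "S \<subseteq> W" "tplot D2 n m S x b"
    "\<forall>w\<in>S. a w = push B2 (b w)" by (elim exE conjE)
  \<comment> \<open>The pair \<open>P\<close> consists of a neighbourhood and of the lift on
    it.\<close>
  have "\<forall>i. \<exists>P. i < n \<longrightarrow> openin (Euclidean_space m) (fst P) \<and> u \<in> fst P \<and> fst P \<subseteq> W \<and>
      plots (tot D2) m (fst P) (snd P) \<and> (\<forall>w\<in>fst P. q w ! i = B2 (snd P w))"
  proof
    fix i
    show "\<exists>P. i < n \<longrightarrow> openin (Euclidean_space m) (fst P) \<and> u \<in> fst P \<and> fst P \<subseteq> W \<and>
      plots (tot D2) m (fst P) (snd P) \<and> (\<forall>w\<in>fst P. q w ! i = B2 (snd P w))"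
    proof (cases "i < n")
      case True
      have fq: "fst (q w ! i) = c w" if "w \<in> W" for w
        using step.hyps(5)[OF that True] by simp
      have "\<exists>W' \<eta>. openin (Euclidean_space m) W' \<and> u \<in> W' \<and> W' \<subseteq> W \<and> plots (tot D2) m W' \<eta> \<and> (\<forall>w\<in>W'. q w ! i = B2 (\<eta> w))"
      proof (rule B2_lift_plot[OF step.hyps(4)[OF True] u])
        fix S y assume S: "openin (Euclidean_space m) S" "u \<in> S" "S \<subseteq> W" "plots (base V1) m S y"
        from no[OF this] obtain w where "w \<in> S" "c w \<noteq> i1 (y w)" by blast
        moreover have "fst (q w ! i) = c w" using fq[of w] S(3) \<open>w \<in> S\<close> by blast
        ultimately show "\<exists>w\<in>S. fst (q w ! i) \<noteq> i1 (y w)" by (intro bexI[of _ w]) simp_all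
      qed
      then obtain W' \<eta> where "openin (Euclidean_space m) W' \<and> u \<in> W' \<and> W' \<subseteq> W \<and> plots (tot D2) m W' \<eta> \<and> (\<forall>w\<in>W'. q w ! i = B2 (\<eta> w))"
        by (elim exE)
      then show ?thesis by (intro exI[of _ "(W', \<eta>)"]) simp
    qed simp
  qed
  from choice[OF this] obtain P where P: "\<forall>i. i < n \<longrightarrow> openin (Euclidean_space m) (fst (P i)) \<and> u \<in> fst (P i) \<and> fst (P i) \<subseteq> W \<and>
      plots (tot D2) m (fst (P i)) (snd (P i)) \<and> (\<forall>w\<in>fst (P i). q w ! i = B2 (snd (P i) w))" ..
  note P = this[rule_format]
  let ?S = "S \<inter> (\<Inter>i<n. fst (P i))"
  let ?q = "\<lambda>w. map (\<lambda>i. snd (P i) w) [0..<n]"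
  have o: "openin (Euclidean_space m) ?S"
    by (rule openin_Int_INT_lessThan[OF S(1)]) (simp add: P)
  have sub: "?S \<subseteq> fst (P i)" if "i < n" for i using that by blast
  have eq: "map B2 (?q w) = q w" if "w \<in> ?S" for w
  proof (rule nth_equalityI)
    show "length (map B2 (?q w)) = length (q w)"
      using step.hyps(3)[of w] S(3) that by auto
    fix i assume "i < length (map B2 (?q w))"
    then have i: "i < n" by simp
    have "q w ! i = B2 (snd (P i) w)"
      using P[OF i] sub[OF i] that by blast
    then show "map B2 (?q w) ! i = q w ! i" using i by simp
  qed
  have "tplot D2 n m ?S x (\<lambda>w. b w + r w *\<^sub>R gen (?q w))"
  proof (rule tplot.step[OF tplot_subset[OF T2 S(1) o _ S(4)]])
    show "smooth_fun m ?S r" by (rule smooth_fun_subset[OF step.hyps(2)]) (use S(3) in blast)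
    fix i assume i: "i < n"
    have "plots (tot D2) m ?S (snd (P i))"
      by (rule plots_subset[OF T2 _ o sub[OF i]]) (simp add: P[OF i])
    then show "plots (tot D2) m ?S (\<lambda>w. ?q w ! i)" using i by simp
    fix w assume w: "w \<in> ?S"
    let ?e = "snd (P i) w"
    have e: "?e \<in> pts (tot D2)" by (rule plots_in[OF T2 \<open>plots (tot D2) m ?S (snd (P i))\<close> w])
    have wW: "w \<in> W" using w S(3) by blast
    \<comment> \<open>\<open>B2\<close> covers the injective map \<open>Inr\<close>, so the lift is
      over the prescribed curve \<open>x\<close>, as \<open>tplot\<close> demands of all its
      factors.\<close>
    have "B2 ?e \<in> vert dG (Inr (fst ?e))"
      using linear_mapD(3)[OF B2_linear[OF pts_dual_base[OF e]], of ?e] e by (simp add: vert_def)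
    moreover have "q w ! i = B2 ?e" using P[OF i] sub[OF i] w by blast
    ultimately have "c w = Inr (fst ?e)"
      using step.hyps(5)[OF wW i] by (simp add: vert_def)
    then show "bproj D2 (?q w ! i) = x w" using c[OF wW] i by simp
  qed auto
  moreover have "\<forall>w\<in>?S. a w + r w *\<^sub>R gen (q w) = push B2 (b w + r w *\<^sub>R gen (?q w))"
    using S(5) eq by (simp add: linear_add[OF linear_push] linear_scale[OF linear_push])
  ultimately show ?case using o S(2,3) P
    by (intro exI[of _ ?S] exI[of _ "\<lambda>w. b w + r w *\<^sub>R gen (?q w)"] conjI) auto
qed


text \<open>The dimension bound concerns the duals of \<open>V1\<close> and \<open>V2\<close>. It
  reaches the dual of the gluing through the isomorphisms of exterior powers on the fibres.\<close>

lemma vanish_G: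
  assumes c: "c \<in> pts (base G)" and w: "w \<in> vert EG c" and n: "k < n"
  shows "w n = tcls dG n c 0"
  using c
proof (cases rule: sw_cases)
  case (left x)
  then have w': "w \<in> vert EG (i1 x)" using w by simp
  have "ext_map D1 \<phi>1 P1 w n = tcls D1 n x 0"
    by (rule vanish1[OF left(1) n ext_comp[OF _ Q1_vert[OF left(1) w']]]) (simp add: left(1))
  then have "ext_map dG i1 B1 (ext_map D1 \<phi>1 P1 w) n = tcls dG n (i1 x) 0"
    using tensor_power_map_tcls[where W = dG and \<phi> = i1 and a = 0 and n = n, OF B1_linear[OF left(1)]]
    by (simp add: ext_map_def linear_0[OF linear_push])
  then show ?thesis by (simp add: R1_Q1[OF left(1) w'] left(2))
next
  case (right x)
  then have w': "w \<in> vert EG (Inr x)" using w by simp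
  have "ext_map D2 \<phi>2 P2 w n = tcls D2 n x 0"
    by (rule vanish2[OF right(1) n ext_comp[OF _ Q2_vert[OF right(1,2) w']]]) (simp add: right(1))
  then have "ext_map dG Inr B2 (ext_map D2 \<phi>2 P2 w) n = tcls dG n (Inr x) 0"
    using tensor_power_map_tcls[where W = dG and \<phi> = Inr and a = 0 and n = n, OF B2_linear[OF right(1)]]
    by (simp add: ext_map_def linear_0[OF linear_push])
  then show ?thesis by (simp add: R2_Q2[OF right(1,2) w'] right(3))
qed

lemma H_diff: "diffeological (tot H)"
  unfolding glue_bundle_simps by (rule diffeological_dglue[OF E_diff(2,1)])

text \<open>Along a base curve that lifts to the base of \<open>V1\<close>, \<Theta> is the map
  induced by \<open>P1\<close> followed by the inclusion \<open>Inr\<close>, and over such a curve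
  \<open>P1\<close> preserves plots.\<close>

lemma \<Theta>_plots_left:
  assumes p: "plots (tot EG) m W p" and x: "plots (base V1) m W x" and c: "\<And>w. w \<in> W \<Longrightarrow> fst (p w 0) = i1 (x w)"
  shows "plots (tot H) m W (\<lambda>w. \<Theta> (p w))"
proof -
  have xin: "x w \<in> pts (base V1)" if "w \<in> W" for w
    by (rule plots_in[OF pseudo_bundle_base[OF V1] x that])
  have "plots (tot E1) m W (\<lambda>w. ext_map D1 \<phi>1 P1 (p w))"
  proof (rule ext_map_plots[OF dG D1 p])
    show "linear_map class_ring (fibre dG (fst (p w 0))) (fibre D1 (\<phi>1 (fst (p w 0)))) P1" if "w \<in> W" for w
      unfolding c[OF that] by (rule P1_linear'[OF xin[OF that]])
    show "plots (base D1) m W (\<lambda>w. \<phi>1 (fst (p w 0)))"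
      unfolding base_D
      by (rule plots_cong[OF pseudo_bundle_base[OF V1] x]) (simp add: c \<phi>1_i1 xin)
    fix S q assume S: "S \<subseteq> W" "plots (tot dG) m S q" "\<And>w. w \<in> S \<Longrightarrow> bproj dG (q w) = fst (p w 0)"
    show "plots (tot D1) m S (\<lambda>w. P1 (q w))"
    proof (rule P1_plots[OF S(2)])
      fix w assume w: "w \<in> S"
      then have "w \<in> W" using S(1) by blast
      then show "x w \<in> pts (base V1) \<and> fst (q w) = i1 (x w)"
        using S(3)[OF w] c xin by simp
    qed
  qed
  from plots_dglue_right[OF E_diff(2,1) this]
  have "plots (tot H) m W (\<lambda>w. Inr (ext_map D1 \<phi>1 P1 (p w)))" by simp
  then show ?thesis
  proof (rule plots_cong[OF H_diff])
    fix w assume w: "w \<in> W"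
    have "p w \<in> vert EG (i1 (x w))"
      using EG_vert[OF plots_in[OF E_diff(3) p w]] c[OF w] by simp
    then show "\<Theta> (p w) = Inr (ext_map D1 \<phi>1 P1 (p w))"
      by (rule \<Theta>_left[OF xin[OF w]])
  qed
qed

text \<open>Over the glued region the local lifts of the components to \<open>V\<^sub>2\<close> need not be alternating, so
  they are alternated; this does not change their images.\<close>

lemma \<Theta>_plots_right:
  assumes W: "openin (Euclidean_space m) W" and u: "u \<in> W" and p: "plots (tot EG) m W p"
    and x: "plots (base V2) m W x" and c: "\<And>w. w \<in> W \<Longrightarrow> fst (p w 0) = Inr (x w)"
    and no: "\<And>S y. openin (Euclidean_space m) S \<Longrightarrow> u \<in> S \<Longrightarrow> S \<subseteq> W \<Longrightarrow> plots (base V1) m S y \<Longrightarrow>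
      \<exists>w\<in>S. fst (p w 0) \<noteq> i1 (y w)"
  shows "\<exists>S. openin (Euclidean_space m) S \<and> u \<in> S \<and> S \<subseteq> W \<and> plots (tot H) m S (\<lambda>w. \<Theta> (p w))"
proof -
  note T2 = pseudo_bundle_tot[OF D2] and TG = pseudo_bundle_tot[OF dG]
  have xin: "x w \<in> pts (base V2)" if "w \<in> W" for w
    by (rule plots_in[OF pseudo_bundle_base[OF V2] x that])
  have pv: "p w \<in> vert EG (Inr (x w))" if "w \<in> W" for w
    using EG_vert[OF plots_in[OF E_diff(3) p that]] c[OF that] by simp
  have base: "Inr (x w) \<in> pts (base dG)" if "w \<in> W" for w
    using Inr_base_G[OF xin[OF that]] by simp
  have fst: "fst (p w n) = Inr (x w)" if "w \<in> W" for w n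
    by (rule contra_ext_comp[OF base[OF that] pv[OF that], of n]) simp
  have "\<forall>n. \<exists>P. openin (Euclidean_space m) (fst P) \<and> u \<in> fst P \<and> fst P \<subseteq> W \<and> tplot D2 n m (fst P) x (snd P) \<and>
      (\<forall>w\<in>fst P. p w n = tcls dG n (Inr (x w)) (push B2 (snd P w)))"
  proof
    fix n
    have pn: "plots (tensor_diff dG n) m W (\<lambda>w. p w n)"
      using p[unfolded plots_contra_ext, THEN conjunct2, THEN conjunct2, rule_format, of n]
      by (simp add: plots_ext_power tensor_power_simps[OF dG] del: glue_bundle_simps)
    show "\<exists>P. openin (Euclidean_space m) (fst P) \<and> u \<in> fst P \<and> fst P \<subseteq> W \<and> tplot D2 n m (fst P) x (snd P) \<and>
      (\<forall>w\<in>fst P. p w n = tcls dG n (Inr (x w)) (push B2 (snd P w)))"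
      using pn u
    proof (rule plots_tensor_diffE)
      fix S a assume S: "openin (Euclidean_space m) S" "u \<in> S" "S \<subseteq> W" "tplot dG n m S (\<lambda>w. fst (p w n)) a"
        and e: "\<And>w. w \<in> S \<Longrightarrow> p w n = tcls dG n (fst (p w n)) (a w)"
      have fS: "fst (p w n) = Inr (x w)" if "w \<in> S" for w
        using fst[of w n] S(3) that by blast
      have noS: "\<exists>w\<in>R. fst (p w n) \<noteq> i1 (y w)"
        if R: "openin (Euclidean_space m) R" "u \<in> R" "R \<subseteq> S" "plots (base V1) m R y" for R y
      proof -
        have "R \<subseteq> W" using R(3) S(3) by blast
        from no[OF R(1,2) this R(4)] obtain w where w: "w \<in> R" "fst (p w 0) \<noteq> i1 (y w)" by blast
        moreover have "fst (p w n) = fst (p w 0)"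
          using fst[of w n] fst[of w 0] \<open>R \<subseteq> W\<close> w(1) by auto
        ultimately show ?thesis by (intro bexI[of _ w]) simp_all
      qed
      have "\<exists>R b. openin (Euclidean_space m) R \<and> u \<in> R \<and> R \<subseteq> S \<and> tplot D2 n m R x b \<and>
          (\<forall>w\<in>R. a w = push B2 (b w))"
        by (rule tplot_B2_lift[OF S(1,2,4)]) (fact fS, fact noS)
      then obtain R b where R: "openin (Euclidean_space m) R" "u \<in> R" "R \<subseteq> S"
        "tplot D2 n m R x b" "\<forall>w\<in>R. a w = push B2 (b w)" by (elim exE conjE)
      have "p w n = tcls dG n (Inr (x w)) (push B2 (b w))" if "w \<in> R" for w
      proof -
        have "w \<in> S" using R(3) that by blast
        then show ?thesis using e[of w] fS[of w] R(5) that by simp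
      qed
      then show ?thesis using R S(3) by (intro exI[of _ "(R, b)"]) auto
    qed
  qed
  from choice[OF this] obtain P where P: "\<forall>n. openin (Euclidean_space m) (fst (P n)) \<and> u \<in> fst (P n) \<and> fst (P n) \<subseteq> W \<and>
      tplot D2 n m (fst (P n)) x (snd (P n)) \<and>
      (\<forall>w\<in>fst (P n). p w n = tcls dG n (Inr (x w)) (push B2 (snd (P n) w)))" ..
  \<comment> \<open>One neighbourhood for each of the degrees 0 to \<open>k\<close>; this finite
    intersection is where the dimension bound is used.\<close>
  let ?S = "W \<inter> (\<Inter>n<Suc k. fst (P n))"
  \<comment> \<open>Alternated lifts up to degree \<open>k\<close> and zero above it, so that all
    components are alternating and finitely many are nonzero.\<close>
  define z where "z w n = (if n \<le> k then tcls D2 n (x w) (alt_op n (snd (P n) w)) else tcls D2 n (x w) 0)" for w n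
  have o: "openin (Euclidean_space m) ?S"
    by (rule openin_Int_INT_lessThan[OF W]) (simp add: P)
  have sub: "?S \<subseteq> fst (P n)" if "n \<le> k" for n using that by (auto simp: less_Suc_eq_le)
  have tp: "tplot D2 n m ?S x (snd (P n))" if "n \<le> k" for n
    by (rule tplot_subset[OF T2 _ o sub[OF that]]) (simp_all add: P)
  have span: "snd (P n) w \<in> tspan D2 n (x w)" if "n \<le> k" "w \<in> ?S" for n w
    by (rule tplot_span[OF T2 tp[OF that(1)] that(2)])
  have zn: "z w n \<in> vert (ext_power D2 n) (x w)" if "w \<in> ?S" for w n
  proof -
    have x': "x w \<in> pts (base D2)" using xin that by simp
    show ?thesis
      unfolding z_def using span[OF _ that, of n]
      by (auto intro!: vert_ext_powerI[OF x'] alt_op_tuples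
          simp: alt_op_idem real_vector.span_zero linear_0[OF linear_alt_op])
  qed
  have zv: "z w \<in> vert E2 (x w)" if "w \<in> ?S" for w
  proof -
    have x': "x w \<in> pts (base D2)" using xin that by simp
    have "{n. z w n \<noteq> vzero (tensor_power D2 n) (x w)} \<subseteq> {..k}"
      by (auto simp: z_def tensor_power_simps[OF D2])
    then show ?thesis
      unfolding vert_contra_ext[OF x'] using zn[OF that] finite_subset by blast
  qed
  have zp: "plots (tot E2) m ?S z"
    unfolding plots_contra_ext plots_ext_power
  proof (intro conjI ballI allI o)
    show "z w \<in> pts (tot E2)" if "w \<in> ?S" for w
      by (rule vert_in_tot[OF zv[OF that]])
    fix n
    show "z w n \<in> Alt D2 n ` tensor_pts D2 n" if "w \<in> ?S" for w
      using vert_in_tot[OF zn[OF that]] unfolding pts_ext_power .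
    show "plots (tot (tensor_power D2 n)) m ?S (\<lambda>w. z w n)"
      unfolding tensor_power_simps(2)[OF D2]
    proof (rule plots_tensor_diffI[OF o])
      have "plots (base V2) m ?S x"
        by (rule plots_subset[OF pseudo_bundle_base[OF V2] x o]) blast
      moreover have "fst (z w n) = x w" for w by (simp add: z_def)
      ultimately show "plots (base D2) m ?S (\<lambda>w. fst (z w n))" by simp
      show "\<exists>R y a. openin (Euclidean_space m) R \<and> v \<in> R \<and> R \<subseteq> ?S \<and> tplot D2 n m R y a \<and>
          (\<forall>w\<in>R. z w n = tcls D2 n (y w) (a w))" if "v \<in> ?S" for v
      proof (cases "n \<le> k")
        case True
        show ?thesis
          using o that tplot_alt_op[OF tp[OF True] T2]
          by (intro exI[of _ ?S] exI[of _ x] exI[of _ "\<lambda>w. alt_op n (snd (P n) w)"] conjI ballI) (simp_all add: z_def True)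
      next
        case False
        show ?thesis
          using o that
          by (intro exI[of _ ?S] exI[of _ x] exI[of _ "\<lambda>w. 0"] conjI ballI) (simp_all add: z_def False tplot.zero)
      qed
    qed
  qed
  have eq: "ext_map dG Inr B2 (z w) = p w" if w: "w \<in> ?S" for w
  proof
    fix n
    have wW: "w \<in> W" using w by blast
    note t = tensor_power_map_tcls[where W = dG and \<phi> = Inr, OF B2_linear[OF xin[OF wW]]]
    show "ext_map dG Inr B2 (z w) n = p w n"
    proof (cases "n \<le> k")
      case True
      obtain a where a: "alt_op n a = a" "p w n = tcls dG n (Inr (x w)) a"
        by (rule contra_ext_comp[OF base[OF wW] pv[OF wW], of n])
      \<comment> \<open>The component is fixed by \<open>Alt\<close>, so alternating the image of
        the lift, which represents it, gives the same class.\<close>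
      have "Alt dG n (p w n) = p w n"
        unfolding a(2) Alt_tcls a(1) ..
      moreover have "p w n = tcls dG n (Inr (x w)) (push B2 (snd (P n) w))"
        using P sub[OF True] w by blast
      ultimately have "tcls dG n (Inr (x w)) (alt_op n (push B2 (snd (P n) w))) = p w n"
        by (simp add: Alt_tcls)
      then show ?thesis
        by (simp add: ext_map_def z_def True t alt_op_push[OF span[OF True w]])
    next
      case False
      then show ?thesis
        \<comment> \<open>Above degree \<open>k\<close> the given component is zero as well and
          matches the chosen value of \<open>z\<close>.\<close>
        using vanish_G[OF Inr_base_G[OF xin[OF wW]] pv[OF wW], of n]
        by (simp add: ext_map_def z_def t linear_0[OF linear_push])
    qed
  qed
  have "plots (tot H) m ?S (\<lambda>w. glue_map (over E2 (f ` Y)) elift (Inl (z w)))"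
    using plots_dglue_left[OF E_diff(2,1) zp] by simp
  then have "plots (tot H) m ?S (\<lambda>w. \<Theta> (p w))"
  proof (rule plots_cong[OF H_diff])
    fix w assume w: "w \<in> ?S"
    then have "w \<in> W" by blast
    from \<Theta>_glue[OF xin[OF this] zv[OF w]]
    show "\<Theta> (p w) = glue_map (over E2 (f ` Y)) elift (Inl (z w))"
      unfolding eq[OF w] .
  qed
  moreover have "u \<in> ?S" using u P by blast
  ultimately show ?thesis using o by (intro exI[of _ ?S] conjI) auto
qed

text \<open>The case distinction asks whether the base curve lifts to the base of \<open>V1\<close>
  on some neighbourhood of \<open>u\<close>. Its negation is as strong as needed: it rules out lifts
  to that side of all covectors over the curve, on every neighbourhood.\<close>

lemma \<Theta>_plots:
  assumes p: "plots (tot EG) m U p"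
  shows "plots (tot H) m U (\<lambda>u. \<Theta> (p u))"
proof (rule plots_local[OF H_diff plots_open[OF E_diff(3) p]])
  note B1' = pseudo_bundle_base[OF V1] and B2' = pseudo_bundle_base[OF V2]
  have c: "plots (base G) m U (\<lambda>u. fst (p u 0))"
    using contra_ext_base_plot[OF dG p] by simp
  fix u assume u: "u \<in> U"
  show "\<exists>S. openin (Euclidean_space m) S \<and> u \<in> S \<and> S \<subseteq> U \<and> plots (tot H) m S (\<lambda>w. \<Theta> (p w))"
  proof (cases "\<exists>W x. openin (Euclidean_space m) W \<and> u \<in> W \<and> W \<subseteq> U \<and> plots (base V1) m W x \<and>
      (\<forall>w\<in>W. fst (p w 0) = i1 (x w))")
    case True
    then obtain W x where W: "openin (Euclidean_space m) W" "u \<in> W" "W \<subseteq> U" "plots (base V1) m W x"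
      "\<forall>w\<in>W. fst (p w 0) = i1 (x w)" by (elim exE conjE)
    have "plots (tot H) m W (\<lambda>w. \<Theta> (p w))"
      by (rule \<Theta>_plots_left[OF plots_subset[OF E_diff(3) p W(1,3)] W(4)]) (simp add: W(5))
    with W(1-3) show ?thesis by (intro exI[of _ W] conjI)
  next
    case False
    have no: "\<exists>w\<in>S. fst (p w 0) \<noteq> i1 (y w)"
      if S: "openin (Euclidean_space m) S" "u \<in> S" "S \<subseteq> U" "plots (base V1) m S y" for S y
    proof (rule ccontr)
      assume "\<not> (\<exists>w\<in>S. fst (p w 0) \<noteq> i1 (y w))"
      then have "\<forall>w\<in>S. fst (p w 0) = i1 (y w)" by blast
      with S have "\<exists>W x. openin (Euclidean_space m) W \<and> u \<in> W \<and> W \<subseteq> U \<and> plots (base V1) m W x \<and>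
          (\<forall>w\<in>W. fst (p w 0) = i1 (x w))"
        by (intro exI[of _ S] exI[of _ y] conjI)
      with False show False by (rule notE)
    qed
    have cin: "fst (p w 0) \<in> pts (base G)" if "w \<in> U" for w
      by (rule plots_in[OF G_base c that])
    \<comment> \<open>A local lift of the switched base curve is, by injectivity of the switch map,
      a lift of the base curve itself; the one to the base of \<open>V1\<close> contradicts
      \<open>no\<close>.\<close>
    from B2' B1' sw_plots[OF c, unfolded base_DG] u show ?thesis
    proof (cases rule: plots_dglueE)
      case (left W x)
      have cx: "fst (p w 0) = Inr (x w)" if w: "w \<in> W" for w
      proof (rule sw_inj[OF cin Inr_base_G])
        show "w \<in> U" using left(3) w by blast
        show "x w \<in> pts (base V2)" by (rule plots_in[OF B2' left(4) w])
        show "sw (fst (p w 0)) = sw (Inr (x w))" unfolding sw_Inr by (rule left(5)[OF w])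
      qed
      have "\<exists>S. openin (Euclidean_space m) S \<and> u \<in> S \<and> S \<subseteq> W \<and> plots (tot H) m S (\<lambda>w. \<Theta> (p w))"
      proof (rule \<Theta>_plots_right[OF left(1,2) plots_subset[OF E_diff(3) p left(1,3)] left(4) cx])
        fix S y assume S: "openin (Euclidean_space m) S" "u \<in> S" "S \<subseteq> W" "plots (base V1) m S y"
        show "\<exists>w\<in>S. fst (p w 0) \<noteq> i1 (y w)"
          by (rule no[OF S(1,2) _ S(4)]) (use S(3) left(3) in blast)
      qed
      then obtain S where "openin (Euclidean_space m) S" "u \<in> S" "S \<subseteq> W" "plots (tot H) m S (\<lambda>w. \<Theta> (p w))"
        by (elim exE conjE)
      with left(3) show ?thesis by (intro exI[of _ S] conjI) auto
    next
      case (right W x)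
      from no[OF right(1-4)] obtain w where w: "w \<in> W" "fst (p w 0) \<noteq> i1 (x w)" by (elim bexE)
      have x: "x w \<in> pts (base V1)" by (rule plots_in[OF B1' right(4) w(1)])
      have "w \<in> U" using right(3) w(1) by blast
      from sw_inj[OF cin[OF this] i1_base[OF x]] right(5)[OF w(1)] sw_i1[OF x] w(2)
      show ?thesis by simp
    qed
  qed
qed

lemma \<Theta>_ddiffeo: "ddiffeo (tot EG) (tot H) \<Theta>"
  unfolding ddiffeo_def
proof (intro conjI)
  show "bij_betw \<Theta> (pts (tot EG)) (pts (tot H))" by (rule \<Theta>_bij)
  show "dsmooth (tot EG) (tot H) \<Theta>"
    by (rule dsmoothI[OF bij_betw_apply[OF \<Theta>_bij] \<Theta>_plots])
  have inv: "inv_into (pts (tot EG)) \<Theta> b = \<Omega> b" if "b \<in> pts (tot H)" for b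
    using \<Omega>_pts[OF that] \<Theta>_bij inv_into_f_eq[of \<Theta> "pts (tot EG)" "\<Omega> b" b] by (simp add: bij_betw_def)
  show "dsmooth (tot H) (tot EG) (inv_into (pts (tot EG)) \<Theta>)"
  proof (rule dsmoothI)
    show "inv_into (pts (tot EG)) \<Theta> b \<in> pts (tot EG)" if "b \<in> pts (tot H)" for b
      unfolding inv[OF that] using \<Omega>_pts[OF that] by blast
    fix m U p assume p: "plots (tot H) m U p"
    show "plots (tot EG) m U (\<lambda>u. inv_into (pts (tot EG)) \<Theta> (p u))"
      by (rule plots_cong[OF E_diff(3) \<Omega>_plots[OF p]]) (rule inv[OF plots_in[OF H_diff p]])
  qed
qed

lemma \<Theta>_linear:
  assumes c: "c \<in> pts (base G)"
  shows "linear_map class_ring (fibre EG c) (fibre H (sw c)) \<Theta>"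
  using c
proof (cases rule: sw_cases)
  case (left x)
  have "linear_map class_ring (fibre E1 x) (fibre H (Inr x)) Inr"
    by (rule linear_map_Inr_glue[of E2 "f ` Y" elift E1, OF elift_over vectorspace_contra_ext[OF D1]]) (simp_all add: left(1))
  moreover have "linear_map class_ring (fibre EG (i1 x)) (fibre E1 x) (ext_map D1 \<phi>1 P1)"
    using ext_map_linear[where \<phi> = \<phi>1, OF dG D1 _ _ P1_linear'[OF left(1)]] left(1) i1_base[OF left(1)] \<phi>1_i1[OF left(1)]
    by simp
  ultimately have "linear_map class_ring (fibre EG (i1 x)) (fibre H (Inr x)) (\<lambda>w. Inr (ext_map D1 \<phi>1 P1 w))"
    by (rule linear_map_compose[rotated])
  then have "linear_map class_ring (fibre EG (i1 x)) (fibre H (Inr x)) \<Theta>"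
    by (rule linear_map_cong) (simp add: \<Theta>_left[OF left(1)])
  then show ?thesis by (simp only: left(2) sw_i1[OF left(1)])
next
  case (right x)
  have sw: "sw (Inr x) = Inl x" using right(3,4) by simp
  have "linear_map class_ring (fibre E2 x) (fibre H (Inl x)) Inl"
    by (rule linear_map_Inl_glue[of E2 "f ` Y" elift E1, OF elift_over vectorspace_contra_ext[OF D2]]) (simp_all add: right(1,2))
  moreover have "linear_map class_ring (fibre EG (Inr x)) (fibre E2 x) (ext_map D2 \<phi>2 P2)"
    using ext_map_linear[where \<phi> = \<phi>2, OF dG D2 _ _ P2_linear'[OF right(1,2)]] right(1) Inr_base_G[OF right(1)] \<phi>2_Inr[OF right(2)]
    by simp
  ultimately have "linear_map class_ring (fibre EG (Inr x)) (fibre H (Inl x)) (\<lambda>w. Inl (ext_map D2 \<phi>2 P2 w))"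
    by (rule linear_map_compose[rotated])
  then have "linear_map class_ring (fibre EG (Inr x)) (fibre H (Inl x)) \<Theta>"
    by (rule linear_map_cong) (simp add: \<Theta>_right[OF right(1,2)])
  then show ?thesis by (simp only: right(3) sw)
qed

lemma \<Theta>_bundle_diffeo: "bundle_diffeo EG H \<Theta> sw"
  unfolding bundle_diffeo_def
proof (intro conjI ballI \<Theta>_ddiffeo)
  fix c assume "c \<in> pts (base EG)"
  then have c: "c \<in> pts (base G)" by (simp add: contra_ext_simps)
  show "sw c \<in> pts (base H)"
    using sw_base[OF c] by (simp add: base_DG contra_ext_simps)
  show "linear_map class_ring (fibre EG c) (fibre H (sw c)) \<Theta>" by (rule \<Theta>_linear[OF c])
qed

end

theorem theorem7p2:
  fixes V1 :: "('v1, 'x1) vbundle" and V2 :: "('v2, 'x2) vbundle"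
    and Y :: "'x1 set" and f :: "'x1 \<Rightarrow> 'x2" and F :: "'v1 \<Rightarrow> 'v2"
  assumes "pseudo_bundle V1" and "pseudo_bundle V2"
    and "finite_dim_bundle V1" and "finite_dim_bundle V2"
    and "bdd_above (fibre_dim V1 ` pts (base V1))"
    and "bdd_above (fibre_dim V2 ` pts (base V2))"
    and "gluing V1 V2 Y f F"
    and "ddiffeo (dsub (base V1) Y) (dsub (base V2) (f ` Y)) f"
    and "gluing_dual_commutes V1 V2 Y f F"
  shows "bundle_diffeo
           (ext_bundle (glue_bundle V1 V2 Y f F))
           (glue_bundle (ext_bundle V2) (ext_bundle V1) (f ` Y) (inv_into Y f) (ext_lift V1 Y f F))
           (\<Phi>_ext V1 V2 Y f F)
           (switch_map Y f)"
proof -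
  interpret ext_gluing V1 V2 Y f F
    by (intro ext_gluing.intro dual_gluing.intro ext_gluing_axioms.intro assms)
  show ?thesis unfolding ext_bundle_def by (rule \<Theta>_bundle_diffeo)
qed

end
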